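(* Consider the Zigzag discrete NLS model (nearest and next-to-nearest neighbour couplings of equal strength) on the periodic ring $\mathcal J=\{-N,\dots,N\}$ with $6\le N\le 10$, i.e. $\mathrm i\dot\psi_j=\partial H/\partial\overline{\psi_j}$ with $$H=\sum_{j\in\mathcal J}|\psi_j|^2+\tfrac12\sum_{j\in\mathcal J}|\psi_j|^4+\varepsilon\sum_{j\in\mathcal J}\bigl(|\psi_{j+1}-\psi_j|^2+|\psi_{j+2}-\psi_j|^2\bigr).$$ Let $S=\{0,1,2,3\}$, let $I^*>0$ be such that $\omega=1+I^*$ satisfies $k\omega\pm1\neq0$ and $k\omega\pm2\neq0$ for all $k\in\mathbb Z\setminus\{0\}$, and let $T=2\pi/\omega$. Write $q_2=\theta_1-\theta_0$, $q_3=\theta_2-\theta_1$, $q_4=\theta_3-\theta_2$. Then the eight unperturbed periodic orbits on the resonant torus (excited sites $S$, common action $I^*$) with $(q_2,q_3,q_4)\in\{0,\pi\}^3$ can all be continued to $\varepsilon>0$ small as $T$-periodic solutions. For $\varepsilon>0$ small, the continuation of $(0,0,0)$ is linearly stable, and the continuations of the other seven, namely $(0,0,\pi)$, $(\pi,0,0)$, $(\pi,0,\pi)$, $(0,\pi,0)$, $(0,\pi,\pi)$, $(\pi,\pi,0)$, $(\pi,\pi,\pi)$, are linearly unstable.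
   Context: Site indices are taken modulo $2N+1$ (periodic boundary conditions). At $\varepsilon=0$, the unperturbed periodic orbits on the resonant torus are $\psi^{(0)}_j(t)=\sqrt{I^*}\,e^{-\mathrm i(\omega t+\theta_j)}$ for $j\in S$ and $\psi^{(0)}_j(t)=0$ for $j\in\mathcal J\setminus S$; up to time translation they are labelled by the phase differences of the $\theta_j$. An unperturbed orbit "can be continued" if there is $\varepsilon^*>0$ such that for every $0<\varepsilon<\varepsilon^*$ the system has a $T$-periodic solution $\psi^{\varepsilon}$, with $\psi^\varepsilon\to\psi^{(0)}$ uniformly in $t$ as $\varepsilon\to0^+$. A periodic solution is linearly stable if all the Floquet multipliers of its monodromy matrix (over the period $T$, viewing the system as a real Hamiltonian system) lie on the unit circle, and linearly unstable if at least one Floquet multiplier lies outside the unit circle. *)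

theory Defs
  imports "HOL-Analysis.Analysis"
begin

text \<open>
  For a finite type \<open>'n\<close> with \<open>CARD('n) = N\<close>, the type \<open>'n bit1\<close> is the ring of integers modulo
  \<open>2 * N + 1\<close>; it is the ring of sites \<open>{-N, ..., N}\<close> with periodic boundary conditions, so
  \<open>j + 1\<close> and \<open>j + 2\<close> below are computed modulo \<open>2 * N + 1\<close>.
\<close>

type_synonym 'n state = "complex ^ ('n bit1)"

definition zigzag_ham :: "real \<Rightarrow> ('n::finite) state \<Rightarrow> real" where
  "zigzag_ham \<epsilon> \<psi> =
     (\<Sum>j\<in>UNIV. (cmod (\<psi> $ j))^2) + 1/2 * (\<Sum>j\<in>UNIV. (cmod (\<psi> $ j))^4)
     + \<epsilon> * (\<Sum>j\<in>UNIV. (cmod (\<psi> $ (j + 1) - \<psi> $ j))^2 + (cmod (\<psi> $ (j + 2) - \<psi> $ j))^2)"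

text \<open>The Wirtinger derivative with respect to the conjugate of the \<open>j\<close>-th variable,
  \<open>(\<partial>/\<partial>x\<^sub>j + \<i> \<partial>/\<partial>y\<^sub>j) / 2\<close> where \<open>\<psi>\<^sub>j = x\<^sub>j + \<i> y\<^sub>j\<close>.\<close>

definition wirtinger_cnj :: "(complex ^ 'j \<Rightarrow> real) \<Rightarrow> 'j::finite \<Rightarrow> complex ^ 'j \<Rightarrow> complex" where
  "wirtinger_cnj F j \<psi> =
     (complex_of_real (frechet_derivative F (at \<psi>) (axis j 1))
      + \<i> * complex_of_real (frechet_derivative F (at \<psi>) (axis j \<i>))) / 2"

definition zigzag_field :: "real \<Rightarrow> ('n::finite) state \<Rightarrow> 'n state" where
  "zigzag_field \<epsilon> \<psi> = (\<chi> j. wirtinger_cnj (zigzag_ham \<epsilon>) j \<psi> / \<i>)"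

definition zigzag_solution :: "real \<Rightarrow> (real \<Rightarrow> ('n::finite) state) \<Rightarrow> bool" where
  "zigzag_solution \<epsilon> \<psi> \<longleftrightarrow> (\<forall>t. (\<psi> has_vector_derivative zigzag_field \<epsilon> (\<psi> t)) (at t))"

definition periodic_solution :: "real \<Rightarrow> real \<Rightarrow> (real \<Rightarrow> ('n::finite) state) \<Rightarrow> bool" where
  "periodic_solution T \<epsilon> \<psi> \<longleftrightarrow> zigzag_solution \<epsilon> \<psi> \<and> (\<forall>t. \<psi> (t + T) = \<psi> t)"

definition unperturbed_orbit ::
    "real \<Rightarrow> real \<Rightarrow> ('n bit1 \<Rightarrow> real) \<Rightarrow> real \<Rightarrow> ('n::finite) state" where
  "unperturbed_orbit Istar \<omega> \<theta> t =
     (\<chi> j. if j \<in> {0, 1, 2, 3}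
           then complex_of_real (sqrt Istar) * exp (- \<i> * complex_of_real (\<omega> * t + \<theta> j))
           else 0)"

definition is_continuation ::
    "real \<Rightarrow> (real \<Rightarrow> ('n::finite) state) \<Rightarrow> (real \<Rightarrow> real \<Rightarrow> 'n state) \<Rightarrow> bool" where
  "is_continuation T \<psi>0 \<psi> \<longleftrightarrow>
     (\<exists>\<epsilon>star>0. \<forall>\<epsilon>. 0 < \<epsilon> \<and> \<epsilon> < \<epsilon>star \<longrightarrow> periodic_solution T \<epsilon> (\<psi> \<epsilon>))
     \<and> uniform_limit UNIV \<psi> \<psi>0 (at_right 0)"

definition can_be_continued :: "real \<Rightarrow> (real \<Rightarrow> ('n::finite) state) \<Rightarrow> bool" where
  "can_be_continued T \<psi>0 \<longleftrightarrow> (\<exists>\<psi>. is_continuation T \<psi>0 \<psi>)"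

text \<open>The real form of the system: the coordinates are \<open>Re \<psi>\<^sub>j\<close> (index \<open>Inl j\<close>) and
  \<open>Im \<psi>\<^sub>j\<close> (index \<open>Inr j\<close>).\<close>

definition to_real :: "complex ^ 'j \<Rightarrow> real ^ ('j::finite + 'j)" where
  "to_real \<psi> = (\<chi> k. case k of Inl j \<Rightarrow> Re (\<psi> $ j) | Inr j \<Rightarrow> Im (\<psi> $ j))"

definition from_real :: "real ^ ('j::finite + 'j) \<Rightarrow> complex ^ 'j" where
  "from_real x = (\<chi> j. Complex (x $ Inl j) (x $ Inr j))"

definition zigzag_real_field ::
    "real \<Rightarrow> real ^ ('n::finite bit1 + 'n bit1) \<Rightarrow> real ^ ('n bit1 + 'n bit1)" where
  "zigzag_real_field \<epsilon> x = to_real (zigzag_field \<epsilon> (from_real x))"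

text \<open>\<open>M\<close> is the value at time \<open>T\<close> of the fundamental matrix of the variational equation of
  \<open>x' = X x\<close> along the orbit \<open>x\<close>, normalised to be the identity at time 0.\<close>

definition is_monodromy ::
    "(real ^ 'k \<Rightarrow> real ^ 'k) \<Rightarrow> (real \<Rightarrow> real ^ 'k) \<Rightarrow> real \<Rightarrow> real ^ 'k ^ 'k::finite \<Rightarrow> bool" where
  "is_monodromy X x T M \<longleftrightarrow>
     (\<exists>\<Phi>. \<Phi> 0 = mat 1
        \<and> (\<forall>t. (\<Phi> has_vector_derivative
                  matrix (frechet_derivative X (at (x t))) ** \<Phi> t) (at t))
        \<and> M = \<Phi> T)"

definition floquet_multiplier :: "real ^ 'k ^ 'k::finite \<Rightarrow> complex \<Rightarrow> bool" where
  "floquet_multiplier M \<mu> \<longleftrightarrow>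
     (\<exists>v. v \<noteq> 0 \<and> (\<chi> i j. complex_of_real (M $ i $ j)) *v v = \<mu> *s v)"

text \<open>The monodromy matrix exists and is unique, the variational equation being linear with
  continuous coefficients; the existential form excludes vacuous truth in both definitions.\<close>

definition linearly_stable :: "real \<Rightarrow> real \<Rightarrow> (real \<Rightarrow> ('n::finite) state) \<Rightarrow> bool" where
  "linearly_stable T \<epsilon> \<psi> \<longleftrightarrow>
     (\<exists>M. is_monodromy (zigzag_real_field \<epsilon>) (\<lambda>t. to_real (\<psi> t)) T M
        \<and> (\<forall>\<mu>. floquet_multiplier M \<mu> \<longrightarrow> cmod \<mu> = 1))"

definition linearly_unstable :: "real \<Rightarrow> real \<Rightarrow> (real \<Rightarrow> ('n::finite) state) \<Rightarrow> bool" where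
  "linearly_unstable T \<epsilon> \<psi> \<longleftrightarrow>
     (\<exists>M. is_monodromy (zigzag_real_field \<epsilon>) (\<lambda>t. to_real (\<psi> t)) T M
        \<and> (\<exists>\<mu>. floquet_multiplier M \<mu> \<and> cmod \<mu> > 1))"

end

theory Submission
  imports Defs "HOL-Computational_Algebra.Fundamental_Theorem_Algebra"
begin

text \<open>The oscillators have frequency \<open>1 + |\<psi>\<^sub>j|\<^sup>2\<close>, the coupling is gauge invariant, and the sought period
\<open>T\<close> is that of the common rotation \<open>e\<^sup>-\<^sup>i\<^sup>\<omega>\<^sup>t\<close>. In the frame rotating with frequency \<open>\<omega>\<close> the equation
is still autonomous and each unperturbed orbit becomes an equilibrium. Three facts reduce the
theorem to linear algebra.

\<^item> Every \<open>T\<close>-periodic solution close to an unperturbed orbit is an exact rotating wave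
\<open>e\<^sup>-\<^sup>i\<^sup>\<omega>\<^sup>t \<phi>\<close> (\<open>periodic_near_equilibrium_constant\<close>): its velocity \<open>Y\<close> in the rotating frame solves
a linear equation close to that of the uncoupled system, whose only \<open>T\<close>-periodic response to a
forcing of size \<open>B\<close>, with \<open>Y\<close> itself the derivative of a periodic function, is of size \<open>O(B)\<close>. On the
empty sites this is the nonresonance \<open>k\<omega> \<noteq> 1\<close>; on the excited sites the linear part is nilpotent and
the theorem of Rolle suffices. The forcing is a small multiple of \<open>Y\<close>, hence \<open>Y = 0\<close>. This treats all
continuations at once, also where the phase Hessian is degenerate (for instance \<open>q\<^sub>3 = \<pi>\<close>) and
does not settle uniqueness of the continuation.

\<^item> Rotating waves with phases in \<open>{0, \<pi>}\<close> are real up to a global phase, and for real amplitudes the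
equilibrium equation is nondegenerate at \<open>\<epsilon> = 0\<close>. So they continue to small \<open>\<epsilon>\<close> (\<open>real_branch\<close>).

\<^item> The monodromy matrix of a rotating wave is \<open>exp (T A)\<close>, where \<open>A = - i Hess\<close> is a constant matrix
(\<open>monodromy_of_rotating_wave\<close>). So only the spectrum of \<open>A\<close> near \<open>\<epsilon> = 0\<close> is at stake.

With \<open>e = \<surd>\<epsilon>\<close>, the eigenvalues of \<open>A\<close> near \<open>0\<close> have size \<open>e\<close>. Measuring relative amplitudes on the excited sites
in units of \<open>e\<close> (\<open>rescale\<close>) makes the problem polynomial in \<open>(e, \<phi>)\<close> with a regular limit:
\<open>\<lambda>\<^sup>2 = - 2 I \<epsilon> \<kappa>\<close>, with \<open>\<kappa>\<close> an eigenvalue of the graph Laplacian of the four excited sites with bond weights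
\<open>cos (\<theta>\<^sub>j - \<theta>\<^sub>k)\<close> (\<open>bond_lap\<close>). For the seven configurations other than the in-phase one this signed Laplacian
has a simple negative eigenvalue (\<open>bond_lap_simple_negative\<close>), which gives a simple positive \<open>\<lambda>\<close>; it persists by
Brouwer's fixed point theorem (\<open>zero_persistence\<close>, \<open>unstable_direction\<close>).

In the in-phase case all weights are positive. If \<open>A\<close> had an eigenvalue off the imaginary axis, then both
the energy and the symplectic form would vanish on its eigenvector paired with the conjugate one (\<open>eigen_isotropic\<close>).
For an eigenvalue away from \<open>0\<close> the eigenvector lives on the empty sites with frequency close to \<open>I\<close>
or to \<open>- I\<close>, where the symplectic form is definite. For an eigenvalue close to \<open>0\<close> it lives on
the excited sites, where the energy is definite modulo the gauge direction \<open>i\<phi>\<close>. Either way this is a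
contradiction in the limit, and by compactness already for small \<open>\<epsilon>\<close> (\<open>no_fast_isotropic_mode\<close>,
\<open>no_slow_isotropic_mode\<close>).\<close>

section \<open>Persistence of zeros and of non-vanishing\<close>

text \<open>An implicit function theorem for existence only: \<open>x \<mapsto> x - D\<^sup>-\<^sup>1 G (p, x)\<close> maps a small ball around \<open>x0\<close> to
itself, so Brouwer applies. Differentiability is needed at the single point \<open>(p0, x0)\<close>, joint continuity
elsewhere.\<close>

lemma zero_persistence:
  fixes G :: "'p::metric_space \<times> 'a::euclidean_space \<Rightarrow> 'a"
  assumes cont: "continuous_on UNIV G"
    and zero: "G (p0, x0) = 0"
    and der: "((\<lambda>x. G (p0, x)) has_derivative D) (at x0)"
    and inj: "\<And>h. D h = 0 \<Longrightarrow> h = 0"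
    and r: "r > 0"
  shows "\<forall>\<^sub>F p in nhds p0. \<exists>x\<in>cball x0 r. G (p, x) = 0"
proof -
  have bl: "bounded_linear D" using der by (rule has_derivative_bounded_linear)
  then have lin: "linear D" by (rule bounded_linear.linear)
  have injD: "inj D" using linear_injective_0[OF lin] inj by blast
  have blinv: "bounded_linear (inv D)"
    by (rule inj_linear_imp_inv_bounded_linear[OF bl injD])
  have invD: "inv D (D h) = h" for h using injD by simp
  obtain B where B: "B > 0" "\<And>x. norm (inv D x) \<le> norm x * B"
    using bounded_linear.pos_bounded[OF blinv] by blast
  have "1 / (2 * B) > 0" using B(1) by simp
  then have "\<exists>d>0. \<forall>y. norm (y - x0) < d \<longrightarrow>
      norm (G (p0, y) - D (y - x0)) \<le> (1 / (2 * B)) * norm (y - x0)"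
    using der[unfolded has_derivative_at_alt zero diff_zero] by blast
  then obtain d where d: "d > 0" "\<And>y. norm (y - x0) < d \<Longrightarrow>
      norm (G (p0, y) - D (y - x0)) \<le> (1 / (2 * B)) * norm (y - x0)"
    by blast
  define s where "s = min r (d / 2)"
  have s: "0 < s" "s \<le> r" "s < d" using r d by (auto simp: s_def)
  have "s / (2 * B) > 0" using s B(1) by simp
  moreover have "continuous_on (UNIV \<times> cball x0 s) G"
    using cont continuous_on_subset by blast
  ultimately obtain X0 where X0: "p0 \<in> X0" "open X0"
    "\<forall>x\<in>X0 \<inter> UNIV. \<forall>t\<in>cball x0 s. dist (G (x, t)) (G (p0, t)) \<le> s / (2 * B)"
    using continuous_on_prod_compactE[of UNIV "cball x0 s" G p0 "s / (2 * B)"] by (metis UNIV_I compact_cball)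
  have "\<exists>x\<in>cball x0 r. G (p, x) = 0" if p: "p \<in> X0" for p
  proof -
    define f where "f x = x - inv D (G (p, x))" for x
    have fc: "continuous_on (cball x0 s) f"
    proof -
      have "continuous_on (cball x0 s) (\<lambda>x. G (p, x))"
        by (rule continuous_on_compose2[OF cont, of _ "Pair p"]) (auto intro!: continuous_intros)
      then show ?thesis
        unfolding f_def
        by (intro continuous_on_diff continuous_on_id bounded_linear.continuous_on[OF blinv])
    qed
    have fm: "f \<in> cball x0 s \<rightarrow> cball x0 s"
    proof
      fix x assume x: "x \<in> cball x0 s"
      then have nx: "norm (x - x0) \<le> s" by (simp add: dist_norm norm_minus_commute)
      have "f x - x0 = inv D (D (x - x0) - G (p, x))"
        using linear_diff[OF bounded_linear.linear[OF blinv]] invD by (simp add: f_def)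
      then have 1: "norm (f x - x0) \<le> norm (D (x - x0) - G (p, x)) * B"
        using B(2) by simp
      have "norm (D (x - x0) - G (p, x))
          \<le> norm (G (p0, x) - D (x - x0)) + norm (G (p, x) - G (p0, x))"
        using norm_triangle_ineq4[of "- (G (p0, x) - D (x - x0))" "G (p, x) - G (p0, x)"]
        by (simp add: norm_minus_commute[of "G (p0, x)"])
      also have "\<dots> \<le> (1 / (2 * B)) * s + s / (2 * B)"
      proof (rule add_mono)
        have "norm (G (p0, x) - D (x - x0)) \<le> (1 / (2 * B)) * norm (x - x0)"
          by (rule d(2)) (use nx s in linarith)
        also have "\<dots> \<le> (1 / (2 * B)) * s" using nx B(1) by (intro mult_left_mono) auto
        finally show "norm (G (p0, x) - D (x - x0)) \<le> (1 / (2 * B)) * s" .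
        show "norm (G (p, x) - G (p0, x)) \<le> s / (2 * B)"
          using X0(3) p x by (simp add: dist_norm)
      qed
      also have "\<dots> = s / B" using B(1) by (simp add: field_simps)
      finally have "norm (D (x - x0) - G (p, x)) * B \<le> (s / B) * B"
        using B(1) by (intro mult_right_mono) auto
      with 1 have "norm (f x - x0) \<le> (s / B) * B" by linarith
      then show "f x \<in> cball x0 s" using B(1) by (simp add: dist_norm norm_minus_commute)
    qed
    obtain x where x: "x \<in> cball x0 s" "f x = x"
      by (rule brouwer_ball[OF s(1) fc fm])
    have "inv D (G (p, x)) = 0" using x(2) by (simp add: f_def)
    then have "D (inv D (G (p, x))) = 0" using linear_0[OF lin] by simp
    moreover have "surj D" using linear_injective_imp_surjective[OF lin injD] by simp
    ultimately have "G (p, x) = 0" by (simp add: surj_f_inv_f)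
    then show ?thesis using x s by (intro bexI[of _ x]) auto
  qed
  then show ?thesis unfolding eventually_nhds using X0(1,2) by blast
qed

text \<open>A single branch converging to \<open>x0\<close> is obtained by choosing a zero nearest to \<open>x0\<close>; zeros form a closed
set, so a nearest one exists.\<close>

lemma zero_branch:
  fixes G :: "'p::metric_space \<times> 'a::euclidean_space \<Rightarrow> 'a"
  assumes cont: "continuous_on UNIV G"
    and zero: "G (p0, x0) = 0"
    and der: "((\<lambda>x. G (p0, x)) has_derivative D) (at x0)"
    and inj: "\<And>h. D h = 0 \<Longrightarrow> h = 0"
  shows "\<exists>X. (\<forall>\<^sub>F p in nhds p0. G (p, X p) = 0) \<and> (X \<longlongrightarrow> x0) (nhds p0)"
proof -
  note near = zero_persistence[OF cont zero der inj]
  define X where "X p = (SOME x. G (p, x) = 0 \<and> (\<forall>y. G (p, y) = 0 \<longrightarrow> dist x0 x \<le> dist x0 y))" for p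
  have X: "G (p, X p) = 0 \<and> (\<forall>y. G (p, y) = 0 \<longrightarrow> dist x0 (X p) \<le> dist x0 y)"
    if "G (p, x) = 0" for p x
  proof -
    have c: "continuous_on UNIV (\<lambda>x. G (p, x))"
      by (rule continuous_on_compose2[OF cont, of _ "Pair p"]) (auto intro!: continuous_intros)
    have "closed ((\<lambda>x. G (p, x)) -` {0})"
      using continuous_on_closed_vimage[of UNIV "\<lambda>x. G (p, x)"] c by (metis Int_UNIV_right closed_UNIV closed_singleton)
    moreover have "(\<lambda>x. G (p, x)) -` {0} \<noteq> {}" using that by auto
    ultimately obtain z where "z \<in> (\<lambda>x. G (p, x)) -` {0}"
      "\<And>y. y \<in> (\<lambda>x. G (p, x)) -` {0} \<Longrightarrow> dist x0 z \<le> dist x0 y"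
      by (rule distance_attains_inf[where a = x0]) blast
    then have "G (p, z) = 0 \<and> (\<forall>y. G (p, y) = 0 \<longrightarrow> dist x0 z \<le> dist x0 y)" by simp
    then show ?thesis unfolding X_def by (rule someI)
  qed
  have "\<forall>\<^sub>F p in nhds p0. G (p, X p) = 0"
    using near[OF _ zero_less_one] by (rule eventually_mono) (use X in blast)+
  moreover have "(X \<longlongrightarrow> x0) (nhds p0)"
  proof (rule tendstoI)
    fix r :: real assume r: "r > 0"
    then have "r / 2 > 0" by simp
    from near[OF _ this] have ev: "\<forall>\<^sub>F p in nhds p0. \<exists>x\<in>cball x0 (r / 2). G (p, x) = 0" by blast
    show "\<forall>\<^sub>F p in nhds p0. dist (X p) x0 < r"
    proof (rule eventually_mono[OF ev])
      fix p assume "\<exists>x\<in>cball x0 (r / 2). G (p, x) = 0"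
      then obtain x where x: "dist x0 x \<le> r / 2" "G (p, x) = 0" by auto
      have "dist x0 (X p) \<le> dist x0 x" using X[OF x(2)] x(2) by blast
      then show "dist (X p) x0 < r" using x r by (simp add: dist_commute)
    qed
  qed
  ultimately show ?thesis by blast
qed

lemma nonzero_persistence:
  fixes f :: "'p::topological_space \<times> 'a::topological_space \<Rightarrow> 'b::real_normed_vector"
  assumes cont: "continuous_on UNIV f" and K: "compact K"
    and nz: "\<And>x. x \<in> K \<Longrightarrow> f (p0, x) \<noteq> 0"
  shows "\<forall>\<^sub>F p in nhds p0. \<forall>x\<in>K. f (p, x) \<noteq> 0"
proof -
  have "continuous_on K (\<lambda>x. f (p0, x))"
    by (intro continuous_on_compose2[OF cont] continuous_intros) auto
  then obtain d where d: "0 < d" "\<forall>x\<in>K. d \<le> norm (f (p0, x))"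
    using brouwer_compactness_lemma[OF K] nz by metis
  have "continuous_on (UNIV \<times> K) f" using cont continuous_on_subset by blast
  then obtain X0 where X0: "p0 \<in> X0" "open X0"
    "\<forall>x\<in>X0 \<inter> UNIV. \<forall>t\<in>K. dist (f (x, t)) (f (p0, t)) \<le> d / 2"
    using continuous_on_prod_compactE[of UNIV K f p0 "d / 2"] K d by auto
  have "f (p, x) \<noteq> 0" if "p \<in> X0" "x \<in> K" for p x
  proof
    assume "f (p, x) = 0"
    then have "norm (f (p0, x)) \<le> d / 2" using X0(3) that by (force simp: dist_norm)
    then show False using d that by force
  qed
  then show ?thesis using X0 by (auto simp: eventually_nhds)
qed

section \<open>Matrix exponentials\<close>

text \<open>The powers \<open>A\<^sup>i v\<close> are linearly dependent, so some polynomial in \<open>A\<close> annihilates \<open>v\<close>. Stripping off its linear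
factors one at a time, the last nonzero vector is an eigenvector of \<open>A\<close>; being a polynomial in \<open>A\<close>
applied to \<open>v\<close>, it stays in the eigenspace of the commuting matrix \<open>M\<close>. It is used to read the eigenvalues of
\<open>exp (T A)\<close> off those of \<open>A\<close>.\<close>

lemma commuting_eigenvector:
  fixes A M :: "complex ^ 'k::finite ^ 'k"
  assumes comm: "A ** M = M ** A" and v: "v \<noteq> 0" "M *v v = \<mu> *s v"
  shows "\<exists>w l. w \<noteq> 0 \<and> A *v w = l *s w \<and> M *v w = \<mu> *s w"
proof -
  define P where "P p w = (\<Sum>i\<le>degree p. coeff p i *s (((*v) A ^^ i) w))" for p :: "complex poly" and w
  have P_def': "P p w = (\<Sum>i\<le>n. coeff p i *s (((*v) A ^^ i) w))" if "degree p \<le> n" for p w n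
    unfolding P_def using that
    by (intro sum.mono_neutral_left) (auto simp: coeff_eq_0)
  have Ak: "((*v) A ^^ i) (A *v w) = A *v (((*v) A ^^ i) w)" for i w
    by (simp add: funpow_swap1)
  have P_A: "P p (A *v w) = A *v P p w" for p w
    unfolding P_def Ak vec.sum vec.scale ..
  \<comment> \<open>Here \<open>P p w\<close> is the polynomial \<open>p\<close> in \<open>A\<close> applied to \<open>w\<close>; the induction is on the degree of \<open>p\<close>.\<close>
  have key: "\<exists>u l. u \<noteq> 0 \<and> A *v u = l *s u \<and> M *v u = \<mu> *s u"
    if "p \<noteq> 0" "P p w = 0" "w \<noteq> 0" "M *v w = \<mu> *s w" for p w
    using that
  proof (induction "degree p" arbitrary: p w)
    case 0
    then obtain c where c: "p = [:c:]" using degree_eq_zeroE[of p] by auto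
    then have "c \<noteq> 0" using 0 by auto
    then have False using 0 c by (simp add: P_def)
    then show ?case ..
  next
    case (Suc n)
    then obtain a where "poly p a = 0"
      using fundamental_theorem_of_algebra[of p] constant_degree[of p] by auto
    then have "[:- a, 1:] dvd p" by (simp add: poly_eq_0_iff_dvd)
    then obtain q where q: "p = [:- a, 1:] * q" by (rule dvdE)
    with Suc.prems have q0: "q \<noteq> 0" by auto
    have dq: "degree q = n"
    proof -
      have "degree p = degree [:- a, 1:] + degree q"
        unfolding q by (rule degree_mult_eq) (use q0 in auto)
      then show ?thesis using Suc.hyps(2) by simp
    qed
    have "P p w = P (pCons 0 q) w - a *s P q w"
    proof -
      have pp: "coeff p i = coeff (pCons 0 q) i - a * coeff q i" for i
        by (simp add: q)
      have "P p w = (\<Sum>i\<le>Suc n. coeff p i *s (((*v) A ^^ i) w))"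
        by (rule P_def') (use Suc.hyps in simp)
      moreover have "P (pCons 0 q) w = (\<Sum>i\<le>Suc n. coeff (pCons 0 q) i *s (((*v) A ^^ i) w))"
        by (rule P_def') (use dq in \<open>simp add: degree_pCons_le\<close>)
      moreover have "P q w = (\<Sum>i\<le>Suc n. coeff q i *s (((*v) A ^^ i) w))"
        by (rule P_def') (use dq in simp)
      ultimately show ?thesis
        by (simp only: pp vector_sub_rdistrib sum_subtractf vec.scale_sum_right vector_smult_assoc)
    qed
    also have "P (pCons 0 q) w = P q (A *v w)"
    proof -
      have "P (pCons 0 q) w = (\<Sum>i\<le>Suc n. coeff (pCons 0 q) i *s (((*v) A ^^ i) w))"
        by (rule P_def') (use dq in \<open>simp add: degree_pCons_le\<close>)
      also have "\<dots> = (\<Sum>i\<le>n. coeff q i *s (((*v) A ^^ i) (A *v w)))"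
        by (subst sum.atMost_Suc_shift) (simp add: Ak)
      finally show ?thesis unfolding P_def dq .
    qed
    finally have eq: "P p w = A *v P q w - a *s P q w" by (simp add: P_A)
    show ?case
    proof (cases "P q w = 0")
      case True
      show ?thesis
        by (rule Suc.hyps(1)[OF dq[symmetric] q0 True Suc.prems(3,4)])
    next
      case False
      have MA: "M *v ((*v) A ^^ i) w = \<mu> *s ((*v) A ^^ i) w" for i
      proof (induction i)
        case 0
        then show ?case using Suc.prems by simp
      next
        case (Suc i)
        have "M *v (A *v ((*v) A ^^ i) w) = A *v (M *v ((*v) A ^^ i) w)"
          using comm by (simp add: matrix_vector_mul_assoc)
        then show ?case using Suc by (simp add: vec.scale)
      qed
      have "M *v P q w = \<mu> *s P q w"
        unfolding P_def vec.sum vec.scale_sum_right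
        by (simp add: vec.scale MA vector_smult_assoc mult.commute)
      moreover have "A *v P q w = a *s P q w" using eq Suc.prems by simp
      ultimately show ?thesis using False by blast
    qed
  qed
  obtain p where "p \<noteq> 0" "P p v = 0"
  proof -
    have "\<exists>c. (\<exists>i\<le>CARD('k). c i \<noteq> 0) \<and> (\<Sum>i\<le>CARD('k). c i *s (((*v) A ^^ i) v)) = 0"
    proof (cases "inj_on (\<lambda>i. ((*v) A ^^ i) v) {..CARD('k)}")
      case False
      then obtain i j where ij: "i \<le> CARD('k)" "j \<le> CARD('k)" "i \<noteq> j"
        "((*v) A ^^ i) v = ((*v) A ^^ j) v" by (auto simp: inj_on_def)
      define c :: "nat \<Rightarrow> complex" where "c k = (if k = i then 1 else 0) - (if k = j then 1 else 0)" for k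
      have "(\<Sum>k\<le>CARD('k). c k *s (((*v) A ^^ k) v)) = (\<Sum>k\<in>{i, j}. c k *s (((*v) A ^^ k) v))"
        by (rule sum.mono_neutral_right) (use ij(1,2) in \<open>auto simp: c_def\<close>)
      also have "\<dots> = 0" using ij(3,4) by (simp add: c_def)
      finally have "(\<Sum>k\<le>CARD('k). c k *s (((*v) A ^^ k) v)) = 0" .
      moreover have "c i \<noteq> 0" using ij by (simp add: c_def)
      ultimately show ?thesis using ij by blast
    next
      case True
      let ?S = "(\<lambda>i. ((*v) A ^^ i) v) ` {..CARD('k)}"
      have "card ?S = Suc CARD('k)" using True by (simp add: card_image)
      then have "vec.dependent ?S"
        using vec.dependent_biggerset_general[of ?S] dim_subset_UNIV_cart_gen[of ?S]
        by simp
      then obtain u where u: "\<exists>x\<in>?S. u x \<noteq> 0" "(\<Sum>x\<in>?S. u x *s x) = 0"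
        using vec.dependent_finite[of ?S] by auto
      then obtain i where "i \<le> CARD('k)" "u (((*v) A ^^ i) v) \<noteq> 0" by auto
      moreover have "(\<Sum>i\<le>CARD('k). u (((*v) A ^^ i) v) *s (((*v) A ^^ i) v)) = 0"
        using u(2) unfolding sum.reindex[OF True] o_def .
      ultimately show ?thesis by (intro exI[of _ "\<lambda>i. u (((*v) A ^^ i) v)"]) blast
    qed
    then obtain c i where c: "i \<le> CARD('k)" "c i \<noteq> 0" "(\<Sum>i\<le>CARD('k). c i *s (((*v) A ^^ i) v)) = 0"
      by blast
    define p where "p = (\<Sum>i\<le>CARD('k). monom (c i) i)"
    have cp: "coeff p k = (if k \<le> CARD('k) then c k else 0)" for k
      by (simp add: p_def coeff_sum sum.delta)
    have "degree p \<le> CARD('k)" by (rule degree_le) (simp add: cp)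
    then have "P p v = 0" using c(3) by (simp add: P_def' cp)
    moreover have "p \<noteq> 0" using cp[of i] c by auto
    ultimately show thesis using that by blast
  qed
  then show ?thesis using key v by blast
qed

lemma bounded_linear_axis: "bounded_linear (axis i :: 'a::real_normed_vector \<Rightarrow> 'a ^ 'n::finite)"
proof (rule bounded_linear_intro[where K = 1])
  fix x :: 'a
  have "norm (axis i x :: 'a ^ 'n) \<le> (\<Sum>k\<in>UNIV. norm ((axis i x :: 'a ^ 'n) $ k))"
    unfolding norm_vec_def by (rule L2_set_le_sum) simp
  also have "\<dots> = norm x" by (simp add: axis_def if_distrib[of norm] cong: if_cong)
  finally show "norm (axis i x :: 'a ^ 'n) \<le> norm x * 1" by simp
qed (auto simp: axis_def vec_eq_iff)

lemma has_derivative_vec_iff: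
  fixes f :: "'a::real_normed_vector \<Rightarrow> 'b::real_normed_vector ^ 'n::finite"
  shows "(f has_derivative f') F \<longleftrightarrow> (\<forall>i. ((\<lambda>x. f x $ i) has_derivative (\<lambda>h. f' h $ i)) F)"
proof
  assume "(f has_derivative f') F"
  then show "\<forall>i. ((\<lambda>x. f x $ i) has_derivative (\<lambda>h. f' h $ i)) F"
    using bounded_linear.has_derivative[OF bounded_linear_vec_nth] by blast
next
  assume *: "\<forall>i. ((\<lambda>x. f x $ i) has_derivative (\<lambda>h. f' h $ i)) F"
  have eq: "(\<Sum>i\<in>UNIV. axis i (v $ i)) = v" for v :: "'b ^ 'n"
    by (simp add: vec_eq_iff axis_def)
  have "((\<lambda>x. \<Sum>i\<in>UNIV. axis i (f x $ i)) has_derivative (\<lambda>h. \<Sum>i\<in>UNIV. axis i (f' h $ i))) F"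
    by (intro has_derivative_sum bounded_linear.has_derivative[OF bounded_linear_axis])
      (use * in blast)
  then show "(f has_derivative f') F" by (simp add: eq)
qed

lemma has_derivative_vec_nth: "((\<lambda>v::'a::real_normed_vector ^ 'n::finite. v $ k) has_derivative (\<lambda>h. h $ k)) F"
  by (rule bounded_linear.has_derivative[OF bounded_linear_vec_nth has_derivative_ident])

lemma has_vector_derivative_vec_iff:
  fixes f :: "real \<Rightarrow> 'b::real_normed_vector ^ 'n::finite"
  shows "(f has_vector_derivative f') F \<longleftrightarrow> (\<forall>i. ((\<lambda>x. f x $ i) has_vector_derivative f' $ i) F)"
  unfolding has_vector_derivative_def by (subst has_derivative_vec_iff) simp

primrec mpow :: "real ^ 'k ^ 'k \<Rightarrow> nat \<Rightarrow> real ^ 'k ^ 'k::finite" where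
  "mpow A 0 = mat 1"
| "mpow A (Suc n) = A ** mpow A n"

text \<open>Defined entrywise, as real power series in \<open>t\<close>, so that it can be differentiated term by term.\<close>

definition mexp :: "real ^ 'k ^ 'k \<Rightarrow> real \<Rightarrow> real ^ 'k ^ 'k::finite" where
  "mexp A t = (\<chi> i j. \<Sum>n. mpow A n $ i $ j / fact n * t ^ n)"

lemma mpow_commute: "mpow A n ** A = A ** mpow A n"
  by (induction n) (simp_all add: matrix_mul_assoc[symmetric])

lemma mpow_entry_bound:
  "\<bar>mpow A n $ i $ j\<bar> \<le> (\<Sum>i\<in>UNIV. \<Sum>j\<in>UNIV. \<bar>A $ i $ j\<bar>) ^ n" (is "_ \<le> ?K ^ n")
proof (induction n arbitrary: i)
  case 0
  then show ?case by (simp add: mat_def)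
next
  case (Suc n)
  have K: "?K \<ge> 0" by (intro sum_nonneg) auto
  have "\<bar>mpow A (Suc n) $ i $ j\<bar> \<le> (\<Sum>l\<in>UNIV. \<bar>A $ i $ l\<bar> * \<bar>mpow A n $ l $ j\<bar>)"
    by (simp add: matrix_matrix_mult_def) (rule order_trans[OF sum_abs], simp add: abs_mult)
  also have "\<dots> \<le> (\<Sum>l\<in>UNIV. \<bar>A $ i $ l\<bar> * ?K ^ n)"
    by (intro sum_mono mult_left_mono Suc.IH) auto
  also have "\<dots> = (\<Sum>l\<in>UNIV. \<bar>A $ i $ l\<bar>) * ?K ^ n" by (simp add: sum_distrib_right)
  also have "\<dots> \<le> ?K * ?K ^ n"
  proof (rule mult_right_mono)
    show "(\<Sum>l\<in>UNIV. \<bar>A $ i $ l\<bar>) \<le> ?K"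
      by (rule member_le_sum[where f = "\<lambda>i. \<Sum>l\<in>UNIV. \<bar>A $ i $ l\<bar>"]) (auto intro: sum_nonneg)
  qed (use K in simp)
  finally show ?case by simp
qed

lemma summable_mexp: "summable (\<lambda>n. mpow A n $ i $ j / fact n * t ^ n)"
proof (rule summable_comparison_test')
  let ?K = "\<Sum>i\<in>UNIV. \<Sum>j\<in>UNIV. \<bar>A $ i $ j\<bar>"
  show "summable (\<lambda>n. inverse (fact n) * (?K * \<bar>t\<bar>) ^ n)"
    using summable_exp[of "?K * \<bar>t\<bar>"] by (simp add: field_simps)
  show "norm (mpow A n $ i $ j / fact n * t ^ n) \<le> inverse (fact n) * (?K * \<bar>t\<bar>) ^ n" if "n \<ge> 0" for n
  proof -
    have "\<bar>mpow A n $ i $ j\<bar> * \<bar>t\<bar> ^ n / fact n \<le> ?K ^ n * \<bar>t\<bar> ^ n / fact n"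
      by (intro divide_right_mono mult_right_mono mpow_entry_bound) auto
    then show ?thesis by (simp add: abs_mult power_abs power_mult_distrib field_simps)
  qed
qed

lemma mexp_sums: "(\<lambda>n. mpow A n $ i $ j / fact n * t ^ n) sums (mexp A t $ i $ j)"
  using summable_mexp[of A i j t] by (simp add: mexp_def summable_sums)

lemma mexp_0: "mexp A 0 = mat 1"
proof -
  have "mexp A 0 $ i $ j = mat 1 $ i $ j" for i j
    by (simp add: mexp_def powser_zero del: times_divide_eq_left)
  then show ?thesis by (simp add: vec_eq_iff)
qed

lemma mexp_left_sums:
  "(\<lambda>n. mpow A (Suc n) $ i $ j / fact n * t ^ n) sums ((A ** mexp A t) $ i $ j)"
proof -
  have "(\<lambda>n. \<Sum>l\<in>UNIV. A $ i $ l * (mpow A n $ l $ j / fact n * t ^ n))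
      sums (\<Sum>l\<in>UNIV. A $ i $ l * mexp A t $ l $ j)"
    by (intro sums_sum sums_mult mexp_sums)
  then show ?thesis
    by (simp add: matrix_matrix_mult_def sum_divide_distrib sum_distrib_right mult.assoc)
qed

lemma mexp_commute: "mexp A t ** A = A ** mexp A t"
proof -
  have "(\<lambda>n. \<Sum>l\<in>UNIV. (mpow A n $ i $ l / fact n * t ^ n) * A $ l $ j)
      sums (\<Sum>l\<in>UNIV. mexp A t $ i $ l * A $ l $ j)" for i j
    by (intro sums_sum sums_mult2 mexp_sums)
  moreover have "(\<Sum>l\<in>UNIV. (mpow A n $ i $ l / fact n * t ^ n) * A $ l $ j)
      = mpow A (Suc n) $ i $ j / fact n * t ^ n" for i j n
  proof -
    have "(\<Sum>l\<in>UNIV. (mpow A n $ i $ l / fact n * t ^ n) * A $ l $ j)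
       = (mpow A n ** A) $ i $ j / fact n * t ^ n"
      by (simp add: matrix_matrix_mult_def sum_divide_distrib sum_distrib_left mult_ac)
    then show ?thesis by (simp only: mpow_commute mpow.simps)
  qed
  ultimately have "(\<lambda>n. mpow A (Suc n) $ i $ j / fact n * t ^ n) sums ((mexp A t ** A) $ i $ j)" for i j
    by (simp add: matrix_matrix_mult_def)
  then have "(mexp A t ** A) $ i $ j = (A ** mexp A t) $ i $ j" for i j
    by (rule sums_unique2[OF _ mexp_left_sums])
  then show ?thesis by (simp add: vec_eq_iff)
qed

lemma mexp_deriv: "(mexp A has_vector_derivative A ** mexp A t) (at t)"
proof -
  have "((\<lambda>t. mexp A t $ i $ j) has_vector_derivative (A ** mexp A t) $ i $ j) (at t)" for i j
  proof -
    let ?c = "\<lambda>n. mpow A n $ i $ j / fact n"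
    have "((\<lambda>t. \<Sum>n. ?c n * t ^ n) has_field_derivative (\<Sum>n. diffs ?c n * t ^ n)) (at t)"
      by (rule termdiffs_strong_converges_everywhere) (rule summable_mexp)
    moreover have "diffs ?c n = mpow A (Suc n) $ i $ j / fact n" for n
      by (simp add: diffs_def fact_Suc del: mpow.simps of_nat_Suc)
    ultimately show ?thesis
      using sums_unique[OF mexp_left_sums[of A i j t]]
      by (simp add: mexp_def has_real_derivative_iff_has_vector_derivative del: mpow.simps)
  qed
  then show ?thesis by (simp add: has_vector_derivative_vec_iff)
qed

definition cmat :: "real ^ 'k ^ 'm \<Rightarrow> complex ^ 'k::finite ^ 'm::finite" where
  "cmat M = (\<chi> i j. complex_of_real (M $ i $ j))"

lemma cmat_mult: "cmat (A ** B) = cmat A ** cmat B"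
  by (simp add: cmat_def matrix_matrix_mult_def vec_eq_iff)

lemma cmat_1: "cmat (mat 1) = mat 1"
  by (simp add: cmat_def mat_def vec_eq_iff)

lemma mexp_eigenvector:
  assumes "cmat A *v v = l *s v"
  shows "cmat (mexp A t) *v v = exp (l * complex_of_real t) *s v"
proof -
  have pw: "cmat (mpow A n) *v v = l ^ n *s v" for n
  proof (induction n)
    case (Suc n)
    have "cmat (mpow A (Suc n)) *v v = cmat A *v (cmat (mpow A n) *v v)"
      by (simp add: cmat_mult matrix_vector_mul_assoc)
    also have "\<dots> = l ^ n *s (l *s v)" by (simp only: Suc vector_scalar_commute assms)
    also have "\<dots> = l ^ Suc n *s v" by (simp add: vector_smult_assoc mult.commute)
    finally show ?case .
  qed (simp add: cmat_1)
  have "(cmat (mexp A t) *v v) $ i = exp (l * complex_of_real t) * v $ i" for i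
  proof -
    have "(\<lambda>n. \<Sum>j\<in>UNIV. complex_of_real (mpow A n $ i $ j / fact n * t ^ n) * v $ j)
        sums (\<Sum>j\<in>UNIV. complex_of_real (mexp A t $ i $ j) * v $ j)"
      by (intro sums_sum sums_mult2 sums_of_real mexp_sums)
    moreover have "(\<Sum>j\<in>UNIV. complex_of_real (mpow A n $ i $ j / fact n * t ^ n) * v $ j)
        = ((l * complex_of_real t) ^ n /\<^sub>R fact n) * v $ i" for n
    proof -
      have "(\<Sum>j\<in>UNIV. complex_of_real (mpow A n $ i $ j / fact n * t ^ n) * v $ j)
         = (complex_of_real t ^ n / fact n) * (cmat (mpow A n) *v v) $ i"
        by (simp add: cmat_def matrix_vector_mult_def sum_distrib_left mult_ac)
      also have "\<dots> = (complex_of_real t ^ n / fact n) * (l ^ n * v $ i)"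
        unfolding pw vector_smult_component ..
      also have "\<dots> = ((l * complex_of_real t) ^ n /\<^sub>R fact n) * v $ i"
        by (simp add: power_mult_distrib scaleR_conv_of_real field_simps)
      finally show ?thesis .
    qed
    moreover have "(\<lambda>n. ((l * complex_of_real t) ^ n /\<^sub>R fact n) * v $ i) sums (exp (l * complex_of_real t) * v $ i)"
      by (intro sums_mult2 exp_converges)
    ultimately have "(\<Sum>j\<in>UNIV. complex_of_real (mexp A t $ i $ j) * v $ j)
        = exp (l * complex_of_real t) * v $ i"
      by (simp only:) (rule sums_unique2)
    then show ?thesis by (simp add: cmat_def matrix_vector_mult_def)
  qed
  then show ?thesis by (simp add: vec_eq_iff)
qed

section \<open>The lattice equation in a rotating frame\<close>

text \<open>The Laplacian of the Zigzag graph. The polymorphic type serves complex states as well as real amplitudes.\<close>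

definition lap :: "'a::real_vector ^ ('n::finite bit1) \<Rightarrow> 'a ^ ('n bit1)" where
  "lap v = (\<chi> j. 4 *\<^sub>R v $ j - v $ (j + 1) - v $ (j - 1) - v $ (j + 2) - v $ (j - 2))"

text \<open>The field seen in the frame rotating with frequency \<open>1 + I\<close>. For \<open>I = - 1\<close> the frame is at rest, so the
lattice equation itself is the case \<open>rot_field (- 1)\<close>. Writing \<open>|\<phi>\<^sub>j|\<^sup>2\<close> as a product keeps every expression polynomial.\<close>

definition rot_field :: "real \<Rightarrow> real \<Rightarrow> 'n state \<Rightarrow> ('n::finite) state" where
  "rot_field I \<epsilon> \<phi> = (\<chi> j. - \<i> * ((\<phi> $ j * cnj (\<phi> $ j) - of_real I) * \<phi> $ j + of_real \<epsilon> * lap \<phi> $ j))"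

text \<open>Up to a factor, the Hessian at \<open>\<phi>\<close> of the energy minus \<open>1 + I\<close> times the squared norm, as a real-linear operator on states.\<close>

definition Hess :: "real \<Rightarrow> real \<Rightarrow> 'n state \<Rightarrow> 'n state \<Rightarrow> ('n::finite) state" where
  "Hess I \<epsilon> \<phi> v = (\<chi> j. (2 * \<phi> $ j * cnj (\<phi> $ j) - of_real I) * v $ j
      + (\<phi> $ j)\<^sup>2 * cnj (v $ j) + of_real \<epsilon> * lap v $ j)"

text \<open>The linearised rotating-frame field, in Hamiltonian form.\<close>

definition Lin :: "real \<Rightarrow> real \<Rightarrow> 'n state \<Rightarrow> 'n state \<Rightarrow> ('n::finite) state" where
  "Lin I \<epsilon> \<phi> v = (\<chi> j. - \<i> * Hess I \<epsilon> \<phi> v $ j)"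

lemma sum_shift:
  fixes f :: "'n::finite bit1 \<Rightarrow> 'b::comm_monoid_add"
  shows "(\<Sum>j\<in>UNIV. f (j + a)) = (\<Sum>j\<in>UNIV. f j)" "(\<Sum>j\<in>UNIV. f (j - a)) = (\<Sum>j\<in>UNIV. f j)"
proof -
  have 1: "bij (\<lambda>j::'n bit1. j + a)" by (rule bij_plus_right)
  have 2: "bij (\<lambda>j::'n bit1. j - a)" using bij_plus_right[of "- a"] by simp
  show "(\<Sum>j\<in>UNIV. f (j + a)) = (\<Sum>j\<in>UNIV. f j)"
    by (rule sum.reindex_bij_betw[OF 1])
  show "(\<Sum>j\<in>UNIV. f (j - a)) = (\<Sum>j\<in>UNIV. f j)"
    by (rule sum.reindex_bij_betw[OF 2])
qed

text \<open>Summation by parts on the ring; it turns coupling energies into Laplacians.\<close>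

lemma difference_by_parts:
  fixes u v :: "complex ^ ('n::finite bit1)"
  shows "(\<Sum>j\<in>UNIV. (u $ (j + a) - u $ j) \<bullet> (v $ (j + a) - v $ j))
       = (\<Sum>j\<in>UNIV. (2 *\<^sub>R u $ j - u $ (j + a) - u $ (j - a)) \<bullet> v $ j)"
proof -
  have "(\<Sum>j\<in>UNIV. (u $ (j + a) - u $ j) \<bullet> (v $ (j + a) - v $ j))
     = (\<Sum>j\<in>UNIV. (u $ (j + a) - u $ (j + a - a)) \<bullet> v $ (j + a)) - (\<Sum>j\<in>UNIV. (u $ (j + a) - u $ j) \<bullet> v $ j)"
    by (simp add: inner_diff_right sum_subtractf)
  also have "(\<Sum>j\<in>UNIV. (u $ (j + a) - u $ (j + a - a)) \<bullet> v $ (j + a)) = (\<Sum>j\<in>UNIV. (u $ j - u $ (j - a)) \<bullet> v $ j)"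
    by (rule sum_shift)
  also have "\<dots> - (\<Sum>j\<in>UNIV. (u $ (j + a) - u $ j) \<bullet> v $ j)
     = (\<Sum>j\<in>UNIV. (2 *\<^sub>R u $ j - u $ (j + a) - u $ (j - a)) \<bullet> v $ j)"
    unfolding sum_subtractf[symmetric]
    by (rule sum.cong) (simp_all add: algebra_simps inner_diff_left inner_add_left)
  finally show ?thesis .
qed

lemma zigzag_ham_has_derivative:
  fixes \<psi> :: "('n::finite) state"
  shows "(zigzag_ham \<epsilon> has_derivative
    (\<lambda>h. 2 * (\<Sum>j\<in>UNIV. ((1 + \<psi> $ j \<bullet> \<psi> $ j) *\<^sub>R \<psi> $ j + \<epsilon> *\<^sub>R lap \<psi> $ j) \<bullet> h $ j))) (at \<psi>)"
proof -
  have H: "zigzag_ham \<epsilon> = (\<lambda>\<psi>::'n state.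
     (\<Sum>j\<in>UNIV. \<psi> $ j \<bullet> \<psi> $ j) + 1/2 * (\<Sum>j\<in>UNIV. (\<psi> $ j \<bullet> \<psi> $ j)\<^sup>2)
     + \<epsilon> * (\<Sum>j\<in>UNIV. (\<psi> $ (j + 1) - \<psi> $ j) \<bullet> (\<psi> $ (j + 1) - \<psi> $ j) + (\<psi> $ (j + 2) - \<psi> $ j) \<bullet> (\<psi> $ (j + 2) - \<psi> $ j)))"
    by (rule ext) (simp add: zigzag_ham_def power2_norm_eq_inner[symmetric] power_mult[symmetric])
  have "(zigzag_ham \<epsilon> has_derivative (\<lambda>h.
     (\<Sum>j\<in>UNIV. 2 * (\<psi> $ j \<bullet> h $ j)) + 1/2 * (\<Sum>j\<in>UNIV. 4 * (\<psi> $ j \<bullet> \<psi> $ j) * (\<psi> $ j \<bullet> h $ j))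
     + \<epsilon> * (\<Sum>j\<in>UNIV. 2 * ((\<psi> $ (j + 1) - \<psi> $ j) \<bullet> (h $ (j + 1) - h $ j)) + 2 * ((\<psi> $ (j + 2) - \<psi> $ j) \<bullet> (h $ (j + 2) - h $ j))))) (at \<psi>)"
    unfolding H
    by (rule derivative_eq_intros has_derivative_vec_nth refl)+ (simp add: inner_commute mult_ac)
  moreover have "(\<Sum>j\<in>UNIV. 2 * (\<psi> $ j \<bullet> h $ j)) + 1/2 * (\<Sum>j\<in>UNIV. 4 * (\<psi> $ j \<bullet> \<psi> $ j) * (\<psi> $ j \<bullet> h $ j))
     + \<epsilon> * (\<Sum>j\<in>UNIV. 2 * ((\<psi> $ (j + 1) - \<psi> $ j) \<bullet> (h $ (j + 1) - h $ j)) + 2 * ((\<psi> $ (j + 2) - \<psi> $ j) \<bullet> (h $ (j + 2) - h $ j)))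
     = 2 * (\<Sum>j\<in>UNIV. ((1 + \<psi> $ j \<bullet> \<psi> $ j) *\<^sub>R \<psi> $ j + \<epsilon> *\<^sub>R lap \<psi> $ j) \<bullet> h $ j)" for h
  proof -
    have "(\<Sum>j\<in>UNIV. 2 * ((\<psi> $ (j + 1) - \<psi> $ j) \<bullet> (h $ (j + 1) - h $ j)) + 2 * ((\<psi> $ (j + 2) - \<psi> $ j) \<bullet> (h $ (j + 2) - h $ j)))
      = 2 * (\<Sum>j\<in>UNIV. lap \<psi> $ j \<bullet> h $ j)"
      unfolding sum.distrib sum_distrib_left[symmetric] difference_by_parts
      unfolding distrib_left[symmetric] sum.distrib[symmetric]
      by (simp add: lap_def inner_diff_left inner_add_left algebra_simps)
    then show ?thesis
      by (simp add: inner_add_left sum.distrib sum_distrib_left algebra_simps)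
  qed
  ultimately show ?thesis by simp
qed

lemma zigzag_field_eq: "zigzag_field \<epsilon> \<psi> = rot_field (-1) \<epsilon> \<psi>"
proof -
  define F where "F j = (1 + \<psi> $ j \<bullet> \<psi> $ j) *\<^sub>R \<psi> $ j + \<epsilon> *\<^sub>R lap \<psi> $ j" for j
  have fd: "frechet_derivative (zigzag_ham \<epsilon>) (at \<psi>) = (\<lambda>h. 2 * (\<Sum>j\<in>UNIV. F j \<bullet> h $ j))"
    unfolding F_def by (rule frechet_derivative_at[symmetric, OF zigzag_ham_has_derivative])
  have ax: "(\<Sum>k\<in>UNIV. F k \<bullet> (axis j c :: 'a state) $ k) = F j \<bullet> c" for j c
    by (simp add: axis_def if_distrib[of "\<lambda>z. _ \<bullet> z"] cong: if_cong)
  have "wirtinger_cnj (zigzag_ham \<epsilon>) j \<psi> = F j" for j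
    by (simp add: wirtinger_cnj_def fd ax complex_eq_iff)
  moreover have "F j = (\<psi> $ j * cnj (\<psi> $ j) - of_real (-1)) * \<psi> $ j + of_real \<epsilon> * lap \<psi> $ j" for j
    by (simp add: F_def scaleR_conv_of_real complex_norm_square[symmetric] power2_norm_eq_inner[symmetric] algebra_simps)
  ultimately show ?thesis
    by (simp add: zigzag_field_def rot_field_def vec_eq_iff divide_inverse mult.commute)
qed

lemma lap_linear: "linear lap"
  by (rule linearI) (simp_all add: lap_def vec_eq_iff scaleR_add_right algebra_simps)

lemma rot_field_has_derivative:
  fixes \<phi> :: "('n::finite) state"
  shows "(rot_field I \<epsilon> has_derivative Lin I \<epsilon> \<phi>) (at \<phi>)"
proof -
  have lp: "((\<lambda>\<psi>::'n state. lap \<psi> $ k) has_derivative (\<lambda>h. lap h $ k)) (at \<phi>)" for k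
    by (intro bounded_linear.has_derivative[OF bounded_linear_vec_nth]
        bounded_linear.has_derivative[OF _ has_derivative_ident])
      (simp add: linear_conv_bounded_linear[symmetric] lap_linear)
  have "((\<lambda>\<phi>::'n state. rot_field I \<epsilon> \<phi> $ j) has_derivative (\<lambda>h. Lin I \<epsilon> \<phi> h $ j)) (at \<phi>)" for j
    unfolding rot_field_def Lin_def Hess_def vec_lambda_beta
    by (rule derivative_eq_intros has_derivative_vec_nth lp bounded_linear.has_derivative[OF bounded_linear_cnj] refl)+
      (rule ext, simp add: algebra_simps power2_eq_square)
  then show ?thesis by (simp add: has_derivative_vec_iff)
qed

lemma lap_scale: "lap (c *s v) = c *s lap (v :: complex ^ _)"
  by (simp add: lap_def vec_eq_iff algebra_simps)

lemma rot_field_rotate: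
  assumes "cmod c = 1"
  shows "rot_field I \<epsilon> (c *s \<phi>) = c *s rot_field I \<epsilon> \<phi>"
proof -
  have "c * cnj c = 1" using assms complex_norm_square[of c] by simp
  then have "(c * \<phi> $ j) * cnj (c * \<phi> $ j) = \<phi> $ j * cnj (\<phi> $ j)" for j
    by (simp add: mult_ac)
  then show ?thesis
    by (simp add: rot_field_def vec_eq_iff lap_scale) (simp add: algebra_simps)
qed

text \<open>Gauge invariance removes the time dependence of the variational equation along a rotating wave, at the
price of the rotation term \<open>i (1 + I)\<close>.\<close>

lemma Lin_rotate:
  assumes "cmod c = 1"
  shows "Lin (-1) \<epsilon> (c *s \<phi>) (c *s v) = c *s (Lin I \<epsilon> \<phi> v - (\<i> * of_real (1 + I)) *s v)"
proof -
  have cc: "c * cnj c = 1" using assms complex_norm_square[of c] by simp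
  have A: "2 * (c * p) * cnj (c * p) = 2 * p * cnj p" for p
  proof -
    have "2 * (c * p) * cnj (c * p) = (c * cnj c) * (2 * p * cnj p)" by simp
    then show ?thesis using cc by simp
  qed
  have B: "(c * p)\<^sup>2 * cnj (c * q) = c * (p\<^sup>2 * cnj q)" for p q
  proof -
    have "(c * p)\<^sup>2 * cnj (c * q) = (c * cnj c) * (c * (p\<^sup>2 * cnj q))" by (simp add: power2_eq_square)
    then show ?thesis using cc by simp
  qed
  have "Lin (-1) \<epsilon> (c *s \<phi>) (c *s v) $ j = (c *s (Lin I \<epsilon> \<phi> v - (\<i> * of_real (1 + I)) *s v)) $ j" for j
    unfolding Lin_def Hess_def vec_lambda_beta vector_smult_component vector_minus_component A B lap_scale
    by (simp add: algebra_simps)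
  then show ?thesis by (simp add: vec_eq_iff)
qed

abbreviation rotating_wave :: "real \<Rightarrow> complex ^ 'j \<Rightarrow> real \<Rightarrow> complex ^ 'j" where
  "rotating_wave I \<phi> t \<equiv> exp (- \<i> * of_real ((1 + I) * t)) *s \<phi>"

section \<open>Monodromy of rotating waves\<close>

lemma to_from: "to_real (from_real x) = x" "from_real (to_real \<psi>) = \<psi>"
  by (simp_all add: to_real_def from_real_def vec_eq_iff split: sum.split)

lemma from_real_linear: "linear from_real"
  by (rule linearI) (simp_all add: from_real_def vec_eq_iff complex_eq_iff)

lemma to_real_linear: "linear to_real"
  by (rule linearI) (simp_all add: to_real_def vec_eq_iff split: sum.split)

definition real_matrix :: "(complex ^ 'j \<Rightarrow> complex ^ 'j) \<Rightarrow> real ^ ('j + 'j) ^ ('j::finite + 'j)" where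
  "real_matrix f = matrix (\<lambda>x. to_real (f (from_real x)))"

lemma real_matrix_works:
  assumes "linear f"
  shows "real_matrix f *v x = to_real (f (from_real x))"
proof -
  have "linear (to_real \<circ> (f \<circ> from_real))"
    by (intro linear_compose[of _ to_real] linear_compose[of from_real] assms to_real_linear from_real_linear)
  then have "linear (\<lambda>x. to_real (f (from_real x)))" by (simp add: o_def)
  then show ?thesis unfolding real_matrix_def by simp
qed

lemma Lin_linear: "linear (Lin I \<epsilon> \<phi>)"
  using rot_field_has_derivative has_derivative_linear by blast

lemma smult_linear: "linear (\<lambda>v::complex ^ 'j::finite. c *s v)"
  by (rule linearI) (simp_all add: vec_eq_iff algebra_simps)

lemma matrix_zigzag_real_field:
  "matrix (frechet_derivative (zigzag_real_field \<epsilon>) (at (to_real \<psi>))) = real_matrix (Lin (-1) \<epsilon> \<psi>)"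
proof -
  have "((\<lambda>x. to_real (rot_field (-1) \<epsilon> (from_real x))) has_derivative
      (\<lambda>h. to_real (Lin (-1) \<epsilon> (from_real (to_real \<psi>)) (from_real h)))) (at (to_real \<psi>))"
    by (intro bounded_linear.has_derivative[OF linear_conv_bounded_linear[THEN iffD1, OF to_real_linear]]
        has_derivative_compose[OF _ rot_field_has_derivative]
        bounded_linear.has_derivative[OF linear_conv_bounded_linear[THEN iffD1, OF from_real_linear] has_derivative_ident])
  then show ?thesis
    unfolding real_matrix_def zigzag_real_field_def[abs_def] zigzag_field_eq to_from
    by (simp add: frechet_derivative_at[symmetric])
qed

text \<open>In the rotating frame the variational equation has the constant coefficient matrix \<open>A\<close>. The fundamental
matrix is thus the rotation by \<open>e\<^sup>-\<^sup>i\<^sup>\<omega>\<^sup>t\<close> composed with \<open>exp (t A)\<close>, and the rotation is trivial at time \<open>T\<close>.\<close>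

lemma monodromy_of_rotating_wave:
  fixes \<phi> :: "('n::finite) state"
  assumes \<psi>: "\<And>t. \<psi> t = rotating_wave I \<phi> t" and T: "(1 + I) * T = 2 * pi"
  shows "is_monodromy (zigzag_real_field \<epsilon>) (\<lambda>t. to_real (\<psi> t)) T (mexp (real_matrix (Lin I \<epsilon> \<phi>)) T)"
proof -
  define w where "w = 1 + I"
  define A where "A = real_matrix (Lin I \<epsilon> \<phi>)"
  define J where "J = real_matrix (\<lambda>v :: 'n state. \<i> *s v)"
  define E where "E = mexp A"
  define \<Phi> where "\<Phi> t = cos (w * t) *\<^sub>R E t - sin (w * t) *\<^sub>R (J ** E t)" for t
  have Jx: "J *v x = to_real (\<i> *s from_real x)" for x
    unfolding J_def by (rule real_matrix_works[OF smult_linear])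
  have Ax: "A *v x = to_real (Lin I \<epsilon> \<phi> (from_real x))" for x
    unfolding A_def by (rule real_matrix_works[OF Lin_linear])
  have blJ: "bounded_linear (\<lambda>X. J ** X)"
    unfolding linear_conv_bounded_linear[symmetric]
    by (rule linearI)
      (simp_all add: matrix_matrix_mult_def vec_eq_iff sum_distrib_left sum.distrib algebra_simps)
  have dJ: "((\<lambda>t. J ** E t) has_vector_derivative J ** (A ** E t)) (at t)" for t
    unfolding E_def by (rule bounded_linear.has_vector_derivative[OF blJ mexp_deriv])
  have d: "(\<Phi> has_vector_derivative
     (cos (w * t) *\<^sub>R (A ** E t) - (w * sin (w * t)) *\<^sub>R E t)
      - (sin (w * t) *\<^sub>R (J ** (A ** E t)) + (w * cos (w * t)) *\<^sub>R (J ** E t))) (at t)" for t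
  proof -
    have c: "((\<lambda>t. cos (w * t)) has_real_derivative - (w * sin (w * t))) (at t)"
      "((\<lambda>t. sin (w * t)) has_real_derivative (w * cos (w * t))) (at t)"
      by (auto intro!: derivative_eq_intros)
    have e: "(E has_vector_derivative A ** E t) (at t)" unfolding E_def by (rule mexp_deriv)
    show ?thesis unfolding \<Phi>_def[abs_def]
      using has_vector_derivative_diff[OF has_vector_derivative_scaleR[OF c(1) e]
          has_vector_derivative_scaleR[OF c(2) dJ]] by simp
  qed
  have ecs: "exp (- \<i> * of_real (w * t)) = of_real (cos (w * t)) - \<i> * of_real (sin (w * t))" for t
    by (simp add: complex_eq_iff Re_exp Im_exp)
  have rot: "to_real (exp (- \<i> * of_real (w * t)) *s v)
      = cos (w * t) *\<^sub>R to_real v - sin (w * t) *\<^sub>R to_real (\<i> *s v)" for t and v :: "'n state"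
    unfolding ecs by (simp add: to_real_def vec_eq_iff algebra_simps split: sum.split)
  have \<Phi>x: "\<Phi> t *v x = to_real (exp (- \<i> * of_real (w * t)) *s from_real (E t *v x))" for t x
    unfolding rot \<Phi>_def
    by (simp add: matrix_vector_mult_diff_rdistrib scaleR_matrix_vector_assoc[symmetric]
        matrix_vector_mul_assoc[symmetric] Jx to_from)
  have "matrix (frechet_derivative (zigzag_real_field \<epsilon>) (at (to_real (\<psi> t)))) ** \<Phi> t =
     (cos (w * t) *\<^sub>R (A ** E t) - (w * sin (w * t)) *\<^sub>R E t)
      - (sin (w * t) *\<^sub>R (J ** (A ** E t)) + (w * cos (w * t)) *\<^sub>R (J ** E t))" (is "?L = ?R") for t
  proof -
    let ?c = "exp (- \<i> * of_real (w * t))"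
    have "?L *v x = ?R *v x" for x
    proof -
      let ?v = "from_real (E t *v x)"
      have "?L *v x = to_real (Lin (-1) \<epsilon> (?c *s \<phi>) (?c *s ?v))"
        unfolding matrix_zigzag_real_field matrix_vector_mul_assoc[symmetric] real_matrix_works[OF Lin_linear]
          \<Phi>x to_from \<psi> w_def ..
      also have "\<dots> = to_real (?c *s (Lin I \<epsilon> \<phi> ?v - (\<i> * of_real (1 + I)) *s ?v))"
        by (subst Lin_rotate[of _ _ _ _ I]) simp_all
      also have "\<dots> = ?R *v x"
      proof -
        let ?z = "Lin I \<epsilon> \<phi> ?v"
        have 1: "?R *v x = (cos (w * t) *\<^sub>R to_real ?z - (w * sin (w * t)) *\<^sub>R to_real ?v)
           - (sin (w * t) *\<^sub>R to_real (\<i> *s ?z) + (w * cos (w * t)) *\<^sub>R to_real (\<i> *s ?v))"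
          by (simp add: matrix_vector_mult_diff_rdistrib matrix_vector_mult_add_rdistrib scaleR_matrix_vector_assoc[symmetric]
              matrix_vector_mul_assoc[symmetric] Jx Ax to_from)
        show ?thesis unfolding 1 ecs w_def[symmetric]
          by (simp add: to_real_def vec_eq_iff algebra_simps split: sum.split)
      qed
      finally show ?thesis .
    qed
    then show ?thesis by (simp add: matrix_eq)
  qed
  with d have "\<forall>t. (\<Phi> has_vector_derivative
      matrix (frechet_derivative (zigzag_real_field \<epsilon>) (at (to_real (\<psi> t)))) ** \<Phi> t) (at t)"
    by simp
  moreover have "\<Phi> 0 = mat 1" by (simp add: \<Phi>_def E_def mexp_0)
  moreover have "\<Phi> T = mexp A T" using T by (simp add: \<Phi>_def E_def w_def)
  ultimately show ?thesis unfolding is_monodromy_def A_def[symmetric] by metis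
qed

definition cvec :: "real ^ 'k \<Rightarrow> real ^ 'k \<Rightarrow> complex ^ 'k::finite" where
  "cvec x y = (\<chi> i. Complex (x $ i) (y $ i))"

lemma cmat_cvec: "cmat M *v cvec x y = cvec (M *v x) (M *v y)"
  by (simp add: cmat_def cvec_def matrix_vector_mult_def vec_eq_iff complex_eq_iff)

lemma smult_cvec: "l *s cvec x y = cvec (Re l *\<^sub>R x - Im l *\<^sub>R y) (Im l *\<^sub>R x + Re l *\<^sub>R y)"
  by (simp add: cvec_def vec_eq_iff complex_eq_iff)

lemma cvec_eq_iff: "cvec x y = cvec x' y' \<longleftrightarrow> x = x' \<and> y = y'"
  by (auto simp: cvec_def vec_eq_iff)

lemma cvec_0: "cvec 0 0 = 0"
  by (simp add: cvec_def vec_eq_iff complex_eq_iff)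

lemma cvec_surj: "\<exists>x y. v = cvec x y"
  by (rule exI[of _ "\<chi> i. Re (v $ i)"], rule exI[of _ "\<chi> i. Im (v $ i)"]) (simp add: cvec_def vec_eq_iff)

lemma floquet_multiplier_iff: "floquet_multiplier M \<mu> \<longleftrightarrow> (\<exists>v. v \<noteq> 0 \<and> cmat M *v v = \<mu> *s v)"
  by (simp add: floquet_multiplier_def cmat_def)

lemma unstable_multiplier:
  assumes "linear f" "f v = l *\<^sub>R v" "v \<noteq> 0"
  shows "floquet_multiplier (mexp (real_matrix f) T) (exp (of_real (l * T)))"
proof -
  let ?w = "cvec (to_real v) 0"
  have "cmat (real_matrix f) *v ?w = of_real l *s ?w"
    by (simp add: cmat_cvec smult_cvec cvec_eq_iff real_matrix_works[OF assms(1)] to_from assms(2)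
        linear_scale[OF to_real_linear])
  then have "cmat (mexp (real_matrix f) T) *v ?w = exp (of_real (l * T)) *s ?w"
    using mexp_eigenvector by fastforce
  moreover have "?w \<noteq> 0"
  proof
    assume "?w = 0"
    then have "to_real v = 0" unfolding cvec_0[symmetric] cvec_eq_iff ..
    then have "v = 0" using to_from(2)[of v] linear_0[OF from_real_linear] by metis
    then show False using assms(3) by simp
  qed
  ultimately show ?thesis unfolding floquet_multiplier_iff by blast
qed

text \<open>The complex eigenvalue equation for the eigenvalue \<open>a + i b\<close> and the vector \<open>x + i y\<close>, in real terms: no complexification of the
state space is needed below.\<close>

definition imaginary_spectrum :: "('a::real_vector \<Rightarrow> 'a) \<Rightarrow> bool" where
  "imaginary_spectrum f \<longleftrightarrow> (\<forall>x y a b. f x = a *\<^sub>R x - b *\<^sub>R y \<longrightarrow> f y = b *\<^sub>R x + a *\<^sub>R y \<longrightarrow> x \<noteq> 0 \<or> y \<noteq> 0 \<longrightarrow> a = 0)"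

text \<open>An eigenvector of \<open>exp (T A)\<close> can be replaced by one of \<open>A\<close> itself, so every multiplier is the exponential of \<open>T\<close> times an
eigenvalue of \<open>A\<close>.\<close>

lemma stable_multipliers:
  assumes f: "linear f"
    and spec: "imaginary_spectrum f"
    and mu: "floquet_multiplier (mexp (real_matrix f) T) \<mu>"
  shows "cmod \<mu> = 1"
proof -
  let ?A = "cmat (real_matrix f)" and ?M = "cmat (mexp (real_matrix f) T)"
  have "?A ** ?M = ?M ** ?A" by (simp add: cmat_mult[symmetric] mexp_commute)
  then obtain w l where w: "w \<noteq> 0" "?A *v w = l *s w" "?M *v w = \<mu> *s w"
    using mu commuting_eigenvector unfolding floquet_multiplier_iff by metis
  have "\<mu> *s w = exp (l * of_real T) *s w" using mexp_eigenvector[OF w(2), of T] w(3) by metis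
  then have \<mu>: "\<mu> = exp (l * of_real T)" using w(1) by auto
  obtain x y where xy: "w = cvec x y" using cvec_surj by blast
  have "cvec (to_real (f (from_real x))) (to_real (f (from_real y)))
      = cvec (Re l *\<^sub>R x - Im l *\<^sub>R y) (Im l *\<^sub>R x + Re l *\<^sub>R y)"
    using w(2) by (simp add: xy cmat_cvec smult_cvec real_matrix_works[OF f])
  then have "to_real (f (from_real x)) = Re l *\<^sub>R x - Im l *\<^sub>R y"
    "to_real (f (from_real y)) = Im l *\<^sub>R x + Re l *\<^sub>R y" by (simp_all add: cvec_eq_iff)
  then have "f (from_real x) = from_real (Re l *\<^sub>R x - Im l *\<^sub>R y)"
    "f (from_real y) = from_real (Im l *\<^sub>R x + Re l *\<^sub>R y)" by (metis to_from(2))+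
  then have 1: "f (from_real x) = Re l *\<^sub>R from_real x - Im l *\<^sub>R from_real y"
    "f (from_real y) = Im l *\<^sub>R from_real x + Re l *\<^sub>R from_real y"
    by (simp_all add: linear_diff[OF from_real_linear] linear_add[OF from_real_linear] linear_scale[OF from_real_linear])
  have "from_real x \<noteq> 0 \<or> from_real y \<noteq> 0"
  proof (rule ccontr)
    assume "\<not> ?thesis"
    then have "x = 0" "y = 0" using to_from(1) linear_0[OF to_real_linear] by metis+
    then show False using w(1) by (simp add: xy cvec_0)
  qed
  then have "Re l = 0" by (rule spec[unfolded imaginary_spectrum_def, rule_format, OF 1])
  then show ?thesis by (simp add: \<mu> norm_exp_eq_Re)
qed

section \<open>Periodic solutions near the resonant torus are rotating waves\<close>

definition sites :: "'n::finite bit1 set" where "sites = {0, 1, 2, 3}"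

text \<open>Being the derivative of a periodic function, \<open>g\<close> vanishes somewhere in each period, and from there it can
only grow at rate \<open>B\<close>.\<close>

lemma rolle_periodic_bound:
  fixes f g :: "real \<Rightarrow> real"
  assumes T: "T > 0"
    and f: "\<And>t. (f has_real_derivative g t) (at t)" and per: "\<And>t. f (t + T) = f t"
    and g: "\<And>t. (g has_real_derivative g' t) (at t)" and bd: "\<And>t. \<bar>g' t\<bar> \<le> B"
  shows "\<bar>g t\<bar> \<le> T * B"
proof -
  have "\<exists>z>t. z < t + T \<and> f (t + T) - f t = (t + T - t) * g z"
    by (rule MVT2) (use T f in auto)
  then obtain z where z: "t < z" "z < t + T" "g z = 0" using per[of t] T by auto
  have "\<exists>w>t. w < z \<and> g z - g t = (z - t) * g' w"
    by (rule MVT2) (use z g in auto)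
  then obtain w where w: "g z - g t = (z - t) * g' w" by blast
  have "g t = - ((z - t) * g' w)" using w z by simp
  then have "\<bar>g t\<bar> = (z - t) * \<bar>g' w\<bar>" using z by (simp add: abs_mult)
  also have "\<dots> \<le> T * B" using z bd[of w] T by (intro mult_mono) auto
  finally show ?thesis .
qed

text \<open>Over one period a free oscillation is multiplied by \<open>e\<^sup>i\<^sup>I\<^sup>T \<noteq> 1\<close>; only the forcing can make up for the
difference.\<close>

lemma oscillator_periodic_bound:
  fixes y :: "real \<Rightarrow> complex"
  assumes T: "T > 0" and per: "\<And>t. y (t + T) = y t"
    and y: "\<And>t. (y has_vector_derivative (\<i> * of_real I * y t + r t)) (at t)"
    and bd: "\<And>t. cmod (r t) \<le> B"
  shows "cmod (exp (- \<i> * of_real (I * T)) - 1) * cmod (y t) \<le> T * B"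
proof -
  \<comment> \<open>In the interaction picture only the forcing remains.\<close>
  define u where "u s = exp (- \<i> * of_real (I * (s - t))) * y s" for s
  have du: "(u has_vector_derivative exp (- \<i> * of_real (I * (s - t))) * r s) (at s)" for s
  proof -
    have "((\<lambda>s. exp (- \<i> * of_real (I * (s - t)))) has_vector_derivative
        (- \<i> * of_real I) * exp (- \<i> * of_real (I * (s - t)))) (at s)"
    proof -
      have "((\<lambda>z. exp (- \<i> * (of_real I * (z - of_real t)))) has_field_derivative
        (- \<i> * of_real I) * exp (- \<i> * (of_real I * (of_real s - of_real t)))) (at (of_real s))"
        by (rule derivative_eq_intros refl | simp)+
      from has_vector_derivative_real_field[OF this] show ?thesis by simp
    qed
    from has_vector_derivative_mult[OF this y[of s]] show ?thesis
      unfolding u_def[abs_def] by (rule has_vector_derivative_eq_rhs) (simp add: algebra_simps)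
  qed
  have "norm (u (t + T) - u t) \<le> B * norm (t + T - t)"
  proof (rule differentiable_bound[where S = "{t..t + T}" and f' = "\<lambda>s h. h *\<^sub>R (exp (- \<i> * of_real (I * (s - t))) * r s)"])
    show "(u has_derivative (\<lambda>h. h *\<^sub>R (exp (- \<i> * of_real (I * (s - t))) * r s))) (at s within {t..t + T})" for s
      using du[of s] unfolding has_vector_derivative_def by (rule has_derivative_at_withinI)
    show "onorm (\<lambda>h. h *\<^sub>R (exp (- \<i> * of_real (I * (s - t))) * r s)) \<le> B" for s
      by (rule onorm_le) (use mult_left_mono[OF bd[of s] abs_ge_zero] in \<open>simp add: norm_mult mult.commute\<close>)
  qed (use T in auto)
  moreover have "u (t + T) - u t = (exp (- \<i> * of_real (I * T)) - 1) * y t"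
    using per[of t] by (simp add: u_def algebra_simps)
  ultimately show ?thesis using T by (simp add: norm_mult mult.commute)
qed

lemma periodic_bounded:
  fixes f :: "real \<Rightarrow> 'a::real_normed_vector"
  assumes "T > 0" "\<And>t. f (t + T) = f t" "continuous_on UNIV f"
  shows "\<exists>s. \<forall>t. norm (f t) \<le> norm (f s)"
proof -
  have "\<exists>s\<in>{0..T}. \<forall>t\<in>{0..T}. norm (f t) \<le> norm (f s)"
    by (rule continuous_attains_sup)
      (use assms in \<open>auto intro!: continuous_intros intro: continuous_on_subset\<close>)
  then obtain s where s: "\<And>t. t \<in> {0..T} \<Longrightarrow> norm (f t) \<le> norm (f s)" by blast
  have perk: "f (t + of_int k * T) = f t" for t and k :: int
  proof (induction k rule: int_induct[where k = 0])
    case (step1 i)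
    then show ?case using assms(2)[of "t + of_int i * T"] by (simp add: algebra_simps)
  next
    case (step2 i)
    then show ?case using assms(2)[of "t + of_int (i - 1) * T"] by (simp add: algebra_simps)
  qed simp
  have "norm (f t) \<le> norm (f s)" for t
  proof -
    define k where "k = \<lfloor>t / T\<rfloor>"
    have "of_int k \<le> t / T" "t / T < of_int k + 1" unfolding k_def by linarith+
    then have "t + of_int (- k) * T \<in> {0..T}" using assms(1) by (simp add: field_simps)
    then show ?thesis using s perk[of t "- k"] by metis
  qed
  then show ?thesis by blast
qed

lemma Lin_0_off: "\<phi>0 $ j = 0 \<Longrightarrow> Lin I 0 \<phi>0 v $ j = \<i> * of_real I * v $ j"
  by (simp add: Lin_def Hess_def)

lemma Lin_0_on:
  assumes "cmod (\<phi>0 $ j) = sqrt I" "I > 0"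
  shows "cnj (\<phi>0 $ j) * Lin I 0 \<phi>0 v $ j = - 2 * \<i> * of_real (I * Re (cnj (\<phi>0 $ j) * v $ j))"
proof -
  let ?u = "\<phi>0 $ j" and ?Z = "cnj (\<phi>0 $ j) * v $ j"
  have uu: "?u * cnj ?u = of_real I"
    using complex_norm_square[of ?u] assms by simp
  have "cnj ?u * Lin I 0 \<phi>0 v $ j = - \<i> * ((2 * (?u * cnj ?u) - of_real I) * ?Z + (?u * cnj ?u) * cnj ?Z)"
    by (simp add: Lin_def Hess_def algebra_simps power2_eq_square)
  also have "\<dots> = - \<i> * of_real I * (?Z + cnj ?Z)" unfolding uu by (simp add: algebra_simps)
  also have "\<dots> = - 2 * \<i> * of_real (I * Re ?Z)" unfolding complex_add_cnj by simp
  finally show ?thesis .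
qed

lemma norm_vec_le_card:
  fixes v :: "'a::real_normed_vector ^ 'n::finite"
  assumes "\<And>j. norm (v $ j) \<le> K"
  shows "norm v \<le> real CARD('n) * K"
proof -
  have "norm v \<le> (\<Sum>j\<in>UNIV. norm (v $ j))" unfolding norm_vec_def by (rule L2_set_le_sum) simp
  also have "\<dots> \<le> (\<Sum>j\<in>(UNIV::'n set). K)" by (rule sum_mono) (rule assms)
  finally show ?thesis by simp
qed

text \<open>The uncoupled linearisation splits into free oscillators on the empty sites and, in the direction of \<open>\<phi>0 $ j\<close>, the
nilpotent block \<open>(Re, Im) \<mapsto> (0, - 2 I Re)\<close> on each excited site. In the latter first the real part and then the imaginary
part is controlled, each as the derivative of a periodic function.\<close>

lemma linear_response_bound:
  fixes \<phi>0 :: "('n::finite) state"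
  assumes I: "I > 0" and T: "T > 0"
    and nonres: "exp (- \<i> * of_real (I * T)) \<noteq> 1"
    and \<phi>0: "\<And>j. j \<in> sites \<Longrightarrow> cmod (\<phi>0 $ j) = sqrt I" "\<And>j. j \<notin> sites \<Longrightarrow> \<phi>0 $ j = 0"
  shows "\<exists>C>0. \<forall>\<Phi> Y r B t. (\<forall>t. (\<Phi> has_vector_derivative Y t) (at t)) \<longrightarrow> (\<forall>t. \<Phi> (t + T) = \<Phi> t) \<longrightarrow>
       (\<forall>t. Y (t + T) = Y t) \<longrightarrow>
       (\<forall>t. (Y has_vector_derivative (Lin I 0 \<phi>0 (Y t) + r t)) (at t)) \<longrightarrow> (\<forall>t. norm (r t) \<le> B) \<longrightarrow>
       norm (Y t) \<le> C * B"
proof -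
  define d where "d = cmod (exp (- \<i> * of_real (I * T)) - 1)"
  define C1 where "C1 = T * (2 * I * T + 2) + T / d"
  have d: "d > 0" using nonres by (simp add: d_def)
  have C1: "C1 > 0" using d I T by (auto simp: C1_def intro!: add_pos_pos mult_pos_pos divide_pos_pos)
  define C where "C = real CARD('n bit1) * C1"
  have "C > 0" using C1 by (simp add: C_def)
  moreover have "norm (Y t) \<le> C * B"
    if "\<forall>t. (\<Phi> has_vector_derivative Y t) (at t)" "\<forall>t. \<Phi> (t + T) = \<Phi> t"
      "\<forall>t. Y (t + T) = Y t" "\<forall>t. (Y has_vector_derivative (Lin I 0 \<phi>0 (Y t) + r t)) (at t)"
      "\<forall>t. norm (r t) \<le> B" for \<Phi> Y r B t
  proof -
    note D\<Phi> = that(1)[rule_format] and per = that(2)[rule_format] and perY = that(3)[rule_format]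
      and DY = that(4)[rule_format] and rB = that(5)[rule_format]
    have B: "B \<ge> 0" using rB[of 0] norm_ge_zero order_trans by blast
    have rj: "cmod (r t $ j) \<le> B" for t j
      using rB[of t] Finite_Cartesian_Product.norm_nth_le[of "r t" j] by linarith
    have D\<Phi>j: "((\<lambda>t. \<Phi> t $ j) has_vector_derivative Y t $ j) (at t)" for t j
      using D\<Phi>[of t] has_vector_derivative_vec_iff by blast
    have DYj: "((\<lambda>t. Y t $ j) has_vector_derivative (Lin I 0 \<phi>0 (Y t) $ j + r t $ j)) (at t)" for t j
      using DY[of t] has_vector_derivative_vec_iff[of Y] by simp
    have "cmod (Y t $ j) \<le> C1 * B" for j
    proof (cases "j \<in> sites")
      case False
      have "d * cmod (Y t $ j) \<le> T * B"
        unfolding d_def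
        by (rule oscillator_periodic_bound[where r = "\<lambda>t. r t $ j"])
          (use T perY rj DYj[of j] False \<phi>0(2) in \<open>simp_all add: Lin_0_off\<close>)
      then have "cmod (Y t $ j) \<le> (T / d) * B" using d by (simp add: field_simps)
      also have "\<dots> \<le> C1 * B" unfolding C1_def
        by (intro mult_right_mono) (use B I T in auto)
      finally show ?thesis .
    next
      case True
      define u where "u = \<phi>0 $ j"
      have u: "cmod u = sqrt I" using \<phi>0(1) True by (simp add: u_def)
      have ur: "cmod (cnj u * r t $ j) \<le> sqrt I * B" for t
        using rj[of t j] I by (simp add: norm_mult u)
      have Lon: "cnj u * Lin I 0 \<phi>0 v $ j = - 2 * \<i> * of_real (I * Re (cnj u * v $ j))" for v
        unfolding u_def by (rule Lin_0_on) (use \<phi>0(1) True I in auto)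
      have re: "((\<lambda>t. Re (cnj u * f t)) has_real_derivative Re (cnj u * f')) (at t)"
        and im: "((\<lambda>t. Im (cnj u * f t)) has_real_derivative Im (cnj u * f')) (at t)"
        if "(f has_vector_derivative f') (at t)" for f f' t
        unfolding has_real_derivative_iff_has_vector_derivative
        by (intro bounded_linear.has_vector_derivative[OF bounded_linear_Re] bounded_linear.has_vector_derivative[OF bounded_linear_Im]
            bounded_linear.has_vector_derivative[OF bounded_linear_mult_right] that)+
      have A: "\<bar>Re (cnj u * Y t $ j)\<bar> \<le> T * (sqrt I * B)" for t
      proof (rule rolle_periodic_bound[OF T re[OF D\<Phi>j]])
        show "Re (cnj u * \<Phi> (t + T) $ j) = Re (cnj u * \<Phi> t $ j)" for t by (simp add: per)
        show "((\<lambda>t. Re (cnj u * Y t $ j)) has_real_derivative Re (cnj u * r t $ j)) (at t)" for t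
          using re[OF DYj[of j t]] by (simp add: distrib_left Lon del: mult_minus_left)
        show "\<bar>Re (cnj u * r t $ j)\<bar> \<le> sqrt I * B" for t
          using abs_Re_le_cmod ur order_trans by blast
      qed
      have A2: "\<bar>Im (cnj u * Y t $ j)\<bar> \<le> T * (2 * I * (T * (sqrt I * B)) + sqrt I * B)"
      proof (rule rolle_periodic_bound[OF T im[OF D\<Phi>j]])
        show "Im (cnj u * \<Phi> (t + T) $ j) = Im (cnj u * \<Phi> t $ j)" for t by (simp add: per)
        show "((\<lambda>t. Im (cnj u * Y t $ j)) has_real_derivative
            - 2 * I * Re (cnj u * Y t $ j) + Im (cnj u * r t $ j)) (at t)" for t
        proof -
          have "Im (cnj u * (Lin I 0 \<phi>0 (Y t) $ j + r t $ j)) = - 2 * I * Re (cnj u * Y t $ j) + Im (cnj u * r t $ j)"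
            unfolding distrib_left Lon by simp
          then show ?thesis using im[OF DYj[of j t]] by simp
        qed
        have "\<bar>- 2 * I * Re (cnj u * Y t $ j) + Im (cnj u * r t $ j)\<bar>
            \<le> 2 * I * \<bar>Re (cnj u * Y t $ j)\<bar> + \<bar>Im (cnj u * r t $ j)\<bar>" for t
          by (rule order_trans[OF abs_triangle_ineq]) (use I in \<open>simp add: abs_mult\<close>)
        also have "\<dots> t \<le> 2 * I * (T * (sqrt I * B)) + sqrt I * B" for t
          by (rule add_mono[OF mult_left_mono[OF A]]) (use I ur[of t] abs_Im_le_cmod[of "cnj u * r t $ j"] in auto)
        finally show "\<bar>- 2 * I * Re (cnj u * Y t $ j) + Im (cnj u * r t $ j)\<bar>
            \<le> 2 * I * (T * (sqrt I * B)) + sqrt I * B" for t .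
      qed
      have "sqrt I * cmod (Y t $ j) = cmod (cnj u * Y t $ j)" by (simp add: norm_mult u)
      also have "\<dots> \<le> \<bar>Re (cnj u * Y t $ j)\<bar> + \<bar>Im (cnj u * Y t $ j)\<bar>" by (rule cmod_le)
      also have "\<dots> \<le> T * (sqrt I * B) + T * (2 * I * (T * (sqrt I * B)) + sqrt I * B)"
        by (rule add_mono[OF A A2])
      also have "\<dots> = sqrt I * (T * (2 * I * T + 2) * B)" by (simp add: algebra_simps)
      finally have "cmod (Y t $ j) \<le> T * (2 * I * T + 2) * B" using I by simp
      also have "\<dots> \<le> C1 * B" unfolding C1_def by (intro mult_right_mono) (use B d T in auto)
      finally show ?thesis .
    qed
    then show ?thesis unfolding C_def mult.assoc by (rule norm_vec_le_card)
  qed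
  ultimately show ?thesis by (intro exI[of _ C] conjI allI impI)
qed

lemma continuous_on_lap [continuous_intros]:
  "continuous_on A f \<Longrightarrow> continuous_on A (\<lambda>x. lap (f x :: 'a::euclidean_space ^ _))"
  unfolding lap_def by (intro continuous_intros)

lemma continuous_on_Lin:
  "continuous_on UNIV (\<lambda>((\<epsilon>, \<phi>), v). Lin I \<epsilon> \<phi> v)"
  unfolding Lin_def Hess_def case_prod_unfold by (intro continuous_intros)

text \<open>By homogeneity in \<open>v\<close> this is uniform continuity over the compact unit sphere.\<close>

lemma Lin_close:
  fixes \<phi>0 :: "('n::finite) state"
  assumes "\<eta> > 0"
  shows "\<exists>\<delta>>0. \<forall>\<epsilon> \<phi> v. \<bar>\<epsilon>\<bar> < \<delta> \<longrightarrow> norm (\<phi> - \<phi>0) < \<delta> \<longrightarrow>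
    norm (Lin I \<epsilon> \<phi> v - Lin I 0 \<phi>0 v) \<le> \<eta> * norm v"
proof -
  let ?f = "\<lambda>((\<epsilon>, \<phi>), v :: 'n state). Lin I \<epsilon> \<phi> v"
  have "continuous_on (UNIV \<times> sphere 0 1) ?f"
    by (rule continuous_on_subset[OF continuous_on_Lin]) simp
  then obtain X0 where X0: "(0, \<phi>0) \<in> X0" "open X0"
    "\<forall>x\<in>X0 \<inter> UNIV. \<forall>t\<in>sphere 0 1. dist (?f (x, t)) (?f ((0, \<phi>0), t)) \<le> \<eta>"
    using continuous_on_prod_compactE[of UNIV "sphere 0 1" ?f "(0, \<phi>0)" \<eta>] assms
    by (metis UNIV_I compact_sphere)
  obtain d where d: "d > 0" "ball (0, \<phi>0) d \<subseteq> X0" using X0(1,2) open_contains_ball by blast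
  have "norm (Lin I \<epsilon> \<phi> v - Lin I 0 \<phi>0 v) \<le> \<eta> * norm v"
    if "\<bar>\<epsilon>\<bar> < d / 2" "norm (\<phi> - \<phi>0) < d / 2" for \<epsilon> \<phi> v
  proof (cases "v = 0")
    case True
    then show ?thesis by (simp add: linear_0[OF Lin_linear])
  next
    case False
    have "dist (0, \<phi>0) (\<epsilon>, \<phi>) \<le> \<bar>\<epsilon>\<bar> + norm (\<phi> - \<phi>0)"
      unfolding dist_Pair_Pair by (rule order_trans[OF sqrt_sum_squares_le_sum]) (auto simp: dist_norm norm_minus_commute)
    then have "(\<epsilon>, \<phi>) \<in> X0" using d that by auto
    moreover have "v /\<^sub>R norm v \<in> sphere 0 1" using False by simp
    ultimately have "dist (Lin I \<epsilon> \<phi> (v /\<^sub>R norm v)) (Lin I 0 \<phi>0 (v /\<^sub>R norm v)) \<le> \<eta>"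
      using X0(3) by fastforce
    then have "norm ((Lin I \<epsilon> \<phi> v - Lin I 0 \<phi>0 v) /\<^sub>R norm v) \<le> \<eta>"
      by (simp only: dist_norm linear_scale[OF Lin_linear] scaleR_diff_right)
    moreover have "norm ((Lin I \<epsilon> \<phi> v - Lin I 0 \<phi>0 v) /\<^sub>R norm v) = norm (Lin I \<epsilon> \<phi> v - Lin I 0 \<phi>0 v) / norm v"
      by (simp only: norm_scaleR) (simp add: divide_inverse mult.commute)
    ultimately show ?thesis using False by (simp add: pos_divide_le_eq)
  qed
  moreover have "d / 2 > 0" using d(1) by simp
  ultimately show ?thesis by (intro exI[of _ "d / 2"] conjI allI impI)
qed

text \<open>The velocity \<open>Y\<close> of a periodic solution solves its own variational equation. Compared with the uncoupled one
the error is at most \<open>|Y| / (2 C)\<close>, so the response bound gives \<open>sup |Y| \<le> sup |Y| / 2\<close>.\<close>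

lemma periodic_near_equilibrium_constant:
  fixes \<phi>0 :: "('n::finite) state"
  assumes I: "I > 0" and T: "T > 0"
    and nonres: "exp (- \<i> * of_real (I * T)) \<noteq> 1"
    and \<phi>0: "\<And>j. j \<in> sites \<Longrightarrow> cmod (\<phi>0 $ j) = sqrt I" "\<And>j. j \<notin> sites \<Longrightarrow> \<phi>0 $ j = 0"
  shows "\<exists>\<delta>>0. \<forall>\<epsilon> \<Phi>. \<bar>\<epsilon>\<bar> < \<delta> \<longrightarrow>
       (\<forall>t. (\<Phi> has_vector_derivative rot_field I \<epsilon> (\<Phi> t)) (at t)) \<longrightarrow>
       (\<forall>t. \<Phi> (t + T) = \<Phi> t) \<longrightarrow> (\<forall>t. norm (\<Phi> t - \<phi>0) < \<delta>) \<longrightarrow>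
       (\<forall>t. \<Phi> t = \<Phi> 0) \<and> rot_field I \<epsilon> (\<Phi> 0) = 0"
proof -
  obtain C where C: "C > 0" and resp: "\<forall>\<Phi> Y r B t. (\<forall>t. (\<Phi> has_vector_derivative Y t) (at t)) \<longrightarrow> (\<forall>t. \<Phi> (t + T) = \<Phi> t) \<longrightarrow>
       (\<forall>t. Y (t + T) = Y t) \<longrightarrow>
       (\<forall>t. (Y has_vector_derivative (Lin I 0 \<phi>0 (Y t) + r t)) (at t)) \<longrightarrow> (\<forall>t. norm (r t) \<le> B) \<longrightarrow>
       norm (Y t) \<le> C * B"
    using linear_response_bound[of I T \<phi>0, OF I T nonres \<phi>0] by blast
  have "1 / (2 * C) > 0" using C by simp
  from Lin_close[OF this, of \<phi>0 I] obtain \<delta> where \<delta>: "\<delta> > 0" and close: "\<forall>\<epsilon> \<phi> v. \<bar>\<epsilon>\<bar> < \<delta> \<longrightarrow> norm (\<phi> - \<phi>0) < \<delta> \<longrightarrow>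
      norm (Lin I \<epsilon> \<phi> v - Lin I 0 \<phi>0 v) \<le> 1 / (2 * C) * norm v"
    by blast
  have main: "(\<forall>t. \<Phi> t = \<Phi> 0) \<and> rot_field I \<epsilon> (\<Phi> 0) = 0"
    if e: "\<bar>\<epsilon>\<bar> < \<delta>" and "\<forall>t. (\<Phi> has_vector_derivative rot_field I \<epsilon> (\<Phi> t)) (at t)"
      "\<forall>t. \<Phi> (t + T) = \<Phi> t" "\<forall>t. norm (\<Phi> t - \<phi>0) < \<delta>" for \<epsilon> \<Phi>
  proof -
    note D = that(2)[rule_format] and per = that(3)[rule_format] and near = that(4)[rule_format]
    define Y where "Y t = rot_field I \<epsilon> (\<Phi> t)" for t
    have DY: "(Y has_vector_derivative Lin I \<epsilon> (\<Phi> t) (Y t)) (at t)" for t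
    proof -
      have "((\<lambda>t. rot_field I \<epsilon> (\<Phi> t)) has_derivative (\<lambda>h. Lin I \<epsilon> (\<Phi> t) (h *\<^sub>R Y t))) (at t)"
        by (rule has_derivative_compose[OF D[of t, unfolded has_vector_derivative_def, folded Y_def] rot_field_has_derivative])
      then show ?thesis
        unfolding has_vector_derivative_def Y_def[abs_def] by (simp add: linear_scale[OF Lin_linear])
    qed
    have perY: "Y (t + T) = Y t" for t by (simp add: Y_def per)
    have contY: "continuous_on UNIV Y"
      by (rule continuous_at_imp_continuous_on) (use has_vector_derivative_continuous[OF DY] in simp)
    obtain s where "\<forall>t. norm (Y t) \<le> norm (Y s)"
      using periodic_bounded[of T Y, OF T perY contY] by blast
    then have s: "norm (Y t) \<le> norm (Y s)" for t by blast
    define K where "K = norm (Y s)"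
    define r where "r t = Lin I \<epsilon> (\<Phi> t) (Y t) - Lin I 0 \<phi>0 (Y t)" for t
    have "norm (Y s) \<le> C * (1 / (2 * C) * K)"
    proof (rule resp[rule_format, of \<Phi> Y r])
      show "(\<Phi> has_vector_derivative Y t) (at t)" for t using D by (simp add: Y_def)
      show "(Y has_vector_derivative Lin I 0 \<phi>0 (Y t) + r t) (at t)" for t using DY by (simp add: r_def)
      show "norm (r t) \<le> 1 / (2 * C) * K" for t
      proof -
        have "norm (r t) \<le> 1 / (2 * C) * norm (Y t)" unfolding r_def by (rule close[rule_format, OF e near])
        also have "\<dots> \<le> 1 / (2 * C) * K" using s[of t] C by (intro mult_left_mono) (auto simp: K_def)
        finally show ?thesis .
      qed
    qed (fact per perY)+
    then have "K \<le> K / 2" using C by (simp add: K_def)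
    then have "norm (Y t) = 0" for t using s[of t] norm_ge_zero[of "Y t"] unfolding K_def by linarith
    then have Y0: "Y t = 0" for t by simp
    then have D0: "(\<Phi> has_vector_derivative 0) (at t)" for t using D[of t] by (simp add: Y_def)
    obtain c where "\<And>t. t \<in> UNIV \<Longrightarrow> \<Phi> t = c"
      by (rule has_vector_derivative_zero_constant[of UNIV \<Phi>]) (auto intro: D0)
    then have "\<Phi> t = \<Phi> 0" for t by simp
    moreover have "rot_field I \<epsilon> (\<Phi> 0) = 0" using Y0[of 0] by (simp add: Y_def)
    ultimately show ?thesis by blast
  qed
  show ?thesis by (intro exI[of _ \<delta>] conjI[OF \<delta>] allI impI) (erule (3) main)
qed

section \<open>The excited sites and the continuation of rotating waves\<close>

lemma of_int_bit1_eq_iff: "(of_int a :: 'n::finite bit1) = of_int b \<longleftrightarrow> int CARD('n bit1) dvd a - b"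
proof -
  have "(of_int a :: 'n bit1) = of_int b \<longleftrightarrow> (of_int (a - b) :: 'n bit1) = 0" by simp
  then show ?thesis by (simp only: of_int_eq_0_iff_char_dvd bit1.CHAR_eq)
qed

text \<open>In a ring of at least seven sites, integers at distance at most six stay distinct. So \<open>0, 1, 2, 3\<close> are different sites, and
their outer neighbours \<open>-2, -1, 4, 5\<close> are empty.\<close>

lemma of_int_bit1_neq:
  assumes "CARD('n::finite) \<ge> 3" "a \<noteq> b" "\<bar>a - b\<bar> \<le> 6"
  shows "(of_int a :: 'n bit1) \<noteq> of_int b"
proof
  assume "(of_int a :: 'n bit1) = of_int b"
  then have "int CARD('n bit1) dvd a - b" by (simp only: of_int_bit1_eq_iff)
  then have "int CARD('n bit1) \<le> \<bar>a - b\<bar>" using assms(2) dvd_imp_le_int[of "a - b" "int CARD('n bit1)"] by simp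
  then show False using assms by simp
qed

lemma sites_distinct:
  assumes "CARD('n::finite) \<ge> 3"
  shows "(0::'n bit1) \<noteq> 1" "(0::'n bit1) \<noteq> 2" "(0::'n bit1) \<noteq> 3" "(1::'n bit1) \<noteq> 2" "(1::'n bit1) \<noteq> 3" "(2::'n bit1) \<noteq> 3"
    "(-1::'n bit1) \<notin> sites" "(-2::'n bit1) \<notin> sites" "(4::'n bit1) \<notin> sites" "(5::'n bit1) \<notin> sites"
  using of_int_bit1_neq[OF assms, of 0 1] of_int_bit1_neq[OF assms, of 0 2] of_int_bit1_neq[OF assms, of 0 3]
    of_int_bit1_neq[OF assms, of 1 2] of_int_bit1_neq[OF assms, of 1 3] of_int_bit1_neq[OF assms, of 2 3]
    of_int_bit1_neq[OF assms, of "-1" 0] of_int_bit1_neq[OF assms, of "-1" 1] of_int_bit1_neq[OF assms, of "-1" 2] of_int_bit1_neq[OF assms, of "-1" 3]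
    of_int_bit1_neq[OF assms, of "-2" 0] of_int_bit1_neq[OF assms, of "-2" 1] of_int_bit1_neq[OF assms, of "-2" 2] of_int_bit1_neq[OF assms, of "-2" 3]
    of_int_bit1_neq[OF assms, of 4 0] of_int_bit1_neq[OF assms, of 4 1] of_int_bit1_neq[OF assms, of 4 2] of_int_bit1_neq[OF assms, of 4 3]
    of_int_bit1_neq[OF assms, of 5 0] of_int_bit1_neq[OF assms, of 5 1] of_int_bit1_neq[OF assms, of 5 2] of_int_bit1_neq[OF assms, of 5 3]
  unfolding sites_def by simp_all

lemma sum_sites:
  assumes "CARD('n::finite) \<ge> 3"
  shows "sum f (sites :: 'n bit1 set) = f 0 + f 1 + f 2 + f 3"
  using sites_distinct[OF assms] by (simp add: sites_def add_ac)

lemma lap_sites: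
  fixes v :: "real ^ ('n::finite bit1)"
  assumes n: "CARD('n) \<ge> 3" and off: "\<And>j. j \<notin> sites \<Longrightarrow> v $ j = 0"
  shows "lap v $ 0 = 4 * v $ 0 - v $ 1 - v $ 2"
    "lap v $ 1 = 4 * v $ 1 - v $ 0 - v $ 2 - v $ 3"
    "lap v $ 2 = 4 * v $ 2 - v $ 0 - v $ 1 - v $ 3"
    "lap v $ 3 = 4 * v $ 3 - v $ 1 - v $ 2"
proof -
  have o: "v $ (-1) = 0" "v $ (-2) = 0" "v $ 4 = 0" "v $ 5 = 0"
    using off sites_distinct[OF n] by auto
  show "lap v $ 0 = 4 * v $ 0 - v $ 1 - v $ 2" using o by (simp add: lap_def)
  show "lap v $ 1 = 4 * v $ 1 - v $ 0 - v $ 2 - v $ 3" using o by (simp add: lap_def)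
  show "lap v $ 2 = 4 * v $ 2 - v $ 0 - v $ 1 - v $ 3" using o by (simp add: lap_def)
  show "lap v $ 3 = 4 * v $ 3 - v $ 1 - v $ 2" using o by (simp add: lap_def)
qed

text \<open>Relative phases \<open>0\<close> and \<open>\<pi>\<close>, encoded by the signs of their cosines; \<open>0\<close> marks the empty sites.\<close>

definition sign_pattern :: "real ^ ('n::finite bit1) \<Rightarrow> bool" where
  "sign_pattern \<sigma> \<longleftrightarrow> (\<forall>j\<in>sites. \<sigma> $ j * \<sigma> $ j = 1) \<and> (\<forall>j. j \<notin> sites \<longrightarrow> \<sigma> $ j = 0)"

lemma sign_pattern_on: "sign_pattern \<sigma> \<Longrightarrow> j \<in> sites \<Longrightarrow> \<sigma> $ j * \<sigma> $ j = 1"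
  and sign_pattern_off: "sign_pattern \<sigma> \<Longrightarrow> j \<notin> sites \<Longrightarrow> \<sigma> $ j = 0"
  by (simp_all add: sign_pattern_def)

text \<open>The Laplacian with bond weights \<open>\<sigma>\<^sub>j \<sigma>\<^sub>k\<close>: the quadratic part, in the phases, of the bond energy at the pattern \<open>\<sigma>\<close>.\<close>

definition bond_lap :: "real ^ ('n::finite bit1) \<Rightarrow> real ^ ('n bit1) \<Rightarrow> 'n bit1 \<Rightarrow> real" where
  "bond_lap \<sigma> b j = \<sigma> $ j * lap (\<chi> k. \<sigma> $ k * b $ k) $ j - \<sigma> $ j * lap \<sigma> $ j * b $ j"

text \<open>On the excited sites: the Laplacian of the graph with bonds 01, 02, 12, 13, 23 and weights \<open>\<sigma>\<^sub>j \<sigma>\<^sub>k\<close>.\<close>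

lemma bond_lap_sites:
  fixes \<sigma> :: "real ^ ('n::finite bit1)"
  assumes n: "CARD('n) \<ge> 3" and \<sigma>: "sign_pattern \<sigma>"
  shows "bond_lap \<sigma> b 0 = \<sigma> $ 0 * \<sigma> $ 1 * (b $ 0 - b $ 1) + \<sigma> $ 0 * \<sigma> $ 2 * (b $ 0 - b $ 2)"
    "bond_lap \<sigma> b 1 = \<sigma> $ 0 * \<sigma> $ 1 * (b $ 1 - b $ 0) + \<sigma> $ 1 * \<sigma> $ 2 * (b $ 1 - b $ 2) + \<sigma> $ 1 * \<sigma> $ 3 * (b $ 1 - b $ 3)"
    "bond_lap \<sigma> b 2 = \<sigma> $ 0 * \<sigma> $ 2 * (b $ 2 - b $ 0) + \<sigma> $ 1 * \<sigma> $ 2 * (b $ 2 - b $ 1) + \<sigma> $ 2 * \<sigma> $ 3 * (b $ 2 - b $ 3)"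
    "bond_lap \<sigma> b 3 = \<sigma> $ 1 * \<sigma> $ 3 * (b $ 3 - b $ 1) + \<sigma> $ 2 * \<sigma> $ 3 * (b $ 3 - b $ 2)"
  by (simp_all add: bond_lap_def lap_sites[OF n] sign_pattern_off[OF \<sigma>]) (simp_all add: algebra_simps)

text \<open>Restricting to real amplitudes removes the phase degeneracy: at \<open>\<epsilon> = 0\<close> the derivative is diagonal with
entries \<open>2 I\<close> on the excited and \<open>- I\<close> on the empty sites.\<close>

lemma real_branch:
  fixes \<sigma> :: "real ^ ('n::finite bit1)"
  assumes I: "I > 0" and \<sigma>: "sign_pattern \<sigma>"
  shows "\<exists>X :: real \<Rightarrow> real ^ ('n bit1).
    (\<forall>\<^sub>F \<epsilon> in nhds 0. \<forall>j. ((X \<epsilon> $ j)\<^sup>2 - I) * X \<epsilon> $ j + \<epsilon> * lap (X \<epsilon>) $ j = 0) \<and> (X \<longlongrightarrow> sqrt I *\<^sub>R \<sigma>) (nhds 0)"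
proof -
  note on = sign_pattern_on[OF \<sigma>] and off = sign_pattern_off[OF \<sigma>]
  define G :: "real \<times> (real ^ ('n bit1)) \<Rightarrow> real ^ ('n bit1)" where
    "G = (\<lambda>(\<epsilon>, X). \<chi> j. ((X $ j)\<^sup>2 - I) * X $ j + \<epsilon> * lap X $ j)"
  define X0 where "X0 = sqrt I *\<^sub>R \<sigma>"
  have sq: "(X0 $ j)\<^sup>2 = (if j \<in> sites then I else 0)" for j
    using on[of j] off[of j] I by (simp add: X0_def power_mult_distrib power2_eq_square[of "\<sigma> $ j"])
  have cont: "continuous_on UNIV G"
    unfolding G_def case_prod_unfold by (intro continuous_intros)
  have zero: "G (0, X0) = 0"
  proof -
    have "X0 $ j = 0" if "j \<notin> sites" for j using off[OF that] by (simp add: X0_def)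
    then show ?thesis by (auto simp: G_def vec_eq_iff sq)
  qed
  define D :: "real ^ ('n bit1) \<Rightarrow> real ^ ('n bit1)" where "D h = (\<chi> j. (3 * (X0 $ j)\<^sup>2 - I) * h $ j)" for h
  have "((\<lambda>X. G (0, X) $ j) has_derivative (\<lambda>h. D h $ j)) (at X0)" for j
  proof -
    have "((\<lambda>X::real ^ ('n bit1). ((X $ j)\<^sup>2 - I) * X $ j) has_derivative (\<lambda>h. D h $ j)) (at X0)"
      unfolding D_def vec_lambda_beta
      by (rule derivative_eq_intros has_derivative_vec_nth refl)+ (rule ext, simp add: algebra_simps power2_eq_square)
    then show ?thesis by (simp add: G_def)
  qed
  then have der: "((\<lambda>X. G (0, X)) has_derivative D) (at X0)" by (simp add: has_derivative_vec_iff)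
  have inj: "h = 0" if "D h = 0" for h
    using that I by (auto simp: D_def vec_eq_iff sq split: if_splits)
  obtain X where X: "\<forall>\<^sub>F \<epsilon> in nhds 0. G (\<epsilon>, X \<epsilon>) = 0" "(X \<longlongrightarrow> X0) (nhds 0)"
    using zero_branch[OF cont zero der inj] by blast
  have "\<forall>\<^sub>F \<epsilon> in nhds 0. \<forall>j. ((X \<epsilon> $ j)\<^sup>2 - I) * X \<epsilon> $ j + \<epsilon> * lap (X \<epsilon>) $ j = 0"
    using X(1) by (rule eventually_mono) (simp add: G_def vec_eq_iff)
  then show ?thesis using X(2) unfolding X0_def by blast
qed

section \<open>The rescaled Hessian\<close>

text \<open>Perturbations are written relative to \<open>\<phi>\<close> on the excited sites, as \<open>\<phi>\<^sub>j (e A + i b)\<close>. Amplitudes \<open>A\<close> and phases \<open>b\<close> are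
conjugate variables whose energies have sizes \<open>1\<close> and \<open>\<epsilon> = e\<^sup>2\<close>; this weighting balances them. On the empty sites
the factor \<open>e\<close> makes the coupling to the excited ones vanish as \<open>e \<longrightarrow> 0\<close>.\<close>

definition rescale :: "real \<Rightarrow> 'n state \<Rightarrow> 'n state \<Rightarrow> ('n::finite) state" where
  "rescale e \<phi> C = (\<chi> j. if j \<in> sites then \<phi> $ j * (of_real (e * Re (C $ j)) + \<i> * of_real (Im (C $ j)))
                 else of_real e * C $ j)"

text \<open>At an equilibrium \<open>|\<phi>\<^sub>j|\<^sup>2 - I\<close> equals \<open>- \<epsilon>\<close> times the Laplacian of \<open>\<phi>\<close> over \<open>\<phi>\<^sub>j\<close>. Substituting this into the Hessian
leaves the first summand from the coupling and turns the detuning into the second, without a division.\<close>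

definition coupling :: "real \<Rightarrow> 'n state \<Rightarrow> 'n state \<Rightarrow> ('n::finite) bit1 \<Rightarrow> complex" where
  "coupling e \<phi> C j = cnj (\<phi> $ j) * lap (rescale e \<phi> C) $ j
     - cnj (\<phi> $ j) * lap \<phi> $ j * (of_real (e * Re (C $ j)) + \<i> * of_real (Im (C $ j)))"

text \<open>This is \<open>e\<^sup>-\<^sup>2 R\<^sup>* Hess R\<close> with \<open>R\<close> the rescaling, written as a polynomial in \<open>(e, \<phi>)\<close> so that it makes sense for \<open>e = 0\<close>.
It has this meaning at equilibria \<open>\<phi>\<close> only; see \<open>Hess_rescale_site\<close> and \<open>inner_Hess_rescale\<close>.\<close>

definition scaled_Hess :: "real \<Rightarrow> real \<Rightarrow> 'n state \<Rightarrow> 'n state \<Rightarrow> ('n::finite) state" where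
  "scaled_Hess I e \<phi> C = (\<chi> j. if j \<in> sites
     then of_real (2 * (cmod (\<phi> $ j))^4 * Re (C $ j) + e * Re (coupling e \<phi> C j)) + \<i> * of_real (Im (coupling e \<phi> C j))
     else (2 * \<phi> $ j * cnj (\<phi> $ j) - of_real I) * C $ j + (\<phi> $ j)\<^sup>2 * cnj (C $ j) + of_real e * lap (rescale e \<phi> C) $ j)"

lemma linear_rescale: "linear (rescale e \<phi>)"
  by (rule linearI) (auto simp: rescale_def vec_eq_iff algebra_simps scaleR_conv_of_real[of _ "z::complex" for z])

lemma linear_scaled_Hess: "linear (scaled_Hess I e \<phi>)"
proof (rule linearI)
  note l = linear_add[OF linear_rescale] linear_scale[OF linear_rescale] linear_add[OF lap_linear] linear_scale[OF lap_linear]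
  have c: "coupling e \<phi> (x + y) j = coupling e \<phi> x j + coupling e \<phi> y j" for x y j
    by (simp add: coupling_def l algebra_simps)
  have s: "coupling e \<phi> (r *\<^sub>R x) j = of_real r * coupling e \<phi> x j" for r x j
    unfolding coupling_def l by (simp add: scaleR_conv_of_real[of _ "z::complex" for z] algebra_simps)
  show "scaled_Hess I e \<phi> (x + y) = scaled_Hess I e \<phi> x + scaled_Hess I e \<phi> y" for x y
    by (auto simp: scaled_Hess_def vec_eq_iff l c algebra_simps)
  show "scaled_Hess I e \<phi> (r *\<^sub>R x) = r *\<^sub>R scaled_Hess I e \<phi> x" for r x
    by (auto simp: scaled_Hess_def vec_eq_iff l s scaleR_conv_of_real[of _ "z::complex" for z] algebra_simps)
qed

lemma continuous_on_if_const:
  "continuous_on A f \<Longrightarrow> continuous_on A g \<Longrightarrow> continuous_on A (\<lambda>x. if P then f x else g x)"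
  by (cases P) simp_all

lemma continuous_on_rescale [continuous_intros]:
  assumes "continuous_on A e" "continuous_on A \<phi>" "continuous_on A C"
  shows "continuous_on A (\<lambda>x. rescale (e x) (\<phi> x) (C x))"
  unfolding rescale_def by (intro continuous_on_vec_lambda continuous_on_if_const continuous_intros assms)

lemma continuous_on_coupling [continuous_intros]:
  assumes "continuous_on A e" "continuous_on A \<phi>" "continuous_on A C"
  shows "continuous_on A (\<lambda>x. coupling (e x) (\<phi> x) (C x) j)"
  unfolding coupling_def by (intro continuous_intros assms)

lemma continuous_on_scaled_Hess [continuous_intros]:
  assumes "continuous_on A e" "continuous_on A \<phi>" "continuous_on A C"
  shows "continuous_on A (\<lambda>x. scaled_Hess I (e x) (\<phi> x) (C x))"
  unfolding scaled_Hess_def by (intro continuous_on_vec_lambda continuous_on_if_const continuous_intros assms)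

lemma rot_field_zero_iff:
  "rot_field I \<epsilon> \<phi> = 0 \<longleftrightarrow> (\<forall>j. (\<phi> $ j * cnj (\<phi> $ j) - of_real I) * \<phi> $ j + of_real \<epsilon> * lap \<phi> $ j = 0)"
  by (simp add: rot_field_def vec_eq_iff)

lemma Hess_rescale_site:
  assumes eq: "rot_field I (e\<^sup>2) \<phi> = 0" and j: "j \<in> sites"
  shows "cnj (\<phi> $ j) * Hess I (e\<^sup>2) \<phi> (rescale e \<phi> C) $ j
     = of_real (e * Re (scaled_Hess I e \<phi> C $ j)) + \<i> * of_real (e\<^sup>2 * Im (scaled_Hess I e \<phi> C $ j))"
proof -
  define p where "p = \<phi> $ j"
  define c where "c = of_real (e * Re (C $ j)) + \<i> * complex_of_real (Im (C $ j))"
  define z where "z = coupling e \<phi> C j"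
  have pp: "p * cnj p = of_real ((cmod p)\<^sup>2)" by (rule complex_norm_square[symmetric])
  have E: "cnj p * ((p * cnj p - of_real I) * p + of_real (e\<^sup>2) * lap \<phi> $ j) = 0"
    using eq by (simp add: rot_field_zero_iff p_def)
  have v: "rescale e \<phi> C $ j = p * c" using j by (simp add: rescale_def p_def c_def)
  have cc: "c + cnj c = of_real (2 * (e * Re (C $ j)))" unfolding complex_add_cnj by (simp add: c_def)
  have "cnj p * Hess I (e\<^sup>2) \<phi> (rescale e \<phi> C) $ j
     = (2 * (p * cnj p) - of_real I) * (p * cnj p) * c + (p * cnj p) * (p * cnj p) * cnj c
       + of_real (e\<^sup>2) * (cnj p * lap (rescale e \<phi> C) $ j)"
    unfolding Hess_def vec_lambda_beta v p_def[symmetric] by (simp add: algebra_simps power2_eq_square)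
  also have "\<dots> = (p * cnj p)\<^sup>2 * (c + cnj c) + of_real (e\<^sup>2) * z
      + cnj p * ((p * cnj p - of_real I) * p + of_real (e\<^sup>2) * lap \<phi> $ j) * c"
    unfolding z_def coupling_def p_def[symmetric] c_def[symmetric] by (simp add: algebra_simps power2_eq_square)
  also have "\<dots> = (p * cnj p)\<^sup>2 * (c + cnj c) + of_real (e\<^sup>2) * z" unfolding E by simp
  also have "\<dots> = of_real ((cmod p)^4 * (2 * (e * Re (C $ j)))) + of_real (e\<^sup>2) * z"
    unfolding pp cc by (simp flip: power_mult)
  also have "z = of_real (Re z) + \<i> * of_real (Im z)" by (simp add: complex_eq)
  finally show ?thesis
    using j by (simp add: scaled_Hess_def p_def[symmetric] z_def[symmetric] algebra_simps power2_eq_square)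
qed

lemma Hess_rescale_off:
  assumes j: "j \<notin> sites"
  shows "Hess I (e\<^sup>2) \<phi> (rescale e \<phi> C) $ j = of_real e * scaled_Hess I e \<phi> C $ j"
  using j by (simp add: Hess_def scaled_Hess_def rescale_def algebra_simps power2_eq_square)

text \<open>The value at time \<open>0\<close> of the unperturbed orbit with action \<open>I\<close>, relative signs \<open>\<sigma>\<close> and global phase \<open>u\<close>.\<close>

definition config :: "real \<Rightarrow> complex \<Rightarrow> real ^ 'j \<Rightarrow> complex ^ 'j::finite" where
  "config I u \<sigma> = (\<chi> j. of_real (sqrt I * \<sigma> $ j) * u)"

lemma lap_of_real: "lap (\<chi> k. of_real (x $ k) * c) $ j = of_real (lap x $ j) * (c :: complex)"
  by (simp add: lap_def scaleR_conv_of_real algebra_simps)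

lemma config_site:
  assumes "I > 0" "cmod u = 1" "\<sigma> $ j * \<sigma> $ j = 1"
  shows "cmod (config I u \<sigma> $ j) = sqrt I"
proof -
  have "\<bar>\<sigma> $ j\<bar> * \<bar>\<sigma> $ j\<bar> = 1" using assms(3) by (simp flip: abs_mult)
  then have "\<bar>\<sigma> $ j\<bar> = 1" by (metis abs_ge_zero abs_mult_self_eq abs_square_eq_1 power2_eq_square abs_abs)
  then show ?thesis using assms by (simp add: config_def norm_mult abs_mult)
qed

text \<open>In the limit amplitudes, phases and empty sites decouple: kinetic energy, the potential energy of the bonds, and a
negative definite part.\<close>

lemma scaled_Hess_0:
  fixes \<sigma> :: "real ^ ('n::finite bit1)"
  assumes I: "I > 0" and u: "cmod u = 1"
    and \<sigma>: "sign_pattern \<sigma>"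
  shows "scaled_Hess I 0 (config I u \<sigma>) C $ j = (if j \<in> sites
     then of_real (2 * I\<^sup>2 * Re (C $ j)) + \<i> * of_real (I * bond_lap \<sigma> (\<chi> k. Im (C $ k)) j)
     else - of_real I * C $ j)"
proof (cases "j \<in> sites")
  case True
  note on = sign_pattern_on[OF \<sigma>] and off = sign_pattern_off[OF \<sigma>]
  let ?b = "\<chi> k. Im (C $ k)"
  have uu: "u * cnj u = 1" using u complex_norm_square[of u] by simp
  have sI: "complex_of_real (sqrt I) * of_real (sqrt I) = of_real I" using I by (simp flip: of_real_mult)
  have s: "rescale 0 (config I u \<sigma>) C = (\<chi> k. of_real ((\<chi> k. \<sigma> $ k * ?b $ k) $ k) * (of_real (sqrt I) * u * \<i>))"
    using off by (simp add: rescale_def config_def vec_eq_iff algebra_simps)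
  have f: "config I u \<sigma> = (\<chi> k. of_real (\<sigma> $ k) * (of_real (sqrt I) * u))"
    by (simp add: config_def vec_eq_iff algebra_simps)
  have nrm: "(cmod (config I u \<sigma> $ j))^4 = I\<^sup>2"
  proof -
    have "cmod (config I u \<sigma> $ j) = sqrt I" by (rule config_site[OF I u on[OF True]])
    moreover have "(sqrt I)^4 = ((sqrt I)\<^sup>2)\<^sup>2" by (simp flip: power_mult)
    ultimately show ?thesis using I by simp
  qed
  have "coupling 0 (config I u \<sigma>) C j = (of_real (sqrt I) * of_real (sqrt I)) * (u * cnj u) *
      (\<i> * of_real (\<sigma> $ j * lap (\<chi> k. \<sigma> $ k * ?b $ k) $ j) - \<i> * of_real (\<sigma> $ j * lap \<sigma> $ j * ?b $ j))"
    unfolding coupling_def s lap_of_real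
    unfolding f lap_of_real by (simp add: algebra_simps)
  also have "\<dots> = \<i> * of_real (I * bond_lap \<sigma> ?b j)"
    unfolding uu sI bond_lap_def by (simp add: algebra_simps)
  finally show ?thesis using True by (simp add: scaled_Hess_def nrm)
next
  case False
  then show ?thesis using sign_pattern_off[OF \<sigma> False] by (simp add: scaled_Hess_def config_def)
qed

text \<open>An eigenvector for the eigenvalue \<open>e s\<close> in rescaled variables. The weights \<open>|\<phi>\<^sub>j|\<^sup>2\<close> and \<open>e\<close> on the right are those of the
rescaled symplectic form.\<close>

definition growing_mode :: "real \<Rightarrow> real \<Rightarrow> 'n state \<Rightarrow> real \<Rightarrow> ('n::finite) state \<Rightarrow> bool" where
  "growing_mode I e \<phi> s C \<longleftrightarrow> s > 0 \<and> (\<exists>j\<in>sites. Im (C $ j) \<noteq> 0) \<and>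
     (\<forall>j. - \<i> * scaled_Hess I e \<phi> C $ j = of_real s * (if j \<in> sites then \<phi> $ j * cnj (\<phi> $ j) else of_real e) * C $ j)"

text \<open>The operator is symmetric, so the last conjunct says that the eigenvalue \<open>- \<nu>\<close> is simple.\<close>

definition simple_negative :: "real ^ ('n::finite bit1) \<Rightarrow> real \<Rightarrow> real ^ ('n bit1) \<Rightarrow> bool" where
  "simple_negative \<sigma> \<nu> b0 \<longleftrightarrow> \<nu> > 0 \<and> (\<Sum>j\<in>sites. (b0 $ j)\<^sup>2) > 0 \<and> (\<forall>j\<in>sites. bond_lap \<sigma> b0 j = - \<nu> * b0 $ j) \<and>
    (\<forall>b. (\<forall>j\<in>sites. bond_lap \<sigma> b j = - \<nu> * b $ j) \<longrightarrow> (\<Sum>j\<in>sites. b0 $ j * b $ j) = 0 \<longrightarrow> (\<forall>j\<in>sites. b $ j = 0))"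

section \<open>Unstable directions\<close>

text \<open>Eigenvalue and eigenvector are found together as a zero of the eigenvalue equation supplemented by a
normalisation. At \<open>e = 0\<close> the equations \<open>- \<nu> b0 = s A\<close> and \<open>- 2 I A = s b0\<close> are solved by \<open>s\<^sup>2 = 2 I \<nu>\<close>. The derivative there is
injective precisely because \<open>- \<nu>\<close> is a simple eigenvalue: pairing the linearised equation with \<open>b0\<close> kills the
variation of \<open>s\<close> by symmetry of the bond Laplacian.\<close>

lemma unstable_direction:
  fixes \<sigma> b0 :: "real ^ ('n::finite bit1)"
  assumes I: "I > 0" and u: "cmod u = 1"
    and \<sigma>: "sign_pattern \<sigma>"
    and b0: "simple_negative \<sigma> \<nu> b0"
    and sym: "\<And>b. (\<Sum>j\<in>sites. b0 $ j * bond_lap \<sigma> b j) = (\<Sum>j\<in>sites. bond_lap \<sigma> b0 j * b $ j)"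
  shows "\<forall>\<^sub>F (e, \<phi>) in nhds (0, config I u \<sigma>). \<exists>s C. growing_mode I e \<phi> s C"
proof -
  note b0 = b0[unfolded simple_negative_def]
  note nu = b0[THEN conjunct1] and nz = b0[THEN conjunct2, THEN conjunct1]
    and eig = b0[THEN conjunct2, THEN conjunct2, THEN conjunct1, rule_format]
    and simple = b0[THEN conjunct2, THEN conjunct2, THEN conjunct2, THEN spec, THEN mp, THEN mp]
  define m :: "real \<Rightarrow> 'n state \<Rightarrow> 'n bit1 \<Rightarrow> complex"
    where "m e \<phi> j = (if j \<in> sites then \<phi> $ j * cnj (\<phi> $ j) else of_real e)" for e \<phi> j
  \<comment> \<open>The normalisation fixes the phase part of the eigenvector along \<open>b0\<close> and excludes the zero vector.\<close>
  define nb where "nb = (\<Sum>j\<in>sites. (b0 $ j)\<^sup>2)"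
  define G :: "(real \<times> 'n state) \<times> (real \<times> 'n state) \<Rightarrow> real \<times> 'n state"
    where "G = (\<lambda>((e, \<phi>), (s, C)). ((\<Sum>j\<in>sites. b0 $ j * Im (C $ j)) - nb,
       \<chi> j. - \<i> * scaled_Hess I e \<phi> C $ j - of_real s * m e \<phi> j * C $ j))"
  define s0 where "s0 = sqrt (2 * I * \<nu>)"
  have s0: "s0 > 0" "s0 * s0 = 2 * I * \<nu>" using I nu by (simp_all add: s0_def)
  define C0 :: "'n state" where "C0 = (\<chi> j. if j \<in> sites then of_real (- s0 * b0 $ j / (2 * I)) + \<i> * of_real (b0 $ j) else 0)"
  let ?\<phi> = "config I u \<sigma>"
  note K0 = scaled_Hess_0[OF I u \<sigma>]
  note on = sign_pattern_on[OF \<sigma>] and off = sign_pattern_off[OF \<sigma>]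
  have m0: "m 0 ?\<phi> j = (if j \<in> sites then of_real I else 0)" for j
  proof -
    have "?\<phi> $ j * cnj (?\<phi> $ j) = of_real I" if "j \<in> sites"
      using complex_norm_square[of "?\<phi> $ j"] I unfolding config_site[OF I u on[OF that]] by simp
    then show ?thesis by (simp add: m_def)
  qed
  have cont: "continuous_on UNIV G"
    unfolding G_def case_prod_unfold m_def
    by (intro continuous_on_Pair continuous_on_vec_lambda continuous_on_if_const continuous_intros)
  have Lamcong: "bond_lap \<sigma> x j = bond_lap \<sigma> y j" if "\<And>k. k \<in> sites \<Longrightarrow> x $ k = y $ k" "j \<in> sites" for x y j
  proof -
    have "(\<chi> k. \<sigma> $ k * x $ k) = (\<chi> k. \<sigma> $ k * y $ k)" using that off by (auto simp: vec_eq_iff)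
    then show ?thesis using that by (simp add: bond_lap_def)
  qed
  have zero: "G ((0, ?\<phi>), (s0, C0)) = 0"
  proof -
    have "(\<Sum>j\<in>sites. b0 $ j * Im (C0 $ j)) = nb"
      unfolding nb_def by (rule sum.cong) (simp_all add: C0_def power2_eq_square)
    moreover have "- \<i> * scaled_Hess I 0 ?\<phi> C0 $ j - of_real s0 * m 0 ?\<phi> j * C0 $ j = 0" for j
    proof (cases "j \<in> sites")
      case True
      have "bond_lap \<sigma> (\<chi> k. Im (C0 $ k)) j = - \<nu> * b0 $ j"
        unfolding eig[OF True, symmetric] by (rule Lamcong) (use True in \<open>simp_all add: C0_def\<close>)
      moreover have "s0 * (s0 * b0 $ j) = 2 * I * (\<nu> * b0 $ j)" using s0(2) by (metis mult.assoc)
      ultimately show ?thesis using True I unfolding K0 m0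
        by (simp add: C0_def complex_eq_iff field_simps power2_eq_square)
    next
      case False
      then show ?thesis unfolding K0 m0 by (simp add: C0_def)
    qed
    ultimately show ?thesis by (simp add: G_def vec_eq_iff zero_prod_def)
  qed
  define D :: "real \<times> 'n state \<Rightarrow> real \<times> 'n state" where
    "D h = ((\<Sum>j\<in>sites. b0 $ j * Im (snd h $ j)),
       \<chi> j. - \<i> * scaled_Hess I 0 ?\<phi> (snd h) $ j - (of_real s0 * m 0 ?\<phi> j * snd h $ j + of_real (fst h) * m 0 ?\<phi> j * C0 $ j))" for h
  have der: "((\<lambda>x. G ((0, ?\<phi>), x)) has_derivative D) (at (s0, C0))"
  proof -
    have bl: "bounded_linear (scaled_Hess I 0 ?\<phi>)"
      using linear_scaled_Hess linear_conv_bounded_linear by blast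
    have sndd: "(snd has_derivative snd) (at (s0, C0))"
      by (rule bounded_linear.has_derivative[OF bounded_linear_snd has_derivative_ident])
    have fstd: "((\<lambda>x. complex_of_real (fst x)) has_derivative (\<lambda>h. of_real (fst h))) (at (s0, C0))"
      by (rule bounded_linear.has_derivative[OF bounded_linear_of_real
            bounded_linear.has_derivative[OF bounded_linear_fst has_derivative_ident]])
    have nth: "((\<lambda>x. snd x $ j) has_derivative (\<lambda>h. snd h $ j)) (at (s0, C0))" for j
      by (rule bounded_linear.has_derivative[OF bounded_linear_vec_nth sndd])
    have imd: "((\<lambda>x. Im (snd x $ j)) has_derivative (\<lambda>h. Im (snd h $ j))) (at (s0, C0))" for j
      by (rule bounded_linear.has_derivative[OF bounded_linear_Im nth])
    have kd: "((\<lambda>x. scaled_Hess I 0 ?\<phi> (snd x) $ j) has_derivative (\<lambda>h. scaled_Hess I 0 ?\<phi> (snd h) $ j)) (at (s0, C0))" for j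
      by (rule bounded_linear.has_derivative[OF bounded_linear_vec_nth bounded_linear.has_derivative[OF bl sndd]])
    have "((\<lambda>x. - \<i> * scaled_Hess I 0 ?\<phi> (snd x) $ j - of_real (fst x) * m 0 ?\<phi> j * snd x $ j) has_derivative
       (\<lambda>h. - \<i> * scaled_Hess I 0 ?\<phi> (snd h) $ j - (of_real s0 * m 0 ?\<phi> j * snd h $ j + of_real (fst h) * m 0 ?\<phi> j * C0 $ j)))
       (at (s0, C0))" for j
      by (rule derivative_eq_intros kd nth fstd refl)+ simp
    then have 2: "((\<lambda>x. \<chi> j. - \<i> * scaled_Hess I 0 ?\<phi> (snd x) $ j - of_real (fst x) * m 0 ?\<phi> j * snd x $ j) has_derivative
       (\<lambda>h. \<chi> j. - \<i> * scaled_Hess I 0 ?\<phi> (snd h) $ j - (of_real s0 * m 0 ?\<phi> j * snd h $ j + of_real (fst h) * m 0 ?\<phi> j * C0 $ j)))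
       (at (s0, C0))"
      by (subst has_derivative_vec_iff) simp
    have 1: "((\<lambda>x. (\<Sum>j\<in>sites. b0 $ j * Im (snd x $ j)) - nb) has_derivative
       (\<lambda>h. \<Sum>j\<in>sites. b0 $ j * Im (snd h $ j))) (at (s0, C0))"
      by (rule derivative_eq_intros imd refl)+ simp
    show ?thesis using has_derivative_Pair[OF 1 2] by (simp add: G_def D_def[abs_def] case_prod_unfold)
  qed
  have inj: "h = 0" if D0: "D h = 0" for h
  proof -
    obtain t C where h: "h = (t, C)" by (cases h)
    define b :: "real ^ ('n bit1)" where "b = (\<chi> k. Im (C $ k))"
    have orth: "(\<Sum>j\<in>sites. b0 $ j * b $ j) = 0" using D0 by (simp add: D_def h b_def zero_prod_def)
    have row: "- \<i> * scaled_Hess I 0 ?\<phi> C $ j = of_real s0 * m 0 ?\<phi> j * C $ j + of_real t * m 0 ?\<phi> j * C0 $ j" for j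
      using D0 by (simp add: D_def h vec_eq_iff zero_prod_def)
    have offC: "C $ j = 0" if "j \<notin> sites" for j
      using row[of j] that I unfolding K0 m0 by simp
    have onr: "bond_lap \<sigma> b j = s0 * Re (C $ j) - t * s0 * b0 $ j / (2 * I)"
      "- 2 * I * Re (C $ j) = s0 * b $ j + t * b0 $ j" if "j \<in> sites" for j
    proof -
      have 1: "I * bond_lap \<sigma> b j = I * (s0 * Re (C $ j) - t * s0 * b0 $ j / (2 * I))"
        and 2: "I * (- 2 * I * Re (C $ j)) = I * (s0 * b $ j + t * b0 $ j)"
        using row[of j] that I unfolding K0 m0 b_def
        by (auto simp: C0_def complex_eq_iff algebra_simps power2_eq_square)
      have "x = y" if "I * x = I * y" for x y using that I by simp
      from this[OF 1] this[OF 2] show "bond_lap \<sigma> b j = s0 * Re (C $ j) - t * s0 * b0 $ j / (2 * I)"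
        "- 2 * I * Re (C $ j) = s0 * b $ j + t * b0 $ j" .
    qed
    \<comment> \<open>Eliminating the amplitudes leaves an equation for the phases alone.\<close>
    have L: "bond_lap \<sigma> b j = - \<nu> * b $ j - t * (s0 / I) * b0 $ j" if "j \<in> sites" for j
    proof -
      have "2 * I * bond_lap \<sigma> b j = s0 * (2 * I * Re (C $ j)) - t * s0 * b0 $ j"
        unfolding onr(1)[OF that] using I by (simp add: field_simps)
      also have "2 * I * Re (C $ j) = - s0 * b $ j - t * b0 $ j" using onr(2)[OF that] by linarith
      also have "s0 * (- s0 * b $ j - t * b0 $ j) - t * s0 * b0 $ j = - (s0 * s0) * b $ j - 2 * t * s0 * b0 $ j"
        by (simp add: algebra_simps)
      also have "\<dots> = 2 * I * (- \<nu> * b $ j - t * (s0 / I) * b0 $ j)"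
        unfolding s0(2) using I by (simp add: field_simps)
      finally show ?thesis using I by simp
    qed
    have "(\<Sum>j\<in>sites. b0 $ j * bond_lap \<sigma> b j) = (\<Sum>j\<in>sites. - \<nu> * (b0 $ j * b $ j) - t * (s0 / I) * (b0 $ j)\<^sup>2)"
      by (rule sum.cong) (simp_all add: L power2_eq_square algebra_simps)
    also have "\<dots> = - \<nu> * (\<Sum>j\<in>sites. b0 $ j * b $ j) - t * (s0 / I) * nb"
      by (simp add: sum_subtractf sum_distrib_left nb_def)
    also have "(\<Sum>j\<in>sites. b0 $ j * bond_lap \<sigma> b j) = (\<Sum>j\<in>sites. - \<nu> * (b0 $ j * b $ j))"
      unfolding sym by (rule sum.cong) (simp_all add: eig)
    also have "\<dots> = - \<nu> * (\<Sum>j\<in>sites. b0 $ j * b $ j)" by (simp add: sum_distrib_left)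
    finally have "t * (s0 / I) * nb = 0" by simp
    then have t: "t = 0" using s0 I nz unfolding nb_def by simp
    have "\<forall>j\<in>sites. bond_lap \<sigma> b j = - \<nu> * b $ j" by (simp add: L t)
    then have bz: "b $ j = 0" if "j \<in> sites" for j
      using simple[OF _ orth] that by blast
    have "C $ j = 0" for j
    proof (cases "j \<in> sites")
      case True
      then show ?thesis using onr(2)[OF True] bz[OF True] t I by (simp add: complex_eq_iff b_def)
    qed (rule offC)
    then show ?thesis by (simp add: h t vec_eq_iff zero_prod_def)
  qed
  \<comment> \<open>Within distance \<open>s0 / 2\<close> the eigenvalue is still positive.\<close>
  have "s0 / 2 > 0" using s0 by simp
  from zero_persistence[OF cont zero der inj this]
  have "\<forall>\<^sub>F p in nhds (0, ?\<phi>). \<exists>x\<in>cball (s0, C0) (s0 / 2). G (p, x) = 0" by blast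
  then show ?thesis
  proof eventually_elim
    case (elim p)
    then obtain s C where sC: "(s, C) \<in> cball (s0, C0) (s0 / 2)" "G (p, (s, C)) = 0" by auto
    obtain e \<phi> where p: "p = (e, \<phi>)" by (cases p)
    have "dist s0 s \<le> dist (s0, C0) (s, C)" using dist_fst_le[of "(s0, C0)" "(s, C)"] by simp
    then have "s > 0" using sC(1) s0 by (simp add: dist_real_def)
    moreover have "\<exists>j\<in>sites. Im (C $ j) \<noteq> 0"
    proof (rule ccontr)
      assume "\<not> ?thesis"
      then have "(\<Sum>j\<in>sites. b0 $ j * Im (C $ j)) = 0" by simp
      then show False using sC(2) nz by (simp add: G_def p zero_prod_def nb_def)
    qed
    moreover have "\<forall>j. - \<i> * scaled_Hess I e \<phi> C $ j = of_real s * m e \<phi> j * C $ j"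
      using sC(2) by (simp add: G_def p zero_prod_def vec_eq_iff)
    ultimately show ?case unfolding p prod.case growing_mode_def m_def by blast
  qed
qed

lemma unstable_eigenvector:
  assumes e: "e > 0" and eq: "rot_field I (e\<^sup>2) \<phi> = 0" and nz: "\<And>j. j \<in> sites \<Longrightarrow> \<phi> $ j \<noteq> 0"
    and mode: "growing_mode I e \<phi> s C"
  shows "Lin I (e\<^sup>2) \<phi> (rescale e \<phi> C) = (e * s) *\<^sub>R rescale e \<phi> C" "rescale e \<phi> C \<noteq> 0"
proof -
  have row: "- \<i> * scaled_Hess I e \<phi> C $ j = of_real s * (if j \<in> sites then \<phi> $ j * cnj (\<phi> $ j) else of_real e) * C $ j" for j
    using mode unfolding growing_mode_def by blast
  have "Lin I (e\<^sup>2) \<phi> (rescale e \<phi> C) $ j = of_real (e * s) * rescale e \<phi> C $ j" for j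
  proof (cases "j \<in> sites")
    case True
    define r where "r = (cmod (\<phi> $ j))\<^sup>2"
    have rr: "\<phi> $ j * cnj (\<phi> $ j) = of_real r" unfolding r_def by (rule complex_norm_square[symmetric])
    let ?K = "scaled_Hess I e \<phi> C $ j"
    have K: "Im ?K = s * r * Re (C $ j)" "Re ?K = - s * r * Im (C $ j)"
      using row[of j] True unfolding rr by (auto simp: complex_eq_iff)
    have "cnj (\<phi> $ j) * Lin I (e\<^sup>2) \<phi> (rescale e \<phi> C) $ j = - \<i> * (cnj (\<phi> $ j) * Hess I (e\<^sup>2) \<phi> (rescale e \<phi> C) $ j)"
      by (simp add: Lin_def)
    also have "\<dots> = of_real (e * s) * (of_real r * (of_real (e * Re (C $ j)) + \<i> * of_real (Im (C $ j))))"
      unfolding Hess_rescale_site[OF eq True] K by (simp add: complex_eq_iff power2_eq_square)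
    also have "\<dots> = cnj (\<phi> $ j) * (of_real (e * s) * rescale e \<phi> C $ j)"
      using True unfolding rr[symmetric] by (simp add: rescale_def)
    finally show ?thesis using nz[OF True] by simp
  next
    case False
    have "Lin I (e\<^sup>2) \<phi> (rescale e \<phi> C) $ j = of_real e * (- \<i> * scaled_Hess I e \<phi> C $ j)"
      by (simp add: Lin_def Hess_rescale_off[OF False])
    also have "\<dots> = of_real (e * s) * rescale e \<phi> C $ j"
      unfolding row using False by (simp add: rescale_def)
    finally show ?thesis .
  qed
  then show "Lin I (e\<^sup>2) \<phi> (rescale e \<phi> C) = (e * s) *\<^sub>R rescale e \<phi> C"
    by (simp add: vec_eq_iff scaleR_conv_of_real[of _ "z::complex" for z])
  obtain j where j: "j \<in> sites" "Im (C $ j) \<noteq> 0" using mode unfolding growing_mode_def by blast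
  have "of_real (e * Re (C $ j)) + \<i> * complex_of_real (Im (C $ j)) \<noteq> 0"
    using j(2) by (simp add: complex_eq_iff)
  then have "rescale e \<phi> C $ j \<noteq> 0" using j(1) nz[OF j(1)] by (simp add: rescale_def)
  then show "rescale e \<phi> C \<noteq> 0" by (metis zero_index)
qed

text \<open>The eigenvalue equation of the bond Laplacian for eigenvalue \<open>- \<nu>\<close>, with \<open>p\<close>, \<open>q\<close>, \<open>r\<close> the weights of the bonds 01, 12, 23. As the
signs square to one, the bonds 02 and 13 have weights \<open>p q\<close> and \<open>q r\<close>.\<close>

definition eig4 :: "real \<Rightarrow> real \<Rightarrow> real \<Rightarrow> real \<Rightarrow> real \<Rightarrow> real \<Rightarrow> real \<Rightarrow> real \<Rightarrow> bool" where
  "eig4 p q r \<nu> y0 y1 y2 y3 \<longleftrightarrow>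
     p * (y0 - y1) + p * q * (y0 - y2) = - \<nu> * y0 \<and>
     p * (y1 - y0) + q * (y1 - y2) + q * r * (y1 - y3) = - \<nu> * y1 \<and>
     p * q * (y2 - y0) + q * (y2 - y1) + r * (y2 - y3) = - \<nu> * y2 \<and>
     q * r * (y3 - y1) + r * (y3 - y2) = - \<nu> * y3"

definition simple_eig4 :: "real \<Rightarrow> real \<Rightarrow> real \<Rightarrow> real \<Rightarrow> real \<Rightarrow> real \<Rightarrow> real \<Rightarrow> real \<Rightarrow> bool" where
  "simple_eig4 p q r \<nu> x0 x1 x2 x3 \<longleftrightarrow> \<nu> > 0 \<and> x0 \<noteq> 0 \<and> eig4 p q r \<nu> x0 x1 x2 x3 \<and>
    (\<forall>y0 y1 y2 y3. eig4 p q r \<nu> y0 y1 y2 y3 \<longrightarrow> x0 * y0 + x1 * y1 + x2 * y2 + x3 * y3 = 0 \<longrightarrow>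
      y0 = 0 \<and> y1 = 0 \<and> y2 = 0 \<and> y3 = 0)"

lemma eig4_reverse: "eig4 p q r \<nu> y0 y1 y2 y3 \<longleftrightarrow> eig4 r q p \<nu> y3 y2 y1 y0"
  by (auto simp: eig4_def mult_ac add_ac)

text \<open>Reflection of the four sites halves the number of cases.\<close>

lemma simple_eig4_reverse:
  assumes "simple_eig4 p q r \<nu> x0 x1 x2 x3" "x3 \<noteq> 0"
  shows "simple_eig4 r q p \<nu> x3 x2 x1 x0"
  unfolding simple_eig4_def
proof (intro conjI allI impI)
  show "\<nu> > 0" "eig4 r q p \<nu> x3 x2 x1 x0"
    using assms eig4_reverse unfolding simple_eig4_def by auto
  fix y0 y1 y2 y3 assume *: "eig4 r q p \<nu> y0 y1 y2 y3" "x3 * y0 + x2 * y1 + x1 * y2 + x0 * y3 = 0"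
  have "eig4 p q r \<nu> y3 y2 y1 y0" using *(1) eig4_reverse by blast
  moreover have "x0 * y3 + x1 * y2 + x2 * y1 + x3 * y0 = 0" using *(2) by linarith
  ultimately have "y3 = 0 \<and> y2 = 0 \<and> y1 = 0 \<and> y0 = 0"
    using assms(1) unfolding simple_eig4_def by blast
  then show "y0 = 0" "y1 = 0" "y2 = 0" "y3 = 0" by auto
qed (rule assms(2))

text \<open>Modulo constants and the antisymmetric vector \<open>(0, 1, -1, 0)\<close> the Laplacian has the matrix \<open>((3, 1), (-1, -3))\<close> in the
outer components, with eigenvalues \<open>\<plusminus> 2 \<surd>2\<close>.\<close>

lemma simple_eig4_one_outer:
  defines "n \<equiv> 2 * sqrt 2"
  shows "simple_eig4 1 1 (-1) n 1 (1 + n / 2) (1 + n / 2) (- 3 - n)"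
proof -
  have nn: "n * n = 8" and n2: "n > 2" by (simp_all add: n_def real_less_rsqrt)
  have "y0 = 0 \<and> y1 = 0 \<and> y2 = 0 \<and> y3 = 0"
    if e: "eig4 1 1 (-1) n y0 y1 y2 y3" and o: "1 * y0 + (1 + n / 2) * y1 + (1 + n / 2) * y2 + (- 3 - n) * y3 = 0"
    for y0 y1 y2 y3
  proof -
    have E: "y0 - y1 + (y0 - y2) = - n * y0" "(y1 - y0) + (y1 - y2) - (y1 - y3) = - n * y1"
      "(y2 - y0) + (y2 - y1) - (y2 - y3) = - n * y2" "- (y3 - y1) - (y3 - y2) = - n * y3"
      using e unfolding eig4_def by simp_all
    have "(n + 2) * (y1 - y2) = 0" using E(2,3) by (simp add: algebra_simps)
    then have y2: "y2 = y1" using n2 by simp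
    have y0: "(n + 2) * y0 = 2 * y1" using E(1) y2 by (simp add: algebra_simps)
    have y3: "(n - 2) * y3 = - 2 * y1" using E(4) y2 by (simp add: algebra_simps)
    have "y0 + (2 + n) * y1 - (3 + n) * y3 = 0" using o y2 by (simp add: algebra_simps)
    then have "(n - 2) * ((n + 2) * y0) + (n - 2) * (n + 2) * (2 + n) * y1 - (3 + n) * (n + 2) * ((n - 2) * y3) = 0"
      by algebra
    then have "((n - 2) * 2 + (n - 2) * (n + 2) * (2 + n) + 2 * (3 + n) * (n + 2)) * y1 = 0"
      unfolding y0 y3 by (simp add: algebra_simps)
    moreover have "(n - 2) * 2 + (n - 2) * (n + 2) * (2 + n) + 2 * (3 + n) * (n + 2) > 0"
      using n2 by (intro add_pos_pos mult_pos_pos) auto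
    ultimately have "y1 = 0" by simp
    then show ?thesis using y0 y3 y2 n2 by simp
  qed
  moreover have "eig4 1 1 (-1) n 1 (1 + n / 2) (1 + n / 2) (- 3 - n)"
    using nn unfolding eig4_def by (simp add: algebra_simps)
  ultimately show ?thesis using n2 unfolding simple_eig4_def by auto
qed

lemma simple_eig4_both_outer: "simple_eig4 (-1) 1 (-1) 4 1 (-1) (-1) 1"
  unfolding simple_eig4_def eig4_def by auto

text \<open>The antisymmetric vectors \<open>(a, b, - b, - a)\<close> are invariant; there the eigenvalues are the roots of
\<open>\<kappa>\<^sup>2 + 2 \<kappa> = 4\<close>, of which \<open>- 1 - \<surd>5\<close> is taken.\<close>

lemma simple_eig4_middle_equal:
  assumes g: "g = 1 \<or> g = (-1::real)"
  defines "n \<equiv> 1 + sqrt 5"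
  shows "simple_eig4 g (-1) g n 2 (g * n) (- g * n) (- 2)"
proof -
  have nn: "n * n = 4 + 2 * n" and n0: "n > 0" by (simp_all add: n_def algebra_simps add_pos_nonneg)
  have gg: "g * g = 1" "g * (g * x) = x" for x using g by auto
  have "y0 = 0 \<and> y1 = 0 \<and> y2 = 0 \<and> y3 = 0"
    if e: "eig4 g (-1) g n y0 y1 y2 y3" and o: "2 * y0 + (g * n) * y1 + (- g * n) * y2 + (- 2) * y3 = 0"
    for y0 y1 y2 y3
  proof -
    have E: "g * (y2 - y1) = - n * y0" "g * (y1 - y0) - (y1 - y2) - g * (y1 - y3) = - n * y1"
      "- g * (y2 - y0) - (y2 - y1) + g * (y2 - y3) = - n * y2" "g * (y1 - y2) = - n * y3"
      using e unfolding eig4_def by (simp_all add: algebra_simps)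
    have "n * (y0 + y3) = 0" using E(1,4) by (simp add: algebra_simps)
    then have y3: "y3 = - y0" using n0 by simp
    have "n * (y1 + y2) = 0" using E(2,3) by (simp add: algebra_simps)
    then have y2: "y2 = - y1" using n0 by simp
    have y0: "n * y0 = 2 * g * y1" using E(1) y2 by (simp add: algebra_simps)
    have "4 * (n * y0) + 2 * g * (n * n) * y1 = n * (2 * y0 + (g * n) * y1 + (- g * n) * y2 + (- 2) * y3)"
      unfolding y2 y3 by (simp add: algebra_simps)
    then have "g * ((8 + 2 * (n * n)) * y1) = 0" unfolding o y0 by (simp add: algebra_simps)
    moreover have "8 + 2 * (n * n) > 0" using n0 by (intro add_pos_pos mult_pos_pos) auto
    ultimately have "y1 = 0" using g by auto
    then show ?thesis using y0 y2 y3 n0 by simp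
  qed
  moreover have "eig4 g (-1) g n 2 (g * n) (- g * n) (- 2)"
    using nn unfolding eig4_def by (simp add: algebra_simps gg)
  ultimately show ?thesis using n0 unfolding simple_eig4_def by auto
qed

lemma simple_eig4_middle_opposite:
  assumes g: "g = 1 \<or> g = (-1::real)"
  shows "simple_eig4 g (-1) (- g) 4 1 (2 * g - 1) (- 2 * g - 1) 1"
  using g unfolding simple_eig4_def eig4_def by auto

lemma simple_eig4_exists:
  assumes "p = 1 \<or> p = -1" "q = 1 \<or> q = -1" "r = 1 \<or> r = (-1::real)" "\<not> (p = 1 \<and> q = 1 \<and> r = 1)"
  shows "\<exists>\<nu> x0 x1 x2 x3. simple_eig4 p q r \<nu> x0 x1 x2 x3"
proof (cases "q = 1")
  case True
  have "- 3 - 2 * sqrt 2 \<noteq> 0" using real_sqrt_ge_zero[of 2] by linarith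
  then have "simple_eig4 (-1) 1 1 (2 * sqrt 2) (- 3 - 2 * sqrt 2) (1 + sqrt 2) (1 + sqrt 2) 1"
    using simple_eig4_reverse[OF simple_eig4_one_outer] by simp
  then show ?thesis using True assms simple_eig4_one_outer simple_eig4_both_outer by blast
next
  case False
  then have q: "q = -1" using assms by simp
  show ?thesis
  proof (cases "r = p")
    case True
    then show ?thesis using simple_eig4_middle_equal[OF assms(1)] unfolding q by blast
  next
    case False
    then have "r = - p" using assms by auto
    then show ?thesis using simple_eig4_middle_opposite[OF assms(1)] unfolding q by blast
  qed
qed

lemma bond_lap_symmetric:
  fixes \<sigma> :: "real ^ ('n::finite bit1)"
  assumes n: "CARD('n) \<ge> 3" and \<sigma>: "sign_pattern \<sigma>"
  shows "(\<Sum>j\<in>sites. a $ j * bond_lap \<sigma> b j) = (\<Sum>j\<in>sites. bond_lap \<sigma> a j * b $ j)"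
  unfolding sum_sites[OF n] bond_lap_sites[OF n \<sigma>] by algebra

lemma bond_lap_simple_negative:
  fixes \<sigma> :: "real ^ ('n::finite bit1)"
  assumes n: "CARD('n) \<ge> 3"
    and \<sigma>: "sign_pattern \<sigma>"
    and ne: "\<not> (\<sigma> $ 0 * \<sigma> $ 1 = 1 \<and> \<sigma> $ 1 * \<sigma> $ 2 = 1 \<and> \<sigma> $ 2 * \<sigma> $ 3 = 1)"
  shows "\<exists>\<nu> b0. simple_negative \<sigma> \<nu> b0"
proof -
  have s: "\<sigma> $ 0 * \<sigma> $ 0 = 1" "\<sigma> $ 1 * \<sigma> $ 1 = 1" "\<sigma> $ 2 * \<sigma> $ 2 = 1" "\<sigma> $ 3 * \<sigma> $ 3 = 1"
    using sign_pattern_on[OF \<sigma>] by (simp_all add: sites_def)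
  define p q r where "p = \<sigma> $ 0 * \<sigma> $ 1" and "q = \<sigma> $ 1 * \<sigma> $ 2" and "r = \<sigma> $ 2 * \<sigma> $ 3"
  have "p * p = 1" "q * q = 1" "r * r = 1" using s unfolding p_def q_def r_def by algebra+
  then have pm: "p = 1 \<or> p = -1" "q = 1 \<or> q = -1" "r = 1 \<or> r = -1"
    by (simp_all add: square_eq_1_iff)
  have pq: "\<sigma> $ 0 * \<sigma> $ 2 = p * q" "\<sigma> $ 1 * \<sigma> $ 3 = q * r" using s unfolding p_def q_def r_def by algebra+
  have eig: "(\<forall>j\<in>sites. bond_lap \<sigma> b j = - \<nu> * b $ j) \<longleftrightarrow> eig4 p q r \<nu> (b $ 0) (b $ 1) (b $ 2) (b $ 3)" for \<nu> b
  proof -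
    have L: "bond_lap \<sigma> b 0 = p * (b $ 0 - b $ 1) + p * q * (b $ 0 - b $ 2)"
      "bond_lap \<sigma> b 1 = p * (b $ 1 - b $ 0) + q * (b $ 1 - b $ 2) + q * r * (b $ 1 - b $ 3)"
      "bond_lap \<sigma> b 2 = p * q * (b $ 2 - b $ 0) + q * (b $ 2 - b $ 1) + r * (b $ 2 - b $ 3)"
      "bond_lap \<sigma> b 3 = q * r * (b $ 3 - b $ 1) + r * (b $ 3 - b $ 2)"
      unfolding pq[symmetric] unfolding p_def q_def r_def by (rule bond_lap_sites[OF n \<sigma>])+
    show ?thesis unfolding sites_def eig4_def by (simp only: ball_simps L simp_thms)
  qed
  obtain \<nu> x0 x1 x2 x3 where x: "simple_eig4 p q r \<nu> x0 x1 x2 x3"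
    using simple_eig4_exists[OF pm] ne unfolding p_def q_def r_def by blast
  define b0 :: "real ^ ('n bit1)" where
    "b0 = (\<chi> j. if j = 0 then x0 else if j = 1 then x1 else if j = 2 then x2 else x3)"
  have b0: "b0 $ 0 = x0" "b0 $ 1 = x1" "b0 $ 2 = x2" "b0 $ 3 = x3"
    using sites_distinct(1-6)[OF n] by (auto simp: b0_def)
  have "simple_negative \<sigma> \<nu> b0"
    unfolding simple_negative_def
  proof (intro conjI allI impI)
    show "\<nu> > 0" "\<forall>j\<in>sites. bond_lap \<sigma> b0 j = - \<nu> * b0 $ j"
      using x unfolding eig b0 simple_eig4_def by auto
    have "x0 \<noteq> 0" using x by (simp add: simple_eig4_def)
    then have "x0\<^sup>2 > 0" by simp
    then have "x0\<^sup>2 + x1\<^sup>2 + x2\<^sup>2 + x3\<^sup>2 > 0" by (simp add: add_pos_nonneg)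
    then show "(\<Sum>j\<in>sites. (b0 $ j)\<^sup>2) > 0" unfolding sum_sites[OF n] b0 .
    fix b assume "\<forall>j\<in>sites. bond_lap \<sigma> b j = - \<nu> * b $ j" "(\<Sum>j\<in>sites. b0 $ j * b $ j) = 0"
    then show "\<forall>j\<in>sites. b $ j = 0"
      using x unfolding eig sum_sites[OF n] b0 simple_eig4_def by (simp add: sites_def)
  qed
  then show ?thesis by blast
qed

section \<open>Stability of the in-phase configuration\<close>

lemma inner_lap: "(\<Sum>j\<in>UNIV. lap x $ j \<bullet> y $ j)
   = (\<Sum>j\<in>UNIV. (x $ (j + 1) - x $ j) \<bullet> (y $ (j + 1) - y $ j)) + (\<Sum>j\<in>UNIV. (x $ (j + 2) - x $ j) \<bullet> (y $ (j + 2) - y $ j))"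
  for x y :: "('n::finite) state"
proof -
  have "lap x $ j = (2 *\<^sub>R x $ j - x $ (j + 1) - x $ (j - 1)) + (2 *\<^sub>R x $ j - x $ (j + 2) - x $ (j - 2))" for j
    by (simp add: lap_def scaleR_conv_of_real)
  then show ?thesis
    unfolding difference_by_parts sum.distrib[symmetric] inner_add_left[symmetric] by simp
qed

lemma Hess_symmetric: "x \<bullet> Hess I \<epsilon> \<phi> y = Hess I \<epsilon> \<phi> x \<bullet> y" for x y :: "('n::finite) state"
proof -
  have L: "(\<Sum>j\<in>UNIV. x $ j \<bullet> lap y $ j) = (\<Sum>j\<in>UNIV. lap x $ j \<bullet> y $ j)"
    unfolding inner_commute[of "x $ _"] inner_lap by (simp add: inner_commute)
  have 1: "x $ j \<bullet> Hess I \<epsilon> \<phi> y $ j - \<epsilon> * (x $ j \<bullet> lap y $ j) = Hess I \<epsilon> \<phi> x $ j \<bullet> y $ j - \<epsilon> * (lap x $ j \<bullet> y $ j)" for j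
    by (simp add: Hess_def inner_complex_def power2_eq_square algebra_simps)
  have "(\<Sum>j\<in>UNIV. x $ j \<bullet> Hess I \<epsilon> \<phi> y $ j) - \<epsilon> * (\<Sum>j\<in>UNIV. x $ j \<bullet> lap y $ j)
      = (\<Sum>j\<in>UNIV. Hess I \<epsilon> \<phi> x $ j \<bullet> y $ j) - \<epsilon> * (\<Sum>j\<in>UNIV. lap x $ j \<bullet> y $ j)"
    unfolding sum_distrib_left sum_subtractf[symmetric] by (rule sum.cong) (simp_all add: 1)
  then show ?thesis unfolding L by (simp add: inner_vec_def)
qed

lemma inner_rot: "x \<bullet> (\<i> *s x) = 0" "x \<bullet> (\<i> *s y) = - (y \<bullet> (\<i> *s x))" for x y :: "complex ^ 'j::finite"
  by (simp_all add: inner_vec_def inner_complex_def sum_negf[symmetric] algebra_simps)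

lemma Hess_Lin: "Hess I \<epsilon> \<phi> v = \<i> *s Lin I \<epsilon> \<phi> v"
  by (simp add: Lin_def vec_eq_iff)

text \<open>For a Hamiltonian matrix, the eigenspaces of \<open>\<lambda>\<close> and \<open>\<mu>\<close> are orthogonal for the symplectic form and for the energy unless
\<open>\<lambda> + \<mu> = 0\<close>. With \<open>\<mu>\<close> the conjugate of \<open>\<lambda>\<close> this is the case as soon as the real part \<open>a\<close> is nonzero.\<close>

lemma eigen_isotropic:
  fixes x y :: "('n::finite) state"
  assumes x: "Lin I \<epsilon> \<phi> x = a *\<^sub>R x - b *\<^sub>R y" and y: "Lin I \<epsilon> \<phi> y = b *\<^sub>R x + a *\<^sub>R y" and a: "a \<noteq> 0"
  shows "x \<bullet> (\<i> *s y) = 0" "x \<bullet> Hess I \<epsilon> \<phi> x = 0" "y \<bullet> Hess I \<epsilon> \<phi> y = 0"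
proof -
  have Hx: "Hess I \<epsilon> \<phi> x = a *\<^sub>R (\<i> *s x) - b *\<^sub>R (\<i> *s y)"
    unfolding Hess_Lin x by (simp add: vec_eq_iff algebra_simps)
  have Hy: "Hess I \<epsilon> \<phi> y = b *\<^sub>R (\<i> *s x) + a *\<^sub>R (\<i> *s y)"
    unfolding Hess_Lin y by (simp add: vec_eq_iff algebra_simps)
  have "y \<bullet> Hess I \<epsilon> \<phi> x = x \<bullet> Hess I \<epsilon> \<phi> y"
    using Hess_symmetric[of x I \<epsilon> \<phi> y] by (simp add: inner_commute)
  then have "a * (y \<bullet> (\<i> *s x)) = a * (x \<bullet> (\<i> *s y))"
    unfolding Hx Hy by (simp add: inner_diff_right inner_add_right inner_rot(1))
  then have "y \<bullet> (\<i> *s x) = x \<bullet> (\<i> *s y)" using a by simp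
  then show 0: "x \<bullet> (\<i> *s y) = 0" using inner_rot(2)[of x y] by linarith
  then show "x \<bullet> Hess I \<epsilon> \<phi> x = 0" unfolding Hx by (simp add: inner_diff_right inner_rot(1))
  from 0 have "y \<bullet> (\<i> *s x) = 0" using inner_rot(2)[of x y] by linarith
  then show "y \<bullet> Hess I \<epsilon> \<phi> y = 0" unfolding Hy by (simp add: inner_add_right inner_rot(1))
qed

text \<open>A complexified vector \<open>(x, y)\<close> over \<open>\<complex>\<close> splits into the components \<open>x + i y\<close> and \<open>x - i y\<close>, on which multiplication by
\<open>c\<close> has eigenvalues \<open>c\<close> and the conjugate of \<open>c\<close>; this diagonalises the free oscillators.\<close>

lemma complex_pair_eigen:
  assumes "of_real a * x - of_real b * y = c * x" "of_real b * x + of_real a * y = c * (y :: complex)"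
  shows "(Complex a b - c) * (x + \<i> * y) = 0" "(Complex a (- b) - c) * (x - \<i> * y) = 0"
proof -
  have C: "Complex a b = of_real a + \<i> * of_real b" "Complex a (- b) = of_real a - \<i> * of_real b"
    by (simp_all add: complex_eq_iff)
  have "(Complex a b - c) * (x + \<i> * y)
     = (of_real a * x - of_real b * y - c * x) + \<i> * (of_real b * x + of_real a * y - c * y)"
    unfolding C by (simp add: algebra_simps)
  then show "(Complex a b - c) * (x + \<i> * y) = 0" using assms by simp
  have "(Complex a (- b) - c) * (x - \<i> * y)
     = (of_real a * x - of_real b * y - c * x) - \<i> * (of_real b * x + of_real a * y - c * y)"
    unfolding C by (simp add: algebra_simps)
  then show "(Complex a (- b) - c) * (x - \<i> * y) = 0" using assms by simp
qed

lemma pm_zero: "x + \<i> * y = 0 \<Longrightarrow> x - \<i> * y = 0 \<Longrightarrow> x = 0 \<and> y = (0::complex)"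
proof -
  assume "x + \<i> * y = 0" "x - \<i> * y = 0"
  then have "2 * x = 0" "2 * \<i> * y = 0" by (algebra, algebra)
  then show ?thesis by simp
qed

text \<open>On the two components the symplectic form is definite, with opposite signs.\<close>

lemma pm_inner: "4 * (x \<bullet> (\<i> * y)) = (cmod (x + \<i> * y))\<^sup>2 - (cmod (x - \<i> * y))\<^sup>2"
  unfolding cmod_power2 by (simp add: inner_complex_def power2_eq_square algebra_simps)

text \<open>With \<open>(s, t)\<close> the inverse of the eigenvalue, which is bounded, the unknowns range over a compact set, and the claim need
only be checked for \<open>e = 0\<close>. There the excited sites drop out since the linearisation is nilpotent on them, and of the two
components of the empty sites at most one, the same on all of them, can be nonzero. Then the symplectic form is
definite.\<close>

lemma no_fast_isotropic_mode:
  fixes \<sigma> :: "real ^ ('n::finite bit1)"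
  assumes I: "I > 0" and u: "cmod u = 1"
    and \<sigma>: "sign_pattern \<sigma>"
  shows "\<forall>\<^sub>F (e, \<phi>) in nhds (0, config I u \<sigma>). \<forall>x y a b.
     Lin I (e\<^sup>2) \<phi> x = a *\<^sub>R x - b *\<^sub>R y \<longrightarrow> Lin I (e\<^sup>2) \<phi> y = b *\<^sub>R x + a *\<^sub>R y \<longrightarrow>
     x \<bullet> (\<i> *s y) = 0 \<longrightarrow> (x, y) \<noteq> 0 \<longrightarrow> a\<^sup>2 + b\<^sup>2 < (I / 2)\<^sup>2"
proof -
  note on = sign_pattern_on[OF \<sigma>] and off = sign_pattern_off[OF \<sigma>]
  define F :: "(real \<times> 'n state) \<times> ((real \<times> real) \<times> ('n state \<times> 'n state)) \<Rightarrow> 'n state \<times> 'n state \<times> real" where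
    "F = (\<lambda>((e, \<phi>), ((s, t), (x, y))).
      (x - s *\<^sub>R Lin I (e\<^sup>2) \<phi> x + t *\<^sub>R Lin I (e\<^sup>2) \<phi> y,
       y - t *\<^sub>R Lin I (e\<^sup>2) \<phi> x - s *\<^sub>R Lin I (e\<^sup>2) \<phi> y, x \<bullet> (\<i> *s y)))"
  let ?\<phi> = "config I u \<sigma>"
  let ?K = "cball (0 :: real \<times> real) (2 / I) \<times> sphere (0 :: 'n state \<times> 'n state) 1"
  have cl: "continuous_on A (\<lambda>x. Lin I (f x) (g x) (h x))"
    if "continuous_on A f" "continuous_on A g" "continuous_on A h"
    for A f g h
    unfolding Lin_def Hess_def by (intro continuous_intros that)
  have cJ: "continuous_on A (\<lambda>x. \<i> *s f x)" if "continuous_on A f" for A and f :: "_ \<Rightarrow> 'n state"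
    unfolding vector_scalar_mult_def by (intro continuous_intros that)
  have cont: "continuous_on UNIV F"
    unfolding F_def case_prod_unfold by (intro continuous_on_Pair continuous_intros cl cJ)
  have nz: "F ((0, ?\<phi>), w) \<noteq> 0" if w: "w \<in> ?K" for w
  proof
    assume F0: "F ((0, ?\<phi>), w) = 0"
    obtain s t x y where wd: "w = ((s, t), (x, y))" by (cases w; cases "fst w"; cases "snd w") auto
    have n1: "norm (x, y) = 1" using w by (simp add: wd)
    let ?L = "Lin I 0 ?\<phi>"
    have ex: "x = s *\<^sub>R ?L x - t *\<^sub>R ?L y" and ey: "y = t *\<^sub>R ?L x + s *\<^sub>R ?L y" and om: "x \<bullet> (\<i> *s y) = 0"
      using F0 by (simp_all add: F_def wd zero_prod_def algebra_simps)
    have exj: "x $ j = of_real s * ?L x $ j - of_real t * ?L y $ j" "y $ j = of_real t * ?L x $ j + of_real s * ?L y $ j" for j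
      using ex ey by (metis vector_minus_component vector_add_component vector_scaleR_component scaleR_conv_of_real)+
    have S: "x $ j = 0 \<and> y $ j = 0" if j: "j \<in> sites" for j
    proof -
      let ?p = "?\<phi> $ j"
      have cp: "cmod ?p = sqrt I" by (rule config_site[OF I u on[OF j]])
      then have p0: "?p \<noteq> 0" using I by auto
      note L = Lin_0_on[OF cp I]
      have re: "Re (cnj ?p * ?L v $ j) = 0" for v unfolding L by simp
      have rr: "Re (of_real r * c) = r * Re c" for r c by simp
      have x1: "cnj ?p * x $ j = of_real s * (cnj ?p * ?L x $ j) - of_real t * (cnj ?p * ?L y $ j)"
        by (subst exj(1)) (simp add: algebra_simps)
      have y1: "cnj ?p * y $ j = of_real t * (cnj ?p * ?L x $ j) + of_real s * (cnj ?p * ?L y $ j)"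
        by (subst exj(2)) (simp add: algebra_simps)
      have "Re (cnj ?p * x $ j) = 0" unfolding x1 minus_complex.sel rr re by simp
      then have Lx: "cnj ?p * ?L x $ j = 0" unfolding L by simp
      have "Re (cnj ?p * y $ j) = 0" unfolding y1 plus_complex.sel rr re by simp
      then have Ly: "cnj ?p * ?L y $ j = 0" unfolding L by simp
      show ?thesis using x1 y1 Lx Ly p0 by simp
    qed
    let ?z = "Complex s t"
    have O: "(1 - ?z * (\<i> * of_real I)) * (x $ j + \<i> * y $ j) = 0"
      "(1 - cnj ?z * (\<i> * of_real I)) * (x $ j - \<i> * y $ j) = 0" if j: "j \<notin> sites" for j
    proof -
      have p: "?\<phi> $ j = 0" using off[OF j] by (simp add: config_def)
      have xx: "x $ j = of_real s * (\<i> * of_real I * x $ j) - of_real t * (\<i> * of_real I * y $ j)"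
        using exj(1)[of j] unfolding Lin_0_off[OF p] .
      have yy: "y $ j = of_real t * (\<i> * of_real I * x $ j) + of_real s * (\<i> * of_real I * y $ j)"
        using exj(2)[of j] unfolding Lin_0_off[OF p] .
      have C: "?z = of_real s + \<i> * of_real t" "cnj ?z = of_real s - \<i> * of_real t"
        by (simp_all add: complex_eq_iff)
      have "?z * (\<i> * of_real I) * (x $ j + \<i> * y $ j)
        = (of_real s * (\<i> * of_real I * x $ j) - of_real t * (\<i> * of_real I * y $ j))
          + \<i> * (of_real t * (\<i> * of_real I * x $ j) + of_real s * (\<i> * of_real I * y $ j))"
        unfolding C by (simp add: algebra_simps)
      also have "\<dots> = x $ j + \<i> * y $ j" unfolding xx[symmetric] yy[symmetric] ..
      finally have "?z * (\<i> * of_real I) * (x $ j + \<i> * y $ j) = x $ j + \<i> * y $ j" .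
      then show "(1 - ?z * (\<i> * of_real I)) * (x $ j + \<i> * y $ j) = 0" by (simp add: algebra_simps)
      have "cnj ?z * (\<i> * of_real I) * (x $ j - \<i> * y $ j)
        = (of_real s * (\<i> * of_real I * x $ j) - of_real t * (\<i> * of_real I * y $ j))
          - \<i> * (of_real t * (\<i> * of_real I * x $ j) + of_real s * (\<i> * of_real I * y $ j))"
        unfolding C by (simp add: algebra_simps)
      also have "\<dots> = x $ j - \<i> * y $ j" unfolding xx[symmetric] yy[symmetric] ..
      finally have "cnj ?z * (\<i> * of_real I) * (x $ j - \<i> * y $ j) = x $ j - \<i> * y $ j" .
      then show "(1 - cnj ?z * (\<i> * of_real I)) * (x $ j - \<i> * y $ j) = 0" by (simp add: algebra_simps)
    qed
    \<comment> \<open>The symplectic form balances the two components, so if one vanishes everywhere both do.\<close>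
    have sumz: "(\<Sum>j\<in>UNIV. (cmod (x $ j + \<i> * y $ j))\<^sup>2) = (\<Sum>j\<in>UNIV. (cmod (x $ j - \<i> * y $ j))\<^sup>2)"
    proof -
      have "4 * (x \<bullet> (\<i> *s y)) = (\<Sum>j\<in>UNIV. (cmod (x $ j + \<i> * y $ j))\<^sup>2) - (\<Sum>j\<in>UNIV. (cmod (x $ j - \<i> * y $ j))\<^sup>2)"
        by (simp add: inner_vec_def sum_distrib_left pm_inner sum_subtractf)
      then show ?thesis using om by simp
    qed
    have "1 - ?z * (\<i> * of_real I) \<noteq> 0 \<or> 1 - cnj ?z * (\<i> * of_real I) \<noteq> 0"
    proof (rule ccontr)
      assume "\<not> ?thesis"
      then have "Im (?z * (\<i> * of_real I)) = 0" "Re (?z * (\<i> * of_real I)) = 1" "Re (cnj ?z * (\<i> * of_real I)) = 1"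
        by (auto simp: complex_eq_iff)
      then show False by simp
    qed
    then have "(\<forall>j. x $ j + \<i> * y $ j = 0) \<or> (\<forall>j. x $ j - \<i> * y $ j = 0)"
      using O S by (metis mult_eq_0_iff mult_zero_right add_0 diff_0_right)
    then have z: "(\<Sum>j\<in>UNIV. (cmod (x $ j + \<i> * y $ j))\<^sup>2) = 0" "(\<Sum>j\<in>UNIV. (cmod (x $ j - \<i> * y $ j))\<^sup>2) = 0"
      using sumz by auto
    have "\<forall>j. x $ j + \<i> * y $ j = 0" using z(1) by (simp add: sum_nonneg_eq_0_iff)
    moreover have "\<forall>j. x $ j - \<i> * y $ j = 0" using z(2) by (simp add: sum_nonneg_eq_0_iff)
    ultimately have "x $ j = 0 \<and> y $ j = 0" for j using pm_zero by blast
    then have "(x, y) = 0" by (simp add: vec_eq_iff zero_prod_def)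
    then show False using n1 by simp
  qed
  have "compact ?K" by (intro compact_Times compact_cball compact_sphere)
  from nonzero_persistence[OF cont this nz]
  have "\<forall>\<^sub>F p in nhds (0, ?\<phi>). \<forall>w\<in>?K. F (p, w) \<noteq> 0" by blast
  then show ?thesis
  proof eventually_elim
    case (elim p)
    note p = elim
    obtain e \<phi> where pd: "p = (e, \<phi>)" by (cases p)
    have "a\<^sup>2 + b\<^sup>2 < (I / 2)\<^sup>2"
      if ex: "Lin I (e\<^sup>2) \<phi> x = a *\<^sub>R x - b *\<^sub>R y" and ey: "Lin I (e\<^sup>2) \<phi> y = b *\<^sub>R x + a *\<^sub>R y"
        and om: "x \<bullet> (\<i> *s y) = 0" and ne: "(x, y) \<noteq> 0" for x y a b
    proof (rule ccontr)
      assume "\<not> ?thesis"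
      then have ge: "(I / 2)\<^sup>2 \<le> a\<^sup>2 + b\<^sup>2" by simp
      define d where "d = a\<^sup>2 + b\<^sup>2"
      have d: "d > 0" using ge I unfolding d_def by (meson half_gt_zero less_le_trans zero_less_power)
      define k where "k = inverse (norm (x, y))"
      have k: "k > 0" using ne by (simp add: k_def)
      let ?w = "((a / d, - b / d), (k *\<^sub>R x, k *\<^sub>R y))"
      have "norm (a / d, - b / d) = sqrt ((a\<^sup>2 + b\<^sup>2) / d\<^sup>2)"
        by (simp add: norm_Pair power_divide add_divide_distrib)
      also have "\<dots> = 1 / sqrt d" using d unfolding d_def[symmetric]
        by (simp add: power2_eq_square real_sqrt_divide)
      also have "\<dots> \<le> 2 / I"
      proof -
        have "I / 2 \<le> sqrt d" using real_sqrt_le_mono[OF ge] I by (simp add: d_def)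
        then show ?thesis using I d by (simp add: field_simps)
      qed
      finally have "norm (a / d, - b / d) \<le> 2 / I" .
      moreover have "norm (k *\<^sub>R x, k *\<^sub>R y) = 1"
      proof -
        have "norm (k *\<^sub>R (x, y)) = \<bar>k\<bar> * norm (x, y)" by (rule norm_scaleR)
        also have "\<dots> = 1" using k ne by (simp add: k_def)
        finally show ?thesis by (simp only: scaleR_Pair)
      qed
      ultimately have "?w \<in> ?K" by simp
      moreover have "F (p, ?w) = 0"
      proof -
        let ?L = "Lin I (e\<^sup>2) \<phi>"
        have lin: "?L (k *\<^sub>R v) = k *\<^sub>R ?L v" for v by (rule linear_scale[OF Lin_linear])
        have aa: "(a / d) * a + (b / d) * b = 1" 
        proof -
          have "(a / d) * a + (b / d) * b = (a\<^sup>2 + b\<^sup>2) / d" by (simp add: power2_eq_square add_divide_distrib)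
          then show ?thesis using d unfolding d_def[symmetric] by simp
        qed
        have hx: "x - ((a / d) *\<^sub>R ?L x + (b / d) *\<^sub>R ?L y) = 0"
        proof -
          have "(a / d) *\<^sub>R ?L x + (b / d) *\<^sub>R ?L y = ((a / d) * a + (b / d) * b) *\<^sub>R x"
            unfolding ex ey by (simp add: algebra_simps)
          then show ?thesis unfolding aa by simp
        qed
        have hy: "y - ((a / d) *\<^sub>R ?L y - (b / d) *\<^sub>R ?L x) = 0"
        proof -
          have "(a / d) *\<^sub>R ?L y - (b / d) *\<^sub>R ?L x = ((a / d) * a + (b / d) * b) *\<^sub>R y"
            unfolding ex ey by (simp add: algebra_simps)
          then show ?thesis unfolding aa by simp
        qed
        have "k *\<^sub>R x - (a / d) *\<^sub>R (k *\<^sub>R ?L x) + (- b / d) *\<^sub>R (k *\<^sub>R ?L y)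
            = k *\<^sub>R (x - ((a / d) *\<^sub>R ?L x + (b / d) *\<^sub>R ?L y))"
          by (simp add: scaleR_diff_right scaleR_add_right mult.commute)
        then have 1: "k *\<^sub>R x - (a / d) *\<^sub>R (k *\<^sub>R ?L x) + (- b / d) *\<^sub>R (k *\<^sub>R ?L y) = 0"
          unfolding hx by simp
        have "k *\<^sub>R y - (- b / d) *\<^sub>R (k *\<^sub>R ?L x) - (a / d) *\<^sub>R (k *\<^sub>R ?L y)
            = k *\<^sub>R (y - ((a / d) *\<^sub>R ?L y - (b / d) *\<^sub>R ?L x))"
          by (simp add: scaleR_diff_right mult.commute)
        then have 2: "k *\<^sub>R y - (- b / d) *\<^sub>R (k *\<^sub>R ?L x) - (a / d) *\<^sub>R (k *\<^sub>R ?L y) = 0"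
          unfolding hy by simp
        have J: "\<i> *s (k *\<^sub>R y) = k *\<^sub>R (\<i> *s y)" by (simp add: vec_eq_iff)
        have 3: "(k *\<^sub>R x) \<bullet> (\<i> *s (k *\<^sub>R y)) = 0" unfolding J by (simp add: om)
        show ?thesis unfolding F_def pd prod.case lin 1 2 3 by (simp add: zero_prod_def)
      qed
      ultimately show False using p by blast
    qed
    then show ?case unfolding pd prod.case by blast
  qed
qed

lemma inner_Hess_rescale:
  fixes \<phi> :: "('n::finite) state"
  assumes eq: "rot_field I (e\<^sup>2) \<phi> = 0"
  shows "rescale e \<phi> X \<bullet> Hess I (e\<^sup>2) \<phi> (rescale e \<phi> X) = e\<^sup>2 * (X \<bullet> scaled_Hess I e \<phi> X)"
proof -
  have "rescale e \<phi> X $ j \<bullet> Hess I (e\<^sup>2) \<phi> (rescale e \<phi> X) $ j = e\<^sup>2 * (X $ j \<bullet> scaled_Hess I e \<phi> X $ j)" for j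
  proof (cases "j \<in> sites")
    case True
    define c where "c = of_real (e * Re (X $ j)) + \<i> * complex_of_real (Im (X $ j))"
    let ?h = "Hess I (e\<^sup>2) \<phi> (rescale e \<phi> X) $ j" and ?K = "scaled_Hess I e \<phi> X $ j"
    have v: "rescale e \<phi> X $ j = \<phi> $ j * c" using True by (simp add: rescale_def c_def)
    have gen: "(p * c) \<bullet> h = c \<bullet> (cnj p * h)" for p h by (simp add: inner_complex_def algebra_simps)
    have "rescale e \<phi> X $ j \<bullet> ?h = c \<bullet> (cnj (\<phi> $ j) * ?h)"
      unfolding v by (rule gen)
    also have "\<dots> = e * Re (X $ j) * (e * Re ?K) + Im (X $ j) * (e\<^sup>2 * Im ?K)"
      unfolding Hess_rescale_site[OF eq True] by (simp add: inner_complex_def c_def)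
    finally show ?thesis by (simp add: inner_complex_def algebra_simps power2_eq_square)
  next
    case False
    then show ?thesis unfolding Hess_rescale_off[OF False]
      by (simp add: rescale_def inner_complex_def algebra_simps power2_eq_square)
  qed
  then show ?thesis by (simp add: inner_vec_def sum_distrib_left)
qed

lemma rescale_surj:
  assumes "e \<noteq> 0" "\<And>j. j \<in> sites \<Longrightarrow> \<phi> $ j \<noteq> 0"
  shows "\<exists>X. rescale e \<phi> X = v"
proof -
  define X where "X = (\<chi> j. if j \<in> sites then of_real (Re (v $ j / \<phi> $ j) / e) + \<i> * of_real (Im (v $ j / \<phi> $ j)) else v $ j / of_real e)"
  have "rescale e \<phi> X $ j = v $ j" for j
  proof (cases "j \<in> sites")
    case True
    have "of_real (e * Re (X $ j)) + \<i> * of_real (Im (X $ j)) = v $ j / \<phi> $ j"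
      using True assms(1) by (simp add: X_def complex_eq_iff)
    then show ?thesis using True assms(2) by (simp add: rescale_def)
  next
    case False
    then show ?thesis using assms(1) by (simp add: rescale_def X_def)
  qed
  then have "rescale e \<phi> X = v" by (simp add: vec_eq_iff)
  then show ?thesis ..
qed

text \<open>Rotating an equilibrium gives an equilibrium, so \<open>i\<phi>\<close> is a null vector of the Hessian.\<close>

lemma Hess_gauge: "rot_field I \<epsilon> \<phi> = 0 \<Longrightarrow> Hess I \<epsilon> \<phi> (\<i> *s \<phi>) = 0"
proof -
  assume eq: "rot_field I \<epsilon> \<phi> = 0"
  have "Hess I \<epsilon> \<phi> (\<i> *s \<phi>) $ j = \<i> * ((\<phi> $ j * cnj (\<phi> $ j) - of_real I) * \<phi> $ j + of_real \<epsilon> * lap \<phi> $ j)" for j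
    unfolding Hess_def lap_scale by (simp add: algebra_simps power2_eq_square)
  moreover have "(\<phi> $ j * cnj (\<phi> $ j) - of_real I) * \<phi> $ j + of_real \<epsilon> * lap \<phi> $ j = 0" for j
    using eq unfolding rot_field_zero_iff by blast
  ultimately show ?thesis by (simp add: vec_eq_iff)
qed

text \<open>The graph of the bonds is connected, so this energy vanishes on constants only.\<close>

lemma bond_lap_in_phase_form:
  fixes \<sigma> :: "real ^ ('n::finite bit1)"
  assumes n: "CARD('n) \<ge> 3" and \<sigma>: "sign_pattern \<sigma>" and one: "\<forall>j\<in>sites. \<sigma> $ j = 1"
  shows "(\<Sum>j\<in>sites. b $ j * bond_lap \<sigma> b j) = (b $ 0 - b $ 1)\<^sup>2 + (b $ 0 - b $ 2)\<^sup>2 + (b $ 1 - b $ 2)\<^sup>2 + (b $ 1 - b $ 3)\<^sup>2 + (b $ 2 - b $ 3)\<^sup>2"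
proof -
  have "\<sigma> $ 0 = 1" "\<sigma> $ 1 = 1" "\<sigma> $ 2 = 1" "\<sigma> $ 3 = 1" using one by (simp_all add: sites_def)
  then show ?thesis unfolding sum_sites[OF n] bond_lap_sites[OF n \<sigma>] by (simp add: power2_eq_square algebra_simps)
qed

text \<open>The inner product with \<open>i\<phi>\<close> over the excited sites: the weighted mean phase, which the gauge symmetry leaves free.\<close>

abbreviation phase_moment :: "'n state \<Rightarrow> ('n::finite) state \<Rightarrow> real" where
  "phase_moment \<phi> X \<equiv> (\<Sum>j\<in>sites. (cmod (\<phi> $ j))\<^sup>2 * Im (X $ j))"

text \<open>The eigenvalue equation \<open>- i K X = W + \<Gamma> i \<phi>\<close> on the empty sites. The term with \<open>\<phi>\<close> comes from splitting off the gauge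
direction; its coefficient \<open>\<Gamma>\<close> is eliminated by summing the equations of the excited sites, and the equation is multiplied by
the mass of these sites to avoid a division.\<close>

definition slow_row :: "real \<Rightarrow> real \<Rightarrow> 'n state \<Rightarrow> 'n state \<Rightarrow> 'n state \<Rightarrow> ('n::finite) state" where
  "slow_row I e \<phi> X W = (\<chi> j. if j \<in> sites then 0 else
     of_real (\<Sum>k\<in>sites. (cmod (\<phi> $ k))\<^sup>2) * (W $ j + \<i> * scaled_Hess I e \<phi> X $ j)
     - of_real (\<Sum>k\<in>sites. Re (scaled_Hess I e \<phi> X $ k)) * (\<i> * \<phi> $ j))"

lemma slow_row_scale: "slow_row I e \<phi> (k *\<^sub>R X) (k *\<^sub>R W) = k *\<^sub>R slow_row I e \<phi> X W"
proof -
  have "(\<Sum>j\<in>sites. k * Re (scaled_Hess I e \<phi> X $ j)) = k * (\<Sum>j\<in>sites. Re (scaled_Hess I e \<phi> X $ j))"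
    by (simp add: sum_distrib_left)
  then show ?thesis
    unfolding slow_row_def linear_scale[OF linear_scaled_Hess]
    by (auto simp: vec_eq_iff scaleR_conv_of_real[of _ "z::complex" for z] algebra_simps)
qed

text \<open>On the excited sites only the sum of the imaginary parts of the equations is used; it determines \<open>\<gamma>\<close>, as \<open>W\<close> is
normalised to have no gauge component.\<close>

lemma slow_row_eigen:
  fixes \<phi> :: "('n::finite) state"
  assumes e: "e > 0" and eq: "rot_field I (e\<^sup>2) \<phi> = 0"
    and L: "Lin I (e\<^sup>2) \<phi> (rescale e \<phi> X) = rescale e \<phi> W + \<gamma> *\<^sub>R (\<i> *s \<phi>)"
    and W: "phase_moment \<phi> W = 0"
  shows "slow_row I e \<phi> X W = 0"
proof -
  let ?K = "scaled_Hess I e \<phi> X"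
  define R where "R = (\<Sum>k\<in>sites. (cmod (\<phi> $ k))\<^sup>2)"
  have Lj: "- \<i> * Hess I (e\<^sup>2) \<phi> (rescale e \<phi> X) $ j = rescale e \<phi> W $ j + of_real \<gamma> * (\<i> * \<phi> $ j)" for j
  proof -
    have "Lin I (e\<^sup>2) \<phi> (rescale e \<phi> X) $ j = (rescale e \<phi> W + \<gamma> *\<^sub>R (\<i> *s \<phi>)) $ j" by (simp only: L)
    then show ?thesis by (simp add: Lin_def scaleR_conv_of_real[of _ "z::complex" for z])
  qed
  have "- e * Re (?K $ j) = (cmod (\<phi> $ j))\<^sup>2 * Im (W $ j) + \<gamma> * (cmod (\<phi> $ j))\<^sup>2" if j: "j \<in> sites" for j
  proof -
    define r where "r = (cmod (\<phi> $ j))\<^sup>2"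
    have rr: "cnj (\<phi> $ j) * \<phi> $ j = of_real r" unfolding r_def complex_norm_square by (rule mult.commute)
    have "- \<i> * (cnj (\<phi> $ j) * Hess I (e\<^sup>2) \<phi> (rescale e \<phi> X) $ j) = cnj (\<phi> $ j) * (- \<i> * Hess I (e\<^sup>2) \<phi> (rescale e \<phi> X) $ j)"
      by simp
    also have "\<dots> = (cnj (\<phi> $ j) * \<phi> $ j) * (of_real (e * Re (W $ j)) + \<i> * of_real (Im (W $ j)) + of_real \<gamma> * \<i>)"
      unfolding Lj using j by (simp add: rescale_def algebra_simps)
    finally have "- \<i> * (of_real (e * Re (?K $ j)) + \<i> * of_real (e\<^sup>2 * Im (?K $ j)))
        = of_real r * (of_real (e * Re (W $ j)) + \<i> * of_real (Im (W $ j)) + of_real \<gamma> * \<i>)"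
      unfolding Hess_rescale_site[OF eq j] rr .
    then have "Im (- \<i> * (of_real (e * Re (?K $ j)) + \<i> * of_real (e\<^sup>2 * Im (?K $ j))))
        = Im (of_real r * (of_real (e * Re (W $ j)) + \<i> * of_real (Im (W $ j)) + of_real \<gamma> * \<i>))" by simp
    then show ?thesis by (simp add: r_def[symmetric] algebra_simps)
  qed
  then have "(\<Sum>j\<in>sites. - e * Re (?K $ j)) = (\<Sum>j\<in>sites. (cmod (\<phi> $ j))\<^sup>2 * Im (W $ j) + \<gamma> * (cmod (\<phi> $ j))\<^sup>2)"
    by (intro sum.cong) simp_all
  then have g: "- e * (\<Sum>j\<in>sites. Re (?K $ j)) = \<gamma> * R"
    unfolding sum.distrib W R_def by (simp add: sum_distrib_left sum_negf)
  have "of_real R * (W $ j + \<i> * ?K $ j) - of_real (\<Sum>k\<in>sites. Re (?K $ k)) * (\<i> * \<phi> $ j) = 0" if j: "j \<notin> sites" for j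
  proof -
    have "- \<i> * (of_real e * ?K $ j) = of_real e * W $ j + of_real \<gamma> * (\<i> * \<phi> $ j)"
      using Lj[of j] unfolding Hess_rescale_off[OF j] using j by (simp add: rescale_def)
    then have h: "of_real e * W $ j + \<i> * (of_real e * ?K $ j) = - of_real \<gamma> * (\<i> * \<phi> $ j)"
      by algebra
    have "of_real R * (of_real e * W $ j + \<i> * (of_real e * ?K $ j)) = - of_real (\<gamma> * R) * (\<i> * \<phi> $ j)"
      unfolding h by (simp add: algebra_simps)
    then have "of_real e * (of_real R * (W $ j + \<i> * ?K $ j) - of_real (\<Sum>k\<in>sites. Re (?K $ k)) * (\<i> * \<phi> $ j)) = 0"
      unfolding g[symmetric] by (simp add: algebra_simps)
    then show ?thesis using e by simp
  qed
  then show ?thesis unfolding slow_row_def R_def[symmetric] by (simp add: vec_eq_iff)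
qed

text \<open>Again compactness reduces the claim to \<open>e = 0\<close>. There a mode of frequency at most \<open>I / 2\<close> cannot live on the empty sites,
which oscillate with frequency \<open>I\<close>; and on the excited sites the energy is positive definite on phases of
mean zero.\<close>

lemma no_slow_isotropic_mode:
  fixes \<sigma> :: "real ^ ('n::finite bit1)"
  assumes n: "CARD('n) \<ge> 3" and I: "I > 0" and u: "cmod u = 1"
    and \<sigma>: "sign_pattern \<sigma>" and one: "\<forall>j\<in>sites. \<sigma> $ j = 1"
  shows "\<forall>\<^sub>F (e, \<phi>) in nhds (0, config I u \<sigma>). \<forall>X Y a b.
     a\<^sup>2 + b\<^sup>2 \<le> (I / 2)\<^sup>2 \<longrightarrow> slow_row I e \<phi> X (a *\<^sub>R X - b *\<^sub>R Y) = 0 \<longrightarrow> slow_row I e \<phi> Y (b *\<^sub>R X + a *\<^sub>R Y) = 0 \<longrightarrow>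
     X \<bullet> scaled_Hess I e \<phi> X = 0 \<longrightarrow> Y \<bullet> scaled_Hess I e \<phi> Y = 0 \<longrightarrow>
     phase_moment \<phi> X = 0 \<longrightarrow> phase_moment \<phi> Y = 0 \<longrightarrow>
     (X, Y) = 0"
proof -
  define F :: "(real \<times> 'n state) \<times> ((real \<times> real) \<times> ('n state \<times> 'n state)) \<Rightarrow>
      ('n state \<times> 'n state) \<times> (real \<times> real) \<times> (real \<times> real)" where
    "F = (\<lambda>((e, \<phi>), ((a, b), (X, Y))).
      ((slow_row I e \<phi> X (a *\<^sub>R X - b *\<^sub>R Y), slow_row I e \<phi> Y (b *\<^sub>R X + a *\<^sub>R Y)),
       (X \<bullet> scaled_Hess I e \<phi> X, Y \<bullet> scaled_Hess I e \<phi> Y),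
       phase_moment \<phi> X, phase_moment \<phi> Y))"
  let ?\<phi> = "config I u \<sigma>"
  let ?K = "cball (0 :: real \<times> real) (I / 2) \<times> sphere (0 :: 'n state \<times> 'n state) 1"
  note on = sign_pattern_on[OF \<sigma>] and off = sign_pattern_off[OF \<sigma>]
  have cs: "continuous_on A (\<lambda>x. slow_row I (f x) (g x) (h x) (w x))"
    if "continuous_on A f" "continuous_on A g" "continuous_on A h" "continuous_on A w" for A f g h w
    unfolding slow_row_def by (intro continuous_on_vec_lambda continuous_on_if_const continuous_intros that)
  have cont: "continuous_on UNIV F"
    unfolding F_def case_prod_unfold by (intro continuous_on_Pair continuous_intros cs)
  have mass: "(cmod (?\<phi> $ j))\<^sup>2 = I" if "j \<in> sites" for j
    using config_site[OF I u on[OF that]] I by simp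
  note K0 = scaled_Hess_0[OF I u \<sigma>]
  have R: "(\<Sum>k\<in>sites. (cmod (?\<phi> $ k))\<^sup>2) = 4 * I"
    using mass unfolding sum_sites[OF n] by (simp add: sites_def)
  have definite: "X = 0" if q: "X \<bullet> scaled_Hess I 0 ?\<phi> X = 0" and m: "phase_moment ?\<phi> X = 0"
    and o: "\<And>j. j \<notin> sites \<Longrightarrow> X $ j = 0" for X :: "'n state"
  proof -
    define b :: "real ^ ('n bit1)" where "b = (\<chi> k. Im (X $ k))"
    have "X \<bullet> scaled_Hess I 0 ?\<phi> X = (\<Sum>j\<in>sites. X $ j \<bullet> scaled_Hess I 0 ?\<phi> X $ j)"
      unfolding inner_vec_def by (rule sum.mono_neutral_right) (use o in auto)
    also have "\<dots> = (\<Sum>j\<in>sites. 2 * I\<^sup>2 * (Re (X $ j))\<^sup>2 + I * (b $ j * bond_lap \<sigma> b j))"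
      by (rule sum.cong) (simp_all add: K0 inner_complex_def b_def power2_eq_square algebra_simps)
    also have "\<dots> = 2 * I\<^sup>2 * (\<Sum>j\<in>sites. (Re (X $ j))\<^sup>2) + I * (\<Sum>j\<in>sites. b $ j * bond_lap \<sigma> b j)"
      by (simp add: sum.distrib sum_distrib_left)
    finally have z: "2 * I\<^sup>2 * (\<Sum>j\<in>sites. (Re (X $ j))\<^sup>2) + I * (\<Sum>j\<in>sites. b $ j * bond_lap \<sigma> b j) = 0"
      using q by simp
    have p1: "(\<Sum>j\<in>sites. (Re (X $ j))\<^sup>2) \<ge> 0" by (simp add: sum_nonneg)
    note LF = bond_lap_in_phase_form[OF n \<sigma> one]
    have p2: "(\<Sum>j\<in>sites. b $ j * bond_lap \<sigma> b j) \<ge> 0" unfolding LF by simp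
    have "2 * I\<^sup>2 * (\<Sum>j\<in>sites. (Re (X $ j))\<^sup>2) \<ge> 0" "I * (\<Sum>j\<in>sites. b $ j * bond_lap \<sigma> b j) \<ge> 0"
      using p1 p2 I by simp_all
    then have "2 * I\<^sup>2 * (\<Sum>j\<in>sites. (Re (X $ j))\<^sup>2) = 0" "I * (\<Sum>j\<in>sites. b $ j * bond_lap \<sigma> b j) = 0"
      using z by linarith+
    then have z1: "(\<Sum>j\<in>sites. (Re (X $ j))\<^sup>2) = 0" and z2: "(\<Sum>j\<in>sites. b $ j * bond_lap \<sigma> b j) = 0"
      using I by simp_all
    have re: "Re (X $ j) = 0" if "j \<in> sites" for j
      using z1 that by (simp add: sum_nonneg_eq_0_iff)
    have sq: "(b $ 0 - b $ 1)\<^sup>2 \<ge> 0" "(b $ 0 - b $ 2)\<^sup>2 \<ge> 0" "(b $ 1 - b $ 2)\<^sup>2 \<ge> 0" "(b $ 1 - b $ 3)\<^sup>2 \<ge> 0" "(b $ 2 - b $ 3)\<^sup>2 \<ge> 0"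
      by simp_all
    have "(b $ 0 - b $ 1)\<^sup>2 = 0" "(b $ 0 - b $ 2)\<^sup>2 = 0" "(b $ 1 - b $ 3)\<^sup>2 = 0"
      using z2 sq unfolding LF by linarith+
    then have b: "b $ 1 = b $ 0" "b $ 2 = b $ 0" "b $ 3 = b $ 0" by simp_all
    have "phase_moment ?\<phi> X = (\<Sum>j\<in>sites. I * b $ j)"
      by (rule sum.cong) (simp_all add: mass b_def)
    also have "\<dots> = 4 * I * b $ 0" unfolding sum_sites[OF n] b by simp
    finally have "b $ 0 = 0" using m I by simp
    then have bz: "b $ j = 0" if "j \<in> sites" for j using that b by (auto simp: sites_def)
    have "X $ j = 0" for j
      using re[of j] bz[of j] o[of j] by (cases "j \<in> sites") (simp_all add: b_def complex_eq_iff)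
    then show ?thesis by (simp add: vec_eq_iff)
  qed
  have nz: "F ((0, ?\<phi>), w) \<noteq> 0" if w: "w \<in> ?K" for w
  proof
    assume F0: "F ((0, ?\<phi>), w) = 0"
    obtain a b X Y where wd: "w = ((a, b), (X, Y))" by (cases w; cases "fst w"; cases "snd w") auto
    have n1: "norm (X, Y) = 1" and ab: "norm (a, b) \<le> I / 2" using w by (simp_all add: wd)
    have r1: "slow_row I 0 ?\<phi> X (a *\<^sub>R X - b *\<^sub>R Y) = 0" and r2: "slow_row I 0 ?\<phi> Y (b *\<^sub>R X + a *\<^sub>R Y) = 0"
      and q: "X \<bullet> scaled_Hess I 0 ?\<phi> X = 0" "Y \<bullet> scaled_Hess I 0 ?\<phi> Y = 0"
      and m: "phase_moment ?\<phi> X = 0" "phase_moment ?\<phi> Y = 0"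
      using F0 by (simp_all add: F_def wd zero_prod_def)
    have o: "X $ j = 0 \<and> Y $ j = 0" if j: "j \<notin> sites" for j
    proof -
      have p: "?\<phi> $ j = 0" using off[OF j] by (simp add: config_def)
      have row: "W $ j = \<i> * of_real I * Z $ j" if "slow_row I 0 ?\<phi> Z W = 0" for Z W :: "'n state"
      proof -
        have "slow_row I 0 ?\<phi> Z W $ j = 0" using that by simp
        then have "of_real (4 * I) * (W $ j + \<i> * (- of_real I * Z $ j)) = 0"
          using j p by (simp add: slow_row_def R K0)
        then have "W $ j + \<i> * (- of_real I * Z $ j) = 0" using I by simp
        then show ?thesis by (simp add: algebra_simps)
      qed
      have e1: "of_real a * X $ j - of_real b * Y $ j = \<i> * of_real I * X $ j"
        using row[OF r1] by (simp add: scaleR_conv_of_real[of _ "z::complex" for z])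
      have e2: "of_real b * X $ j + of_real a * Y $ j = \<i> * of_real I * Y $ j"
        using row[OF r2] by (simp add: scaleR_conv_of_real[of _ "z::complex" for z])
      have ne: "z - \<i> * of_real I \<noteq> 0" if "cmod z \<le> I / 2" for z
      proof
        assume "z - \<i> * of_real I = 0"
        then have "cmod z = I" using I by (simp add: norm_mult)
        then show False using that I by simp
      qed
      have "cmod (Complex a b) \<le> I / 2" "cmod (Complex a (- b)) \<le> I / 2"
        using ab by (simp_all add: cmod_def norm_Pair)
      then have "X $ j + \<i> * Y $ j = 0" "X $ j - \<i> * Y $ j = 0"
        using complex_pair_eigen[OF e1 e2] ne by auto
      then show ?thesis by (rule pm_zero)
    qed
    have "X = 0" by (rule definite[OF q(1) m(1)]) (use o in blast)
    moreover have "Y = 0" by (rule definite[OF q(2) m(2)]) (use o in blast)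
    ultimately show False using n1 by simp
  qed
  have "compact ?K" by (intro compact_Times compact_cball compact_sphere)
  from nonzero_persistence[OF cont this nz]
  have "\<forall>\<^sub>F p in nhds (0, ?\<phi>). \<forall>w\<in>?K. F (p, w) \<noteq> 0" by blast
  then show ?thesis
  proof eventually_elim
    case (elim p)
    note p = elim
    obtain e \<phi> where pd: "p = (e, \<phi>)" by (cases p)
    have "(X, Y) = 0"
      if ab: "a\<^sup>2 + b\<^sup>2 \<le> (I / 2)\<^sup>2" and r1: "slow_row I e \<phi> X (a *\<^sub>R X - b *\<^sub>R Y) = 0" and r2: "slow_row I e \<phi> Y (b *\<^sub>R X + a *\<^sub>R Y) = 0"
        and q: "X \<bullet> scaled_Hess I e \<phi> X = 0" "Y \<bullet> scaled_Hess I e \<phi> Y = 0"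
        and m: "phase_moment \<phi> X = 0" "phase_moment \<phi> Y = 0"
      for X Y a b
    proof (rule ccontr)
      assume ne: "(X, Y) \<noteq> 0"
      define k where "k = inverse (norm (X, Y))"
      let ?w = "((a, b), (k *\<^sub>R X, k *\<^sub>R Y))"
      have "norm (k *\<^sub>R X, k *\<^sub>R Y) = 1"
      proof -
        have "norm (k *\<^sub>R (X, Y)) = \<bar>k\<bar> * norm (X, Y)" by (rule norm_scaleR)
        also have "\<dots> = 1" using ne by (simp add: k_def)
        finally show ?thesis by (simp only: scaleR_Pair)
      qed
      moreover have "norm (a, b) \<le> I / 2"
        using real_sqrt_le_mono[OF ab] I by (simp add: norm_Pair)
      ultimately have "?w \<in> ?K" by simp
      moreover have "F (p, ?w) = 0"
      proof -
        have 1: "a *\<^sub>R (k *\<^sub>R X) - b *\<^sub>R (k *\<^sub>R Y) = k *\<^sub>R (a *\<^sub>R X - b *\<^sub>R Y)"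
          "b *\<^sub>R (k *\<^sub>R X) + a *\<^sub>R (k *\<^sub>R Y) = k *\<^sub>R (b *\<^sub>R X + a *\<^sub>R Y)"
          by (simp_all add: scaleR_diff_right scaleR_add_right mult.commute)
        have 2: "phase_moment \<phi> (k *\<^sub>R Z) = k * phase_moment \<phi> Z" for Z
          by (simp add: sum_distrib_left mult_ac)
        show ?thesis
          unfolding F_def pd prod.case 1 2 slow_row_scale linear_scale[OF linear_scaled_Hess] r1 r2 m
          by (simp add: q zero_prod_def)
      qed
      ultimately show False using p by blast
    qed
    then show ?case unfolding pd prod.case by blast
  qed
qed

text \<open>An eigenvector with \<open>a \<noteq> 0\<close> is isotropic, hence slow. Subtracting its component along \<open>i\<phi>\<close> changes neither its image under
the linearisation nor its energy, so the rescaled remainder vanishes by \<open>no_slow_isotropic_mode\<close>. An eigenvector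
along \<open>i\<phi>\<close> has eigenvalue zero.\<close>

lemma in_phase_spectrum:
  fixes \<sigma> :: "real ^ ('n::finite bit1)"
  assumes n: "CARD('n) \<ge> 3" and I: "I > 0" and u: "cmod u = 1"
    and \<sigma>: "sign_pattern \<sigma>" and one: "\<forall>j\<in>sites. \<sigma> $ j = 1"
  shows "\<forall>\<^sub>F (e, \<phi>) in nhds (0, config I u \<sigma>). e > 0 \<longrightarrow> rot_field I (e\<^sup>2) \<phi> = 0 \<longrightarrow> (\<forall>j\<in>sites. \<phi> $ j \<noteq> 0) \<longrightarrow>
    imaginary_spectrum (Lin I (e\<^sup>2) \<phi>)"
proof -
  from no_fast_isotropic_mode[OF I u \<sigma>] no_slow_isotropic_mode[OF n I u \<sigma> one] show ?thesis
  proof eventually_elim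
    case (elim p)
    obtain e \<phi> where pd: "p = (e, \<phi>)" by (cases p)
    note fast = elim(1)[unfolded pd prod.case, rule_format]
    note slow = elim(2)[unfolded pd prod.case, rule_format]
    have "a = 0"
      if e: "e > 0" and eq: "rot_field I (e\<^sup>2) \<phi> = 0" and nz: "\<forall>j\<in>sites. \<phi> $ j \<noteq> 0"
        and Lx: "Lin I (e\<^sup>2) \<phi> x = a *\<^sub>R x - b *\<^sub>R y" and Ly: "Lin I (e\<^sup>2) \<phi> y = b *\<^sub>R x + a *\<^sub>R y"
        and ne: "x \<noteq> 0 \<or> y \<noteq> 0" for x y a b
    proof (rule ccontr)
      assume a: "a \<noteq> 0"
      note iso = eigen_isotropic[OF Lx Ly a]
      have "(x, y) \<noteq> 0" using ne by (simp add: zero_prod_def)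
      then have ab: "a\<^sup>2 + b\<^sup>2 \<le> (I / 2)\<^sup>2" using fast[OF Lx Ly iso(1)] by simp
      define R where "R = (\<Sum>j\<in>sites. (cmod (\<phi> $ j))\<^sup>2)"
      have R: "R > 0"
      proof -
        have "(cmod (\<phi> $ 0))\<^sup>2 \<le> R" unfolding R_def by (rule member_le_sum) (auto simp: sites_def)
        moreover have "(cmod (\<phi> $ 0))\<^sup>2 > 0" using nz by (simp add: sites_def)
        ultimately show ?thesis by linarith
      qed
      define g where "g = \<i> *s \<phi>"
      have Hg: "Hess I (e\<^sup>2) \<phi> g = 0" unfolding g_def by (rule Hess_gauge[OF eq])
      have Lg: "Lin I (e\<^sup>2) \<phi> g = 0" using Hg by (simp add: Lin_def vec_eq_iff)
      \<comment> \<open>The weighted mean of the phases is the component along \<open>g\<close>; removing it gives the normalisation of \<open>no_slow_isotropic_mode\<close>.\<close>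
      have reduce: "\<exists>X c. v = rescale e \<phi> X + c *\<^sub>R g \<and> phase_moment \<phi> X = 0" for v
      proof -
        define c where "c = (\<Sum>j\<in>sites. Im (cnj (\<phi> $ j) * v $ j)) / R"
        obtain X where X: "rescale e \<phi> X = v - c *\<^sub>R g" using rescale_surj[of e \<phi>] e nz by force
        have "(cmod (\<phi> $ j))\<^sup>2 * Im (X $ j) = Im (cnj (\<phi> $ j) * v $ j) - c * (cmod (\<phi> $ j))\<^sup>2" if j: "j \<in> sites" for j
        proof -
          define r where "r = (cmod (\<phi> $ j))\<^sup>2"
          have rr: "cnj (\<phi> $ j) * \<phi> $ j = of_real r" unfolding r_def complex_norm_square by (rule mult.commute)
          have sX: "rescale e \<phi> X $ j = v $ j - of_real c * (\<i> * \<phi> $ j)"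
            unfolding X g_def by (simp add: scaleR_conv_of_real[of _ "z::complex" for z])
          have "cnj (\<phi> $ j) * rescale e \<phi> X $ j = cnj (\<phi> $ j) * v $ j - \<i> * of_real c * (cnj (\<phi> $ j) * \<phi> $ j)"
            unfolding sX by (simp add: algebra_simps)
          moreover have "cnj (\<phi> $ j) * rescale e \<phi> X $ j = (cnj (\<phi> $ j) * \<phi> $ j) * (of_real (e * Re (X $ j)) + \<i> * of_real (Im (X $ j)))"
            using j by (simp add: rescale_def)
          ultimately have "of_real r * (of_real (e * Re (X $ j)) + \<i> * of_real (Im (X $ j))) = cnj (\<phi> $ j) * v $ j - \<i> * of_real c * of_real r"
            unfolding rr by simp
          then have "Im (of_real r * (of_real (e * Re (X $ j)) + \<i> * of_real (Im (X $ j)))) = Im (cnj (\<phi> $ j) * v $ j - \<i> * of_real c * of_real r)"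
            by (rule arg_cong)
          then show ?thesis unfolding r_def[symmetric] by simp
        qed
        then have "phase_moment \<phi> X = (\<Sum>j\<in>sites. Im (cnj (\<phi> $ j) * v $ j) - c * (cmod (\<phi> $ j))\<^sup>2)"
          by (intro sum.cong) simp_all
        also have "\<dots> = (\<Sum>j\<in>sites. Im (cnj (\<phi> $ j) * v $ j)) - c * R"
          unfolding sum_subtractf R_def sum_distrib_left ..
        also have "\<dots> = 0" using R by (simp add: c_def)
        finally show ?thesis using X by (intro exI[of _ X] exI[of _ c]) simp
      qed
      obtain X c where X: "x = rescale e \<phi> X + c *\<^sub>R g" "phase_moment \<phi> X = 0" using reduce by blast
      obtain Y d where Y: "y = rescale e \<phi> Y + d *\<^sub>R g" "phase_moment \<phi> Y = 0" using reduce by blast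
      note lin = linear_add[OF linear_rescale] linear_diff[OF linear_rescale] linear_scale[OF linear_rescale]
      have Lred: "Lin I (e\<^sup>2) \<phi> (rescale e \<phi> Z + k *\<^sub>R g) = Lin I (e\<^sup>2) \<phi> (rescale e \<phi> Z)" for Z k
        by (simp add: linear_add[OF Lin_linear] linear_scale[OF Lin_linear] Lg)
      have "Lin I (e\<^sup>2) \<phi> (rescale e \<phi> X) = a *\<^sub>R x - b *\<^sub>R y" using Lx unfolding X(1) Lred .
      also have "\<dots> = rescale e \<phi> (a *\<^sub>R X - b *\<^sub>R Y) + (a * c - b * d) *\<^sub>R g"
        unfolding X(1) Y(1) lin by (simp add: algebra_simps)
      finally have EX: "Lin I (e\<^sup>2) \<phi> (rescale e \<phi> X) = rescale e \<phi> (a *\<^sub>R X - b *\<^sub>R Y) + (a * c - b * d) *\<^sub>R g" .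
      have "Lin I (e\<^sup>2) \<phi> (rescale e \<phi> Y) = b *\<^sub>R x + a *\<^sub>R y" using Ly unfolding Y(1) Lred .
      also have "\<dots> = rescale e \<phi> (b *\<^sub>R X + a *\<^sub>R Y) + (b * c + a * d) *\<^sub>R g"
        unfolding X(1) Y(1) lin by (simp add: algebra_simps)
      finally have EY: "Lin I (e\<^sup>2) \<phi> (rescale e \<phi> Y) = rescale e \<phi> (b *\<^sub>R X + a *\<^sub>R Y) + (b * c + a * d) *\<^sub>R g" .
      have lc: "phase_moment \<phi> (k *\<^sub>R X + l *\<^sub>R Y) = 0" for k l
      proof -
        have "phase_moment \<phi> (k *\<^sub>R X + l *\<^sub>R Y)
          = k * phase_moment \<phi> X + l * phase_moment \<phi> Y"
          by (simp add: sum_distrib_left sum.distrib[symmetric] algebra_simps)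
        then show ?thesis unfolding X(2) Y(2) by simp
      qed
      have rX: "slow_row I e \<phi> X (a *\<^sub>R X - b *\<^sub>R Y) = 0"
        by (rule slow_row_eigen[OF e eq EX[unfolded g_def]]) (use lc[of a "- b"] in simp)
      have rY: "slow_row I e \<phi> Y (b *\<^sub>R X + a *\<^sub>R Y) = 0"
        by (rule slow_row_eigen[OF e eq EY[unfolded g_def]]) (rule lc)
      have quad: "Z \<bullet> scaled_Hess I e \<phi> Z = 0"
        if v: "v = rescale e \<phi> Z + k *\<^sub>R g" and z: "v \<bullet> Hess I (e\<^sup>2) \<phi> v = 0" for v Z k
      proof -
        have H: "Hess I (e\<^sup>2) \<phi> v = Hess I (e\<^sup>2) \<phi> (rescale e \<phi> Z)" unfolding v Hess_Lin Lred ..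
        have "g \<bullet> Hess I (e\<^sup>2) \<phi> v = 0" using Hess_symmetric[of g I "e\<^sup>2" \<phi> v] Hg by simp
        then have "rescale e \<phi> Z \<bullet> Hess I (e\<^sup>2) \<phi> v = 0" using z by (simp add: v inner_add_left)
        then have "e\<^sup>2 * (Z \<bullet> scaled_Hess I e \<phi> Z) = 0" unfolding H inner_Hess_rescale[OF eq] .
        then show ?thesis using e by simp
      qed
      have "(X, Y) = 0"
        by (rule slow[OF ab rX rY quad[OF X(1) iso(2)] quad[OF Y(1) iso(3)] X(2) Y(2)])
      then have "X = 0" "Y = 0" by (simp_all add: zero_prod_def)
      then have "Lin I (e\<^sup>2) \<phi> x = 0" "Lin I (e\<^sup>2) \<phi> y = 0"
        unfolding X(1) Y(1) Lred by (simp_all add: linear_0[OF linear_rescale] linear_0[OF Lin_linear])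
      then have z: "a *\<^sub>R x - b *\<^sub>R y = 0" "b *\<^sub>R x + a *\<^sub>R y = 0" using Lx Ly by simp_all
      define k where "k = a * a + b * b"
      have "k *\<^sub>R x = a *\<^sub>R (a *\<^sub>R x - b *\<^sub>R y) + b *\<^sub>R (b *\<^sub>R x + a *\<^sub>R y)"
        by (simp add: k_def algebra_simps)
      moreover have "k *\<^sub>R y = a *\<^sub>R (b *\<^sub>R x + a *\<^sub>R y) - b *\<^sub>R (a *\<^sub>R x - b *\<^sub>R y)"
        by (simp add: k_def algebra_simps)
      moreover have "k \<noteq> 0" using a by (simp add: k_def sum_squares_eq_zero_iff)
      ultimately have "x = 0 \<and> y = 0" unfolding z by simp
      then show False using ne by simp
    qed
    then show ?case unfolding pd prod.case imaginary_spectrum_def by blast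
  qed
qed

section \<open>Rotating waves as solutions of the lattice equation\<close>

lemma norm_smult: "norm (c *s v) = cmod c * norm (v :: complex ^ 'j::finite)"
  by (simp add: norm_vec_def norm_mult L2_set_right_distrib)

lemma rot_field_shift: "rot_field (-1) \<epsilon> \<phi> = rot_field I \<epsilon> \<phi> - (\<i> * of_real (1 + I)) *s \<phi>"
  by (simp add: rot_field_def vec_eq_iff algebra_simps)

lemma phase_deriv:
  "((\<lambda>t. exp (\<i> * of_real (w * t))) has_vector_derivative \<i> * of_real w * exp (\<i> * of_real (w * t))) (at t)"
proof -
  have "((\<lambda>z. exp (\<i> * (of_real w * z))) has_field_derivative \<i> * of_real w * exp (\<i> * (of_real w * of_real t))) (at (of_real t))"
    by (rule derivative_eq_intros refl | simp)+
  from has_vector_derivative_real_field[OF this] show ?thesis by simp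
qed

lemma rotating_wave_solution:
  assumes "rot_field I \<epsilon> \<phi> = 0"
  shows "zigzag_solution \<epsilon> (rotating_wave I \<phi>)"
  unfolding zigzag_solution_def zigzag_field_eq
proof
  fix t
  let ?c = "exp (- \<i> * of_real ((1 + I) * t))"
  have c: "cmod ?c = 1" by (simp add: norm_exp_eq_Re)
  have d: "((\<lambda>t. exp (- \<i> * of_real ((1 + I) * t))) has_vector_derivative - \<i> * of_real (1 + I) * ?c) (at t)"
    using phase_deriv[of "- (1 + I)" t] by (simp add: algebra_simps)
  have "((\<lambda>t. exp (- \<i> * of_real ((1 + I) * t)) * \<phi> $ j) has_vector_derivative (- \<i> * of_real (1 + I) * ?c) * \<phi> $ j) (at t)" for j
    by (rule bounded_linear.has_vector_derivative[OF bounded_linear_mult_left d])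
  moreover have "rot_field (-1) \<epsilon> (?c *s \<phi>) $ j = (- \<i> * of_real (1 + I) * ?c) * \<phi> $ j" for j
    unfolding rot_field_rotate[OF c] rot_field_shift[of _ _ I] assms by simp
  ultimately show "((rotating_wave I \<phi>) has_vector_derivative rot_field (-1) \<epsilon> (?c *s \<phi>)) (at t)"
    by (simp add: has_vector_derivative_vec_iff del: mult_minus_left)
qed

lemma rotating_frame:
  assumes "zigzag_solution \<epsilon> \<psi>"
  shows "((\<lambda>t. exp (\<i> * of_real ((1 + I) * t)) *s \<psi> t) has_vector_derivative
     rot_field I \<epsilon> (exp (\<i> * of_real ((1 + I) * t)) *s \<psi> t)) (at t)"
proof -
  let ?c = "exp (\<i> * of_real ((1 + I) * t))"
  have c: "cmod ?c = 1" by (simp add: norm_exp_eq_Re)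
  have "(\<psi> has_vector_derivative rot_field (-1) \<epsilon> (\<psi> t)) (at t)"
    using assms unfolding zigzag_solution_def zigzag_field_eq by blast
  then have "((\<lambda>t. \<psi> t $ j) has_vector_derivative rot_field (-1) \<epsilon> (\<psi> t) $ j) (at t)" for j
    using has_vector_derivative_vec_iff by blast
  from has_vector_derivative_mult[OF phase_deriv[of "1 + I" t] this]
  have "((\<lambda>t. exp (\<i> * of_real ((1 + I) * t)) * \<psi> t $ j) has_vector_derivative
      ?c * rot_field (-1) \<epsilon> (\<psi> t) $ j + \<i> * of_real (1 + I) * ?c * \<psi> t $ j) (at t)" for j .
  moreover have "rot_field I \<epsilon> (?c *s \<psi> t) $ j = ?c * rot_field (-1) \<epsilon> (\<psi> t) $ j + \<i> * of_real (1 + I) * ?c * \<psi> t $ j" for j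
    unfolding rot_field_rotate[OF c] rot_field_shift[of _ _ I] by (simp add: algebra_simps)
  ultimately show ?thesis by (simp add: has_vector_derivative_vec_iff)
qed

lemma tendsto_eventually_nhds:
  assumes "\<forall>\<^sub>F p in nhds p0. P p" "(f \<longlongrightarrow> p0) F"
  shows "\<forall>\<^sub>F x in F. P (f x)"
  using assms by (simp add: filterlim_iff)

lemma eventually_at_right_0_iff:
  "(\<forall>\<^sub>F \<epsilon> in at_right (0::real). P \<epsilon>) \<longleftrightarrow> (\<exists>\<epsilon>0>0. \<forall>\<epsilon>. 0 < \<epsilon> \<and> \<epsilon> < \<epsilon>0 \<longrightarrow> P \<epsilon>)"
  unfolding eventually_at_right_field by blast

lemma real_branch_rotating:
  assumes "cmod u = 1" "\<forall>j. ((X $ j)\<^sup>2 - I) * X $ j + \<epsilon> * lap X $ j = 0"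
  shows "rot_field I \<epsilon> (\<chi> j. of_real (X $ j) * u) = 0"
proof -
  have "(of_real (X $ j) * u * cnj (of_real (X $ j) * u) - of_real I) * (of_real (X $ j) * u)
      + of_real \<epsilon> * lap (\<chi> j. of_real (X $ j) * u) $ j = 0" for j
  proof -
    have uu: "u * cnj u = 1" using assms(1) complex_norm_square[of u] by simp
    have "of_real (X $ j) * u * cnj (of_real (X $ j) * u) = of_real ((X $ j)\<^sup>2) * (u * cnj u)"
      by (simp add: power2_eq_square algebra_simps)
    then have sq: "of_real (X $ j) * u * cnj (of_real (X $ j) * u) = of_real ((X $ j)\<^sup>2)" unfolding uu by simp
    have "(of_real ((X $ j)\<^sup>2) - of_real I) * (of_real (X $ j) * u) + of_real \<epsilon> * (of_real (lap X $ j) * u)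
        = of_real (((X $ j)\<^sup>2 - I) * X $ j + \<epsilon> * lap X $ j) * u"
      by (simp add: algebra_simps)
    then show ?thesis unfolding sq lap_of_real using assms(2) by simp
  qed
  then show ?thesis unfolding rot_field_zero_iff vec_lambda_beta by blast
qed

text \<open>The rotation is an isometry, so convergence of the amplitudes is uniform convergence in time of the waves.\<close>

lemma rotating_waves_can_be_continued:
  fixes \<sigma> :: "real ^ ('n::finite bit1)"
  assumes I: "I > 0" and u: "cmod u = 1" and T: "(1 + I) * T = 2 * pi"
    and \<sigma>: "sign_pattern \<sigma>"
  shows "can_be_continued T (rotating_wave I (config I u \<sigma>))"
proof -
  obtain X :: "real \<Rightarrow> real ^ ('n bit1)"
    where X: "\<forall>\<^sub>F \<epsilon> in nhds 0. \<forall>j. ((X \<epsilon> $ j)\<^sup>2 - I) * X \<epsilon> $ j + \<epsilon> * lap (X \<epsilon>) $ j = 0" "(X \<longlongrightarrow> sqrt I *\<^sub>R \<sigma>) (nhds 0)"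
    using real_branch[OF I \<sigma>] by blast
  define \<phi> where "\<phi> \<epsilon> = (\<chi> j. of_real (X \<epsilon> $ j) * u)" for \<epsilon>
  define \<psi> where "\<psi> \<epsilon> t = rotating_wave I (\<phi> \<epsilon>) t" for \<epsilon> t
  have le: "at_right 0 \<le> nhds (0::real)" by (rule at_within_le_nhds)
  have per: "exp (- \<i> * of_real ((1 + I) * (t + T))) = exp (- \<i> * of_real ((1 + I) * t))" for t
  proof -
    have "- \<i> * of_real ((1 + I) * (t + T)) = - \<i> * of_real ((1 + I) * t) - (of_real ((1 + I) * T) * \<i>)"
      by (simp add: algebra_simps)
    also have "\<dots> = - \<i> * of_real ((1 + I) * t) - (2 * of_real pi * \<i>)" unfolding T by simp
    finally have "exp (- \<i> * of_real ((1 + I) * (t + T))) = exp (- \<i> * of_real ((1 + I) * t)) / exp (2 * of_real pi * \<i>)"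
      by (simp only: exp_diff)
    then show ?thesis by simp
  qed
  have "\<forall>\<^sub>F \<epsilon> in at_right 0. \<forall>j. ((X \<epsilon> $ j)\<^sup>2 - I) * X \<epsilon> $ j + \<epsilon> * lap (X \<epsilon>) $ j = 0"
    using filter_leD[OF le X(1)] .
  then have "\<forall>\<^sub>F \<epsilon> in at_right 0. periodic_solution T \<epsilon> (\<psi> \<epsilon>)"
  proof (rule eventually_mono)
    fix \<epsilon> assume *: "\<forall>j. ((X \<epsilon> $ j)\<^sup>2 - I) * X \<epsilon> $ j + \<epsilon> * lap (X \<epsilon>) $ j = 0"
    have "rot_field I \<epsilon> (\<phi> \<epsilon>) = 0" unfolding \<phi>_def by (rule real_branch_rotating[OF u *])
    then show "periodic_solution T \<epsilon> (\<psi> \<epsilon>)"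
      unfolding periodic_solution_def using rotating_wave_solution[of I \<epsilon> "\<phi> \<epsilon>"] per
      by (simp add: \<psi>_def[abs_def])
  qed
  moreover have "uniform_limit UNIV \<psi> (rotating_wave I (config I u \<sigma>)) (at_right 0)"
  proof (rule uniform_limitI)
    fix r :: real assume r: "r > 0"
    have "((\<lambda>\<epsilon>. \<phi> \<epsilon>) \<longlongrightarrow> (\<chi> j. of_real ((sqrt I *\<^sub>R \<sigma>) $ j) * u)) (at_right 0)"
      unfolding \<phi>_def by (intro tendsto_intros tendsto_mono[OF le X(2)])
    then have "(\<phi> \<longlongrightarrow> config I u \<sigma>) (at_right 0)" by (simp add: config_def)
    then have "\<forall>\<^sub>F \<epsilon> in at_right 0. dist (\<phi> \<epsilon>) (config I u \<sigma>) < r" using r by (rule tendstoD)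
    then show "\<forall>\<^sub>F \<epsilon> in at_right 0. \<forall>t\<in>UNIV. dist (\<psi> \<epsilon> t) (rotating_wave I (config I u \<sigma>) t) < r"
    proof (rule eventually_mono)
      fix \<epsilon> assume "dist (\<phi> \<epsilon>) (config I u \<sigma>) < r"
      moreover have "dist (c *s v) (c *s w) = cmod c * dist v w" for c and v w :: "'n state"
        unfolding dist_norm vector_ssub_ldistrib[symmetric] by (rule norm_smult)
      ultimately show "\<forall>t\<in>UNIV. dist (\<psi> \<epsilon> t) (rotating_wave I (config I u \<sigma>) t) < r"
        unfolding \<psi>_def by (simp add: norm_exp_eq_Re)
    qed
  qed
  ultimately show ?thesis
    unfolding can_be_continued_def is_continuation_def eventually_at_right_0_iff[symmetric] by blast
qed

section \<open>Stability and instability of every continuation\<close>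

text \<open>Uniform convergence keeps the whole orbit, seen in the rotating frame, near the equilibrium, where it must be constant.\<close>

lemma continuation_is_rotating_wave:
  fixes \<sigma> :: "real ^ ('n::finite bit1)"
  assumes I: "I > 0" and u: "cmod u = 1" and T: "(1 + I) * T = 2 * pi" "T > 0"
    and nonres: "exp (- \<i> * of_real (I * T)) \<noteq> 1"
    and \<sigma>: "sign_pattern \<sigma>"
    and cont: "is_continuation T (rotating_wave I (config I u \<sigma>)) \<psi>"
  shows "\<forall>\<^sub>F \<epsilon> in at_right 0. rot_field I \<epsilon> (\<psi> \<epsilon> 0) = 0 \<and> (\<forall>t. \<psi> \<epsilon> t = rotating_wave I (\<psi> \<epsilon> 0) t)"
    and "((\<lambda>\<epsilon>. (sqrt \<epsilon>, \<psi> \<epsilon> 0)) \<longlongrightarrow> (0, config I u \<sigma>)) (at_right 0)"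
proof -
  let ?\<phi> = "config I u \<sigma>"
  have ul: "uniform_limit UNIV \<psi> (\<lambda>t. rotating_wave I ?\<phi> t) (at_right 0)"
    and "\<exists>\<epsilon>star>0. \<forall>\<epsilon>. 0 < \<epsilon> \<and> \<epsilon> < \<epsilon>star \<longrightarrow> periodic_solution T \<epsilon> (\<psi> \<epsilon>)"
    using cont unfolding is_continuation_def by blast+
  then have ps: "\<forall>\<^sub>F \<epsilon> in at_right 0. periodic_solution T \<epsilon> (\<psi> \<epsilon>)"
    unfolding eventually_at_right_0_iff by blast
  have \<phi>0: "cmod (?\<phi> $ j) = sqrt I" if "j \<in> sites" for j by (rule config_site[OF I u sign_pattern_on[OF \<sigma> that]])
  have \<phi>0': "?\<phi> $ j = 0" if "j \<notin> sites" for j using sign_pattern_off[OF \<sigma> that] by (simp add: config_def)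
  have "\<exists>\<delta>>0. \<forall>\<epsilon> \<Phi>. \<bar>\<epsilon>\<bar> < \<delta> \<longrightarrow>
       (\<forall>t. (\<Phi> has_vector_derivative rot_field I \<epsilon> (\<Phi> t)) (at t)) \<longrightarrow>
       (\<forall>t. \<Phi> (t + T) = \<Phi> t) \<longrightarrow> (\<forall>t. norm (\<Phi> t - ?\<phi>) < \<delta>) \<longrightarrow>
       (\<forall>t. \<Phi> t = \<Phi> 0) \<and> rot_field I \<epsilon> (\<Phi> 0) = 0" (is "\<exists>\<delta>>0. ?P \<delta>")
    by (rule periodic_near_equilibrium_constant[OF I T(2) nonres]) (erule \<phi>0, erule \<phi>0')
  then obtain \<delta> where \<delta>: "\<delta> > 0" and const: "?P \<delta>"
    by (elim exE conjE)
  have near: "\<forall>\<^sub>F \<epsilon> in at_right 0. \<forall>t\<in>UNIV. dist (\<psi> \<epsilon> t) (rotating_wave I ?\<phi> t) < \<delta>"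
    by (rule uniform_limitD[OF ul \<delta>])
  have small: "\<forall>\<^sub>F \<epsilon> in at_right 0. \<epsilon> > 0 \<and> \<epsilon> < \<delta>"
    unfolding eventually_at_right_0_iff using \<delta> by blast
  from ps near small
  show "\<forall>\<^sub>F \<epsilon> in at_right 0. rot_field I \<epsilon> (\<psi> \<epsilon> 0) = 0 \<and> (\<forall>t. \<psi> \<epsilon> t = rotating_wave I (\<psi> \<epsilon> 0) t)"
  proof eventually_elim
    case (elim \<epsilon>)
    define \<Phi> where "\<Phi> t = exp (\<i> * of_real ((1 + I) * t)) *s \<psi> \<epsilon> t" for t
    have unrotate: "rotating_wave I (\<Phi> t) t = \<psi> \<epsilon> t" for t
      unfolding \<Phi>_def vector_smult_assoc exp_add[symmetric] by simp
    have d: "\<forall>t. (\<Phi> has_vector_derivative rot_field I \<epsilon> (\<Phi> t)) (at t)"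
      unfolding \<Phi>_def[abs_def]
      by (rule allI, rule rotating_frame) (use elim(1) in \<open>simp add: periodic_solution_def\<close>)
    have p: "\<forall>t. \<Phi> (t + T) = \<Phi> t"
    proof
      fix t
      have "\<i> * of_real ((1 + I) * (t + T)) = \<i> * of_real ((1 + I) * t) + of_real ((1 + I) * T) * \<i>"
        by (simp add: algebra_simps)
      also have "\<dots> = \<i> * of_real ((1 + I) * t) + 2 * of_real pi * \<i>" unfolding T by simp
      finally have "exp (\<i> * of_real ((1 + I) * (t + T))) = exp (\<i> * of_real ((1 + I) * t)) * exp (2 * of_real pi * \<i>)"
        by (simp only: exp_add)
      then have "exp (\<i> * of_real ((1 + I) * (t + T))) = exp (\<i> * of_real ((1 + I) * t))" by simp
      moreover have "\<psi> \<epsilon> (t + T) = \<psi> \<epsilon> t" using elim(1) unfolding periodic_solution_def by blast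
      ultimately show "\<Phi> (t + T) = \<Phi> t" by (simp only: \<Phi>_def)
    qed
    have nr: "\<forall>t. norm (\<Phi> t - ?\<phi>) < \<delta>"
    proof
      fix t
      let ?c = "exp (- \<i> * of_real ((1 + I) * t))"
      have "norm (\<Phi> t - ?\<phi>) = norm (?c *s (\<Phi> t - ?\<phi>))" unfolding norm_smult by (simp add: norm_exp_eq_Re)
      also have "\<dots> = dist (\<psi> \<epsilon> t) (?c *s ?\<phi>)" unfolding vector_ssub_ldistrib unrotate dist_norm ..
      finally show "norm (\<Phi> t - ?\<phi>) < \<delta>" using elim(2) by simp
    qed
    have "(\<forall>t. \<Phi> t = \<Phi> 0) \<and> rot_field I \<epsilon> (\<Phi> 0) = 0"
      by (rule const[THEN spec[of _ \<epsilon>], THEN spec[of _ \<Phi>], THEN mp, THEN mp, THEN mp, THEN mp])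
        (use elim(3) in simp, rule d, rule p, rule nr)
    then have c: "\<Phi> t = \<Phi> 0" and z: "rot_field I \<epsilon> (\<Phi> 0) = 0" for t by blast+
    have \<Phi>0: "\<Phi> 0 = \<psi> \<epsilon> 0" by (simp add: \<Phi>_def vec_eq_iff)
    have "\<psi> \<epsilon> t = rotating_wave I (\<psi> \<epsilon> 0) t" for t
      using unrotate[of t] unfolding c[of t] \<Phi>0 by (rule sym)
    then show ?case using z unfolding \<Phi>0 by blast
  qed
  have "((\<lambda>\<epsilon>. \<psi> \<epsilon> 0) \<longlongrightarrow> rotating_wave I ?\<phi> 0) (at_right 0)"
    by (rule tendsto_uniform_limitI[OF ul]) simp
  then have "((\<lambda>\<epsilon>. \<psi> \<epsilon> 0) \<longlongrightarrow> ?\<phi>) (at_right 0)" by (simp add: vec_eq_iff)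
  moreover have "(sqrt \<longlongrightarrow> 0) (at_right 0)"
    using tendsto_real_sqrt[OF tendsto_ident_at[of 0 "{0<..}"]] by simp
  ultimately show "((\<lambda>\<epsilon>. (sqrt \<epsilon>, \<psi> \<epsilon> 0)) \<longlongrightarrow> (0, ?\<phi>)) (at_right 0)" by (intro tendsto_Pair)
qed

lemma sites_nonzero_near:
  assumes "I > 0" "cmod u = 1" and \<sigma>: "sign_pattern \<sigma>"
    and lim: "((\<lambda>\<epsilon>. (sqrt \<epsilon>, \<psi> \<epsilon>)) \<longlongrightarrow> (0, config I u \<sigma>)) F"
  shows "\<forall>\<^sub>F \<epsilon> in F. \<forall>j\<in>sites. \<psi> \<epsilon> $ j \<noteq> 0"
proof -
  have l: "(\<psi> \<longlongrightarrow> config I u \<sigma>) F" using tendsto_snd[OF lim] by simp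
  have "\<forall>\<^sub>F \<epsilon> in F. \<psi> \<epsilon> $ j \<noteq> 0" if "j \<in> sites" for j
  proof (rule tendsto_imp_eventually_ne[OF tendsto_vec_nth[OF l]])
    show "config I u \<sigma> $ j \<noteq> 0" using config_site[OF assms(1,2) sign_pattern_on[OF \<sigma> that]] assms(1) by auto
  qed
  then show ?thesis by (intro eventually_ball_finite) (auto simp: sites_def)
qed

text \<open>Properties that hold near the limit point \<open>(0, \<phi>)\<close> of the rescaled problem pass to every continuation for small \<open>\<epsilon>\<close>.\<close>

lemma continuation_eventually:
  fixes \<sigma> :: "real ^ ('n::finite bit1)"
  assumes I: "I > 0" and u: "cmod u = 1" and T: "(1 + I) * T = 2 * pi" "T > 0"
    and nonres: "exp (- \<i> * of_real (I * T)) \<noteq> 1" and \<sigma>: "sign_pattern \<sigma>"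
    and cont: "is_continuation T (rotating_wave I (config I u \<sigma>)) \<psi>"
    and Q: "\<forall>\<^sub>F (e, \<phi>) in nhds (0, config I u \<sigma>). Q e \<phi>"
  shows "\<forall>\<^sub>F \<epsilon> in at_right 0. \<epsilon> > 0 \<and> rot_field I \<epsilon> (\<psi> \<epsilon> 0) = 0 \<and> (\<forall>j\<in>sites. \<psi> \<epsilon> 0 $ j \<noteq> 0) \<and>
    Q (sqrt \<epsilon>) (\<psi> \<epsilon> 0) \<and>
    is_monodromy (zigzag_real_field \<epsilon>) (\<lambda>t. to_real (\<psi> \<epsilon> t)) T (mexp (real_matrix (Lin I \<epsilon> (\<psi> \<epsilon> 0))) T)"
proof -
  have wave: "\<forall>\<^sub>F \<epsilon> in at_right 0. rot_field I \<epsilon> (\<psi> \<epsilon> 0) = 0 \<and> (\<forall>t. \<psi> \<epsilon> t = rotating_wave I (\<psi> \<epsilon> 0) t)"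
    and lim: "((\<lambda>\<epsilon>. (sqrt \<epsilon>, \<psi> \<epsilon> 0)) \<longlongrightarrow> (0, config I u \<sigma>)) (at_right 0)"
    by (rule continuation_is_rotating_wave[OF I u T nonres \<sigma> cont])+
  have pos: "\<forall>\<^sub>F \<epsilon> in at_right 0. (\<epsilon>::real) > 0" unfolding eventually_at_right_0_iff by (intro exI[of _ 1]) simp
  from tendsto_eventually_nhds[OF Q lim] wave sites_nonzero_near[OF I u \<sigma> lim] pos
  show ?thesis
  proof eventually_elim
    case (elim \<epsilon>)
    have "is_monodromy (zigzag_real_field \<epsilon>) (\<lambda>t. to_real (\<psi> \<epsilon> t)) T (mexp (real_matrix (Lin I \<epsilon> (\<psi> \<epsilon> 0))) T)"
      by (rule monodromy_of_rotating_wave[OF _ T(1)]) (use elim(2) in blast)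
    then show ?case using elim unfolding case_prod_conv by blast
  qed
qed

lemma stable_continuation:
  fixes \<sigma> :: "real ^ ('n::finite bit1)"
  assumes n: "CARD('n) \<ge> 3" and I: "I > 0" and u: "cmod u = 1" and T: "(1 + I) * T = 2 * pi" "T > 0"
    and nonres: "exp (- \<i> * of_real (I * T)) \<noteq> 1"
    and \<sigma>: "sign_pattern \<sigma>" and one: "\<forall>j\<in>sites. \<sigma> $ j = 1"
    and cont: "is_continuation T (rotating_wave I (config I u \<sigma>)) \<psi>"
  shows "\<forall>\<^sub>F \<epsilon> in at_right 0. linearly_stable T \<epsilon> (\<psi> \<epsilon>)"
  using continuation_eventually[OF I u T nonres \<sigma> cont in_phase_spectrum[OF n I u \<sigma> one]]
proof eventually_elim
  case (elim \<epsilon>)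
  note mono = elim[THEN conjunct2, THEN conjunct2, THEN conjunct2, THEN conjunct2]
  have spec: "imaginary_spectrum (Lin I \<epsilon> (\<psi> \<epsilon> 0))" using elim by simp
  show ?case unfolding linearly_stable_def
    by (rule exI, rule conjI, rule mono, intro allI impI) (erule stable_multipliers[OF Lin_linear spec])
qed

lemma unstable_continuation:
  fixes \<sigma> :: "real ^ ('n::finite bit1)"
  assumes n: "CARD('n) \<ge> 3" and I: "I > 0" and u: "cmod u = 1" and T: "(1 + I) * T = 2 * pi" "T > 0"
    and nonres: "exp (- \<i> * of_real (I * T)) \<noteq> 1" and \<sigma>: "sign_pattern \<sigma>"
    and ne: "\<not> (\<sigma> $ 0 * \<sigma> $ 1 = 1 \<and> \<sigma> $ 1 * \<sigma> $ 2 = 1 \<and> \<sigma> $ 2 * \<sigma> $ 3 = 1)"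
    and cont: "is_continuation T (rotating_wave I (config I u \<sigma>)) \<psi>"
  shows "\<forall>\<^sub>F \<epsilon> in at_right 0. linearly_unstable T \<epsilon> (\<psi> \<epsilon>)"
proof -
  obtain \<nu> b0 where b0: "simple_negative \<sigma> \<nu> b0"
    using bond_lap_simple_negative[OF n \<sigma> ne] by blast
  from continuation_eventually[OF I u T nonres \<sigma> cont unstable_direction[OF I u \<sigma> b0 bond_lap_symmetric[OF n \<sigma>]]]
  show ?thesis
  proof eventually_elim
    case (elim \<epsilon>)
    note mono = elim[THEN conjunct2, THEN conjunct2, THEN conjunct2, THEN conjunct2]
    let ?\<phi> = "\<psi> \<epsilon> 0" and ?e = "sqrt \<epsilon>"
    have sq: "?e\<^sup>2 = \<epsilon>" "?e > 0" using elim by simp_all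
    obtain s C where mode: "growing_mode I ?e ?\<phi> s C" using elim by blast
    have eq: "rot_field I (?e\<^sup>2) ?\<phi> = 0" unfolding sq(1) using elim by blast
    have nz: "?\<phi> $ j \<noteq> 0" if "j \<in> sites" for j using elim that by blast
    have "Lin I \<epsilon> ?\<phi> (rescale ?e ?\<phi> C) = (?e * s) *\<^sub>R rescale ?e ?\<phi> C"
      by (rule unstable_eigenvector(1)[OF sq(2) eq _ mode, unfolded sq(1)]) (erule nz)
    moreover have "rescale ?e ?\<phi> C \<noteq> 0"
      by (rule unstable_eigenvector(2)[OF sq(2) eq _ mode]) (erule nz)
    ultimately have "floquet_multiplier (mexp (real_matrix (Lin I \<epsilon> ?\<phi>)) T) (exp (of_real (?e * s * T)))"
      by (rule unstable_multiplier[OF Lin_linear])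
    moreover have "s > 0" using mode by (simp add: growing_mode_def)
    then have "cmod (exp (of_real (?e * s * T))) > 1"
      using sq(2) T(2) by (simp add: norm_exp_eq_Re)
    ultimately show ?case using mono unfolding linearly_unstable_def by blast
  qed
qed

text \<open>Phase differences in \<open>{0, \<pi>}\<close> can be added up through their cosines, all sines being zero.\<close>

lemma multiple_of_pi:
  assumes "a \<in> {0, pi}" "sin x = 0"
  shows "sin (x + a) = 0" "cos (x + a) = cos x * cos a" "cos a * cos a = 1" "cos a = 1 \<longleftrightarrow> a = 0"
  using assms by (auto simp: sin_add cos_add)

theorem mainTheorem3:
  fixes N :: nat and Istar \<omega> T q2 q3 q4 :: real and \<theta> :: "'n::finite bit1 \<Rightarrow> real"
  assumes "CARD('n) = N" and "6 \<le> N" and "N \<le> 10"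
    and "Istar > 0" and "\<omega> = 1 + Istar" and "T = 2 * pi / \<omega>"
    and "\<And>k::int. k \<noteq> 0 \<Longrightarrow>
           real_of_int k * \<omega> + 1 \<noteq> 0 \<and> real_of_int k * \<omega> - 1 \<noteq> 0 \<and>
           real_of_int k * \<omega> + 2 \<noteq> 0 \<and> real_of_int k * \<omega> - 2 \<noteq> 0"
    and "q2 = \<theta> 1 - \<theta> 0" and "q3 = \<theta> 2 - \<theta> 1" and "q4 = \<theta> 3 - \<theta> 2"
    and "q2 \<in> {0, pi}" and "q3 \<in> {0, pi}" and "q4 \<in> {0, pi}"
  shows "can_be_continued T (unperturbed_orbit Istar \<omega> \<theta>) \<and>
    (\<forall>\<psi>. is_continuation T (unperturbed_orbit Istar \<omega> \<theta>) \<psi> \<longrightarrow>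
      ((q2, q3, q4) = (0, 0, 0) \<longrightarrow>
         (\<exists>\<epsilon>0>0. \<forall>\<epsilon>. 0 < \<epsilon> \<and> \<epsilon> < \<epsilon>0 \<longrightarrow> linearly_stable T \<epsilon> (\<psi> \<epsilon>))) \<and>
      ((q2, q3, q4) \<in> {(0, 0, pi), (pi, 0, 0), (pi, 0, pi), (0, pi, 0),
                       (0, pi, pi), (pi, pi, 0), (pi, pi, pi)} \<longrightarrow>
         (\<exists>\<epsilon>0>0. \<forall>\<epsilon>. 0 < \<epsilon> \<and> \<epsilon> < \<epsilon>0 \<longrightarrow> linearly_unstable T \<epsilon> (\<psi> \<epsilon>))))"
proof -
  have n: "CARD('n) \<ge> 3" using assms(1,2) by simp
  note I = \<open>Istar > 0\<close>
  have w: "\<omega> > 0" using assms(4,5) by simp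
  have T: "(1 + Istar) * T = 2 * pi" "T > 0" using w assms(5,6) by simp_all
  have nonres: "exp (- \<i> * of_real (Istar * T)) \<noteq> 1"
  proof
    assume "exp (- \<i> * of_real (Istar * T)) = 1"
    \<comment> \<open>Resonance would force \<open>(m + 1) \<omega> = 1\<close>, since \<open>I T = 2 \<pi> - T\<close>.\<close>
    then obtain m :: int where m: "- (Istar * T) = of_int (2 * m) * pi" by (auto simp: exp_eq_1)
    have "Istar * T = 2 * pi - T" using T(1) by (simp add: algebra_simps)
    then have "T = 2 * pi * (of_int m + 1)" using m by (simp add: algebra_simps)
    then have "2 * pi * ((of_int m + 1) * \<omega>) = T * \<omega>" by simp
    also have "\<dots> = 2 * pi * 1" using assms(6) w by simp
    finally have k: "(of_int m + 1) * \<omega> = 1" using mult_cancel_left[of "2 * pi"] pi_gt_zero by simp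
    then have "of_int (m + 1) * \<omega> - 1 = 0" by simp
    moreover have "m + 1 \<noteq> 0"
    proof
      assume "m + 1 = 0"
      then have "(of_int (m + 1) :: real) = 0" by simp
      then show False using k by simp
    qed
    ultimately show False using assms(7)[of "m + 1"] by blast
  qed
  define u where "u = exp (- \<i> * complex_of_real (\<theta> 0))"
  have u: "cmod u = 1" by (simp add: u_def norm_exp_eq_Re)
  define \<sigma> :: "real ^ ('n bit1)" where "\<sigma> = (\<chi> j. if j \<in> sites then cos (\<theta> j - \<theta> 0) else 0)"
  have off: "\<sigma> $ j = 0" if "j \<notin> sites" for j using that by (simp add: \<sigma>_def)
  have d: "\<theta> 1 - \<theta> 0 = 0 + q2" "\<theta> 2 - \<theta> 0 = 0 + q2 + q3" "\<theta> 3 - \<theta> 0 = 0 + q2 + q3 + q4"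
    using assms(8-10) by simp_all
  note p2 = multiple_of_pi[OF assms(11) sin_zero]
  note p3 = multiple_of_pi[OF assms(12) p2(1)]
  note p4 = multiple_of_pi[OF assms(13) p3(1)]
  have sin0: "sin (\<theta> j - \<theta> 0) = 0" if "j \<in> sites" for j
    using that p2(1) p3(1) p4(1) by (auto simp: sites_def d[simplified])
  have \<sigma>: "\<sigma> $ 0 = 1" "\<sigma> $ 1 = cos q2" "\<sigma> $ 2 = cos q2 * cos q3" "\<sigma> $ 3 = cos q2 * cos q3 * cos q4"
    using p2(2) p3(2) p4(2) by (simp_all add: \<sigma>_def sites_def d[simplified])
  have on: "\<sigma> $ j * \<sigma> $ j = 1" if "j \<in> sites" for j
    using sin0[OF that] sin_cos_squared_add[of "\<theta> j - \<theta> 0"] that by (simp add: \<sigma>_def power2_eq_square)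
  have sp: "sign_pattern \<sigma>" unfolding sign_pattern_def using on off by blast
  have "unperturbed_orbit Istar \<omega> \<theta> t = rotating_wave Istar (config Istar u \<sigma>) t" for t
  proof -
    have "exp (- \<i> * complex_of_real (\<omega> * t + \<theta> j)) = exp (- \<i> * of_real (\<omega> * t)) * (of_real (\<sigma> $ j) * u)"
      if j: "j \<in> sites" for j
    proof -
      have "- \<i> * complex_of_real (\<omega> * t + \<theta> j)
          = - \<i> * of_real (\<omega> * t) + (- (\<i> * of_real (\<theta> j - \<theta> 0)) + - \<i> * of_real (\<theta> 0))"
        by (simp add: algebra_simps)
      moreover have "exp (- (\<i> * of_real x)) = complex_of_real (cos x)" if "sin x = 0" for x
        using that by (simp add: complex_eq_iff Re_exp Im_exp)
      then have "exp (- (\<i> * of_real (\<theta> j - \<theta> 0))) = complex_of_real (\<sigma> $ j)"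
        using sin0[OF j] j by (simp only: \<sigma>_def vec_lambda_beta if_True)
      ultimately show ?thesis unfolding u_def by (simp only: exp_add)
    qed
    then show ?thesis
      using off by (simp add: unperturbed_orbit_def config_def vec_eq_iff assms(5) sites_def)
  qed
  then have orbit: "unperturbed_orbit Istar \<omega> \<theta> = (rotating_wave Istar (config Istar u \<sigma>))"
    by (rule ext)
  have "can_be_continued T (unperturbed_orbit Istar \<omega> \<theta>)"
    unfolding orbit by (rule rotating_waves_can_be_continued[OF I u T(1) sp])
  moreover have "\<exists>\<epsilon>0>0. \<forall>\<epsilon>. 0 < \<epsilon> \<and> \<epsilon> < \<epsilon>0 \<longrightarrow> linearly_stable T \<epsilon> (\<psi> \<epsilon>)"
    if "is_continuation T (unperturbed_orbit Istar \<omega> \<theta>) \<psi>" "(q2, q3, q4) = (0, 0, 0)" for \<psi>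
  proof -
    have one: "\<forall>j\<in>sites. \<sigma> $ j = 1" using \<sigma> that(2) by (simp add: sites_def)
    show ?thesis unfolding eventually_at_right_0_iff[symmetric]
      by (rule stable_continuation[OF n I u T nonres sp one that(1)[unfolded orbit]])
  qed
  moreover have "\<exists>\<epsilon>0>0. \<forall>\<epsilon>. 0 < \<epsilon> \<and> \<epsilon> < \<epsilon>0 \<longrightarrow> linearly_unstable T \<epsilon> (\<psi> \<epsilon>)"
    if "is_continuation T (unperturbed_orbit Istar \<omega> \<theta>) \<psi>" "(q2, q3, q4) \<noteq> (0, 0, 0)" for \<psi>
  proof -
    have "\<sigma> $ 0 * \<sigma> $ 1 = cos q2" "\<sigma> $ 1 * \<sigma> $ 2 = (cos q2 * cos q2) * cos q3"
      "\<sigma> $ 2 * \<sigma> $ 3 = (cos q2 * cos q2) * (cos q3 * cos q3) * cos q4"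
      by (simp_all add: \<sigma> mult_ac)
    then have ne: "\<not> (\<sigma> $ 0 * \<sigma> $ 1 = 1 \<and> \<sigma> $ 1 * \<sigma> $ 2 = 1 \<and> \<sigma> $ 2 * \<sigma> $ 3 = 1)"
      using that(2) unfolding p2(3) p3(3) by (simp add: p2(4) p3(4) p4(4))
    show ?thesis unfolding eventually_at_right_0_iff[symmetric]
      by (rule unstable_continuation[OF n I u T nonres sp ne that(1)[unfolded orbit]])
  qed
  ultimately show ?thesis using pi_neq_zero by auto
qed

end
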